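(* Let $\overline{M}^{m+n}$ be a Riemannian manifold of dimension $m+n$, let $\Sigma$ be an $m$-dimensional submanifold isometrically immersed in $\overline{M}$ with $m\geq 2$, and let $q\in\Sigma$ be an umbilic point. Fix an integer $s$ with $0<s\leq m-1$. Then, for each $(s+n)$-dimensional submanifold $M$ of $\overline{M}$ through $q$ which is totally geodesic at $q$ and satisfies $T_q^{\bot}\Sigma\subset T_qM$, the mean curvature vector at $q$ of the submanifold $\Sigma\cap M$ coincides with the mean curvature vector of $\Sigma$ at $q$.
   Context: $T_q^{\bot}\Sigma$ denotes the normal space of $\Sigma$ at $q$ in $T_q\overline{M}$. For a $k$-dimensional isometrically immersed submanifold $S$ of $\overline{M}$, the second fundamental form ${\rm II}_S$ is defined by the Gauss formula $\overline{\nabla}_XY=\nabla^S_XY+{\rm II}_S(X,Y)$, where $\overline{\nabla}$ is the Levi-Civita connection of $\overline{M}$ and $\nabla^S$ the induced connection, and the mean curvature vector of $S$ at $p$ is ${\rm H}(p)=\frac1k\,{\rm trace}\,{\rm II}_S(p)$. A point $p\in S$ is umbilic if ${\rm II}_S(u,v)=\overline{g}(u,v)\,{\rm H}(p)$ for all $u,v\in T_pS$. A submanifold $M$ is totally geodesic at $q\in M$ if every geodesic of $M$ with initial vector in $T_qM$ is a geodesic of $\overline{M}$ for all parameters in some neighborhood of $0$. Near $q$, the intersection $\Sigma\cap M$ is an $s$-dimensional submanifold (since $T_qM+T_q\Sigma=T_q\overline{M}$), regarded as a submanifold of $\overline{M}$. *)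

theory Defs
  imports "HOL-Analysis.Analysis"
begin

text \<open>Intended for open \<open>S\<close>.\<close>

primrec Ck_on :: "nat \<Rightarrow> 'a::real_normed_vector set \<Rightarrow> ('a \<Rightarrow> 'b::real_normed_vector) \<Rightarrow> bool" where
  "Ck_on 0 S f \<longleftrightarrow> continuous_on S f"
| "Ck_on (Suc k) S f \<longleftrightarrow> (\<forall>x\<in>S. f differentiable (at x)) \<and>
     (\<forall>v. Ck_on k S (\<lambda>x. frechet_derivative f (at x) v))"

definition smooth_on :: "'a::real_normed_vector set \<Rightarrow> ('a \<Rightarrow> 'b::real_normed_vector) \<Rightarrow> bool" where
  "smooth_on S f \<longleftrightarrow> (\<forall>k. Ck_on k S f)"

type_synonym ('a, 'e) chart = "'a set \<times> ('a \<Rightarrow> 'e)"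

definition chart_inv :: "('a, 'e) chart \<Rightarrow> 'e \<Rightarrow> 'a" where
  "chart_inv c = inv_into (fst c) (snd c)"

record ('a, 'e) smooth_structure =
  mtop :: "'a topology"
  atlas :: "('a, 'e) chart set"

definition charts_at :: "('a, 'e, 'z) smooth_structure_scheme \<Rightarrow> 'a \<Rightarrow> ('a, 'e) chart set" where
  "charts_at M p = {c \<in> atlas M. p \<in> fst c}"

text \<open>The dimension of the manifold is \<open>DIM('e)\<close>. The atlas need not be maximal.\<close>

definition smooth_manifold :: "('a, 'e::euclidean_space, 'z) smooth_structure_scheme \<Rightarrow> bool" where
  "smooth_manifold M \<longleftrightarrow>
     Hausdorff_space (mtop M) \<and> second_countable (mtop M) \<and>
     topspace (mtop M) = (\<Union>c\<in>atlas M. fst c) \<and>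
     (\<forall>c\<in>atlas M. openin (mtop M) (fst c) \<and> open (snd c ` fst c) \<and>
        homeomorphic_map (subtopology (mtop M) (fst c)) (top_of_set (snd c ` fst c)) (snd c)) \<and>
     (\<forall>c\<in>atlas M. \<forall>d\<in>atlas M.
        smooth_on (snd c ` (fst c \<inter> fst d)) (snd d \<circ> chart_inv c))"

definition smooth_map ::
  "('a, 'e::euclidean_space, 'y) smooth_structure_scheme \<Rightarrow>
   ('b, 'f::euclidean_space, 'z) smooth_structure_scheme \<Rightarrow> ('a \<Rightarrow> 'b) \<Rightarrow> bool" where
  "smooth_map N M f \<longleftrightarrow>
     continuous_map (mtop N) (mtop M) f \<and>
     (\<forall>c\<in>atlas N. \<forall>d\<in>atlas M.
        smooth_on (snd c ` (fst c \<inter> f -` fst d)) (snd d \<circ> f \<circ> chart_inv c))"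

text \<open>
  A tangent vector at \<open>p\<close> is the family of its component vectors in all charts around \<open>p\<close>,
  related by the derivatives of the transition maps. Components in other charts are set
  to 0, so that equality of tangent vectors is equality of functions; the vector space
  operations are pointwise.
\<close>

type_synonym ('a, 'e) tvec = "('a, 'e) chart \<Rightarrow> 'e"

definition tangent_space ::
  "('a, 'e::euclidean_space, 'z) smooth_structure_scheme \<Rightarrow> 'a \<Rightarrow> ('a, 'e) tvec set" where
  "tangent_space M p = {u.
     (\<forall>c\<in>charts_at M p. \<forall>d\<in>charts_at M p.
        u d = frechet_derivative (snd d \<circ> chart_inv c) (at (snd c p)) (u c)) \<and>
     (\<forall>c. c \<notin> charts_at M p \<longrightarrow> u c = 0)}"

text \<open>The tangent vector at \<open>p\<close> whose component vector in the chart \<open>c\<close> is \<open>a\<close>.\<close>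

definition coord_vector ::
  "('a, 'e::euclidean_space, 'z) smooth_structure_scheme \<Rightarrow> ('a, 'e) chart \<Rightarrow> 'a \<Rightarrow> 'e \<Rightarrow> ('a, 'e) tvec"
  where
  "coord_vector M c p a = (\<lambda>d. if d \<in> charts_at M p
     then frechet_derivative (snd d \<circ> chart_inv c) (at (snd c p)) a else 0)"

text \<open>
  The derivative \<open>u[h]\<close> of a vector-valued function along a tangent vector \<open>u\<close> at \<open>p\<close>;
  by the transformation rule for \<open>u\<close> it does not depend on the chart.
\<close>

definition deriv_along ::
  "('a, 'e::euclidean_space, 'z) smooth_structure_scheme \<Rightarrow> 'a \<Rightarrow> ('a, 'e) tvec \<Rightarrow>
   ('a \<Rightarrow> 'v::real_normed_vector) \<Rightarrow> 'v" where
  "deriv_along M p u h =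
     (let c = (SOME c. c \<in> charts_at M p)
      in frechet_derivative (h \<circ> chart_inv c) (at (snd c p)) (u c))"

definition pushforward ::
  "('a, 'e::euclidean_space, 'y) smooth_structure_scheme \<Rightarrow>
   ('b, 'f::euclidean_space, 'z) smooth_structure_scheme \<Rightarrow> ('a \<Rightarrow> 'b) \<Rightarrow> 'a \<Rightarrow>
   ('a, 'e) tvec \<Rightarrow> ('b, 'f) tvec" where
  "pushforward N M f p u =
     (\<lambda>d. if d \<in> charts_at M (f p) then deriv_along N p u (snd d \<circ> f) else 0)"

definition immersion ::
  "('a, 'e::euclidean_space, 'y) smooth_structure_scheme \<Rightarrow>
   ('b, 'f::euclidean_space, 'z) smooth_structure_scheme \<Rightarrow> ('a \<Rightarrow> 'b) \<Rightarrow> bool" where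
  "immersion N M f \<longleftrightarrow> smooth_map N M f \<and>
     (\<forall>p\<in>topspace (mtop N). inj_on (pushforward N M f p) (tangent_space N p))"

definition vector_field_on ::
  "('a, 'e::euclidean_space, 'z) smooth_structure_scheme \<Rightarrow> 'a set \<Rightarrow> ('a \<Rightarrow> ('a, 'e) tvec) \<Rightarrow> bool"
  where
  "vector_field_on M W Y \<longleftrightarrow> openin (mtop M) W \<and>
     (\<forall>y\<in>W. Y y \<in> tangent_space M y) \<and>
     (\<forall>c\<in>atlas M. smooth_on (snd c ` (fst c \<inter> W)) (\<lambda>x. Y (chart_inv c x) c))"

record ('a, 'e) riemannian = "('a, 'e) smooth_structure" +
  metric :: "'a \<Rightarrow> (('a, 'e) chart \<Rightarrow> 'e) \<Rightarrow> (('a, 'e) chart \<Rightarrow> 'e) \<Rightarrow> real"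

definition metric_coeff ::
  "('a, 'e::euclidean_space) riemannian \<Rightarrow> ('a, 'e) chart \<Rightarrow> 'e \<Rightarrow> 'e \<Rightarrow> 'e \<Rightarrow> real" where
  "metric_coeff M c x a b =
     (let p = chart_inv c x in metric M p (coord_vector M c p a) (coord_vector M c p b))"

definition riemannian_manifold :: "('a, 'e::euclidean_space) riemannian \<Rightarrow> bool" where
  "riemannian_manifold M \<longleftrightarrow> smooth_manifold M \<and>
     (\<forall>p\<in>topspace (mtop M). \<forall>u\<in>tangent_space M p. \<forall>v\<in>tangent_space M p.
        metric M p u v = metric M p v u \<and>
        (\<forall>w\<in>tangent_space M p.
           metric M p (\<lambda>d. u d + v d) w = metric M p u w + metric M p v w) \<and>
        (\<forall>r. metric M p (\<lambda>d. r *\<^sub>R u d) v = r * metric M p u v) \<and>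
        (u \<noteq> (\<lambda>_. 0) \<longrightarrow> metric M p u u > 0)) \<and>
     (\<forall>c\<in>atlas M. \<forall>a b. smooth_on (snd c ` fst c) (\<lambda>x. metric_coeff M c x a b))"

definition isometric_immersion ::
  "('a, 'e::euclidean_space) riemannian \<Rightarrow> ('b, 'f::euclidean_space) riemannian \<Rightarrow> ('a \<Rightarrow> 'b) \<Rightarrow> bool"
  where
  "isometric_immersion N M f \<longleftrightarrow> immersion N M f \<and>
     (\<forall>p\<in>topspace (mtop N). \<forall>u\<in>tangent_space N p. \<forall>v\<in>tangent_space N p.
        metric N p u v = metric M (f p) (pushforward N M f p u) (pushforward N M f p v))"

text \<open>
  The Levi-Civita connection in the chart \<open>c\<close>: for the connection
  \<open>\<nabla>\<^sub>X Y = D Y(X) + \<Gamma>(X, Y)\<close>, the first condition says that the torsion vanishes, the second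
  that \<open>\<nabla>\<close> is compatible with the metric.
\<close>

definition christoffel ::
  "('a, 'e::euclidean_space) riemannian \<Rightarrow> ('a, 'e) chart \<Rightarrow> 'e \<Rightarrow> 'e \<Rightarrow> 'e \<Rightarrow> 'e" where
  "christoffel M c x = (THE \<Gamma>.
     (\<forall>a b. \<Gamma> a b = \<Gamma> b a) \<and>
     (\<forall>a b e. frechet_derivative (\<lambda>y. metric_coeff M c y a b) (at x) e =
        metric_coeff M c x (\<Gamma> e a) b + metric_coeff M c x a (\<Gamma> e b)))"

text \<open>
  The Levi-Civita covariant derivative of \<open>M\<close>, for vector fields \<open>Y\<close> along a map \<open>f\<close> from \<open>N\<close>
  to \<open>M\<close> (that is, \<open>Y y\<close> is tangent to \<open>M\<close> at \<open>f y\<close>), in direction of \<open>u\<close> tangent to \<open>N\<close> at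
  \<open>p\<close>. For \<open>N = M\<close> and \<open>f = id\<close> this is the Levi-Civita connection itself; for \<open>N\<close> an interval
  it is the covariant derivative along a curve.
\<close>

definition cov_deriv ::
  "('a, 'e::euclidean_space, 'z) smooth_structure_scheme \<Rightarrow> ('b, 'f::euclidean_space) riemannian \<Rightarrow>
   ('a \<Rightarrow> 'b) \<Rightarrow> 'a \<Rightarrow> ('a, 'e) tvec \<Rightarrow> ('a \<Rightarrow> ('b, 'f) tvec) \<Rightarrow> ('b, 'f) tvec" where
  "cov_deriv N M f p u Y = (\<lambda>d. if d \<in> charts_at M (f p)
     then deriv_along N p u (\<lambda>y. Y y d) +
          christoffel M d (snd d (f p)) (deriv_along N p u (snd d \<circ> f)) (Y p d)
     else 0)"

definition interval_manifold :: "real set \<Rightarrow> (real, real) smooth_structure" where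
  "interval_manifold I = \<lparr>mtop = top_of_set I, atlas = {(I, id)}\<rparr>"

definition unit_tangent :: "real set \<Rightarrow> real \<Rightarrow> (real, real) tvec" where
  "unit_tangent I t = coord_vector (interval_manifold I) (I, id) t 1"

definition velocity ::
  "('a, 'e::euclidean_space) riemannian \<Rightarrow> real set \<Rightarrow> (real \<Rightarrow> 'a) \<Rightarrow> real \<Rightarrow> ('a, 'e) tvec" where
  "velocity M I \<gamma> t = pushforward (interval_manifold I) M \<gamma> t (unit_tangent I t)"

definition geodesic ::
  "('a, 'e::euclidean_space) riemannian \<Rightarrow> real set \<Rightarrow> (real \<Rightarrow> 'a) \<Rightarrow> bool" where
  "geodesic M I \<gamma> \<longleftrightarrow> open I \<and> is_interval I \<and> smooth_map (interval_manifold I) M \<gamma> \<and>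
     (\<forall>t\<in>I. cov_deriv (interval_manifold I) M \<gamma> t (unit_tangent I t) (velocity M I \<gamma>) = (\<lambda>_. 0))"

text \<open>
  The Gauss formula: \<open>\<nabla>\<^sup>M\<^sub>X f\<^sub>*Y = f\<^sub>*(\<nabla>\<^sup>N\<^sub>X Y) + II(X, Y)\<close> for every local vector field \<open>Y\<close> of \<open>N\<close>
  extending \<open>v\<close>, with \<open>\<nabla>\<^sup>N\<close> the Levi-Civita connection of the induced metric.
\<close>

definition second_fundamental_form ::
  "('a, 'e::euclidean_space) riemannian \<Rightarrow> ('b, 'f::euclidean_space) riemannian \<Rightarrow> ('a \<Rightarrow> 'b) \<Rightarrow> 'a \<Rightarrow>
   ('a, 'e) tvec \<Rightarrow> ('a, 'e) tvec \<Rightarrow> ('b, 'f) tvec" where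
  "second_fundamental_form N M f p u v = (THE w.
     \<forall>W Y. vector_field_on N W Y \<and> p \<in> W \<and> Y p = v \<longrightarrow>
       cov_deriv N M f p u (\<lambda>y. pushforward N M f y (Y y)) =
       (\<lambda>d. pushforward N M f p (cov_deriv N N id p u Y) d + w d))"

definition orthonormal_basis ::
  "('a, 'e::euclidean_space) riemannian \<Rightarrow> 'a \<Rightarrow> ('a, 'e) tvec set \<Rightarrow> bool" where
  "orthonormal_basis M p E \<longleftrightarrow> finite E \<and> card E = DIM('e) \<and> E \<subseteq> tangent_space M p \<and>
     (\<forall>e\<in>E. \<forall>e'\<in>E. metric M p e e' = (if e = e' then 1 else 0))"

definition mean_curvature ::
  "('a, 'e::euclidean_space) riemannian \<Rightarrow> ('b, 'f::euclidean_space) riemannian \<Rightarrow> ('a \<Rightarrow> 'b) \<Rightarrow> 'a \<Rightarrow>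
   ('b, 'f) tvec" where
  "mean_curvature N M f p =
     (let E = (SOME E. orthonormal_basis N p E)
      in (\<lambda>d. (1 / real DIM('e)) *\<^sub>R (\<Sum>e\<in>E. second_fundamental_form N M f p e e d)))"

definition umbilic ::
  "('a, 'e::euclidean_space) riemannian \<Rightarrow> ('b, 'f::euclidean_space) riemannian \<Rightarrow> ('a \<Rightarrow> 'b) \<Rightarrow> 'a \<Rightarrow> bool"
  where
  "umbilic N M f p \<longleftrightarrow> (\<forall>u\<in>tangent_space N p. \<forall>v\<in>tangent_space N p.
     second_fundamental_form N M f p u v =
     (\<lambda>d. metric M (f p) (pushforward N M f p u) (pushforward N M f p v) *\<^sub>R mean_curvature N M f p d))"

definition normal_vectors ::
  "('a, 'e::euclidean_space) riemannian \<Rightarrow> ('b, 'f::euclidean_space) riemannian \<Rightarrow> ('a \<Rightarrow> 'b) \<Rightarrow> 'a \<Rightarrow>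
   ('b, 'f) tvec set" where
  "normal_vectors N M f p = {w \<in> tangent_space M (f p).
     \<forall>u\<in>tangent_space N p. metric M (f p) w (pushforward N M f p u) = 0}"

definition totally_geodesic_at ::
  "('a, 'e::euclidean_space) riemannian \<Rightarrow> ('b, 'f::euclidean_space) riemannian \<Rightarrow> ('a \<Rightarrow> 'b) \<Rightarrow> 'a \<Rightarrow> bool"
  where
  "totally_geodesic_at N M f p \<longleftrightarrow>
     (\<forall>I \<gamma>. geodesic N I \<gamma> \<and> 0 \<in> I \<and> \<gamma> 0 = p \<longrightarrow>
        (\<exists>\<epsilon>>0. {-\<epsilon><..<\<epsilon>} \<subseteq> I \<and> geodesic M {-\<epsilon><..<\<epsilon>} (f \<circ> \<gamma>)))"

text \<open>
  \<open>L\<close> makes the subset \<open>S\<close> of \<open>M\<close> an embedded Riemannian submanifold: it carries the subspace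
  topology, and the inclusion is an isometric immersion.
\<close>

definition embedded_submanifold ::
  "('b, 'f::euclidean_space) riemannian \<Rightarrow> 'b set \<Rightarrow> ('b, 'e::euclidean_space) riemannian \<Rightarrow> bool" where
  "embedded_submanifold M S L \<longleftrightarrow> S \<subseteq> topspace (mtop M) \<and> mtop L = subtopology (mtop M) S \<and>
     riemannian_manifold L \<and> isometric_immersion L M id"

end

theory Submission
  imports Defs
begin

text \<open>
  In charts, the second fundamental form of an immersion with local representative \<open>F\<close> is the
  covariant Hessian \<open>D\<^sup>2F(u, v) + \<Gamma>(DF u, DF v)\<close> minus a vector tangent to the immersed manifold.
  Lifting the inclusion of \<open>S = f(U) \<inter> h(V)\<close> through \<open>f\<close> and through \<open>h\<close> shows that the covariant
  Hessians at \<open>q\<close> in a direction \<open>u\<close> tangent to \<open>S\<close> agree modulo \<open>T\<Sigma>\<close> and modulo \<open>TM\<close>.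
  Since \<open>q\<close> is umbilic, \<open>II(u, u)\<close> for \<open>S\<close> equals \<open>\<bar>u\<bar>\<^sup>2 H\<close> modulo \<open>T\<Sigma>\<close>. Geodesics of \<open>M\<close> exist in
  every direction and are geodesics of the ambient manifold, so \<open>II\<close> of \<open>M\<close> vanishes on the diagonal at \<open>q\<close>, and
  as \<open>H\<close> is normal to \<open>\<Sigma>\<close>, hence tangent to \<open>M\<close>, the difference \<open>II(u, u) - \<bar>u\<bar>\<^sup>2 H\<close> also lies in \<open>TM\<close>.
  By transversality it is tangent to \<open>S\<close>; it is normal to \<open>S\<close> as well, and therefore zero.
\<close>

subsection \<open>Smooth functions\<close>

text \<open>Only the diagonal identity II(u, u) = g(u, u) H has to be shown: once it holds for all
  tangent \<open>u\<close>, every orthonormal basis that the definition of the mean curvature may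
  choose gives the same trace. Transversality is derived: a vector splits into a part tangent to
  \<Sigma> and a normal part, and the normal part is tangent to \<open>M\<close>. The intersection
  then has dimension m + (s + n) - (m + n) = s. The obstacle is that an arbitrary submanifold
  structure on the intersection is tied to \<open>f\<close> and \<open>h\<close> only by an
  inclusion of sets. Local left inverses of the two immersions, smooth on open sets of ambient
  coordinates, turn this inclusion into smooth lifts. Connection, second fundamental form and mean
  curvature are given by descriptions and choices, so each is first computed in charts: the Koszul
  formula determines the connection, and in the Gauss formula the derivative of the extending field
  cancels. Working modulo tangent vectors removes the Christoffel symbols of the submanifolds, which
  never have to be compared with one another.\<close>

abbreviation fderiv :: "('a::real_normed_vector \<Rightarrow> 'b::real_normed_vector) \<Rightarrow> 'a \<Rightarrow> 'a \<Rightarrow> 'b" where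
  "fderiv f x \<equiv> frechet_derivative f (at x)"

lemma fderiv_eqI: "(f has_derivative f') (at x) \<Longrightarrow> fderiv f x = f'"
  by (rule frechet_derivative_at[symmetric])

lemma fderiv_cong:
  assumes "open S" "x \<in> S" "\<And>y. y \<in> S \<Longrightarrow> f y = g y" "f differentiable (at x)"
  shows "fderiv f x = fderiv g x"
  using assms frechet_derivative_transform_within_open by blast

lemma differentiable_cong:
  assumes "open S" "x \<in> S" "\<And>y. y \<in> S \<Longrightarrow> f y = g y" "f differentiable (at x)"
  shows "g differentiable (at x)"
  using assms has_derivative_transform_within_open unfolding differentiable_def by blast

lemma fderiv_add:
  assumes "f differentiable (at x)"
  shows "fderiv f x (u + v) = fderiv f x u + fderiv f x v"
  by (rule linear_add[OF linear_frechet_derivative[OF assms]])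

lemma fderiv_scale:
  assumes "f differentiable (at x)"
  shows "fderiv f x (r *\<^sub>R v) = r *\<^sub>R fderiv f x v"
  by (rule linear_cmul[OF linear_frechet_derivative[OF assms]])

lemma linear_euclidean_sum:
  fixes L :: "'a::euclidean_space \<Rightarrow> 'b::real_vector"
  assumes "linear L"
  shows "L v = (\<Sum>b\<in>Basis. (v \<bullet> b) *\<^sub>R L b)"
proof -
  have "L v = L (\<Sum>b\<in>Basis. (v \<bullet> b) *\<^sub>R b)" by (simp add: euclidean_representation)
  also have "\<dots> = (\<Sum>b\<in>Basis. (v \<bullet> b) *\<^sub>R L b)"
    by (simp add: linear_sum[OF assms] linear_cmul[OF assms])
  finally show ?thesis .
qed

section \<open>Closure properties of functions that are k times continuously differentiable\<close>

lemma Ck_on_Suc_imp: "Ck_on (Suc k) S f \<Longrightarrow> Ck_on k S f"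
proof (induction k arbitrary: f)
  case 0
  then show ?case
    by (auto intro!: continuous_at_imp_continuous_on differentiable_imp_continuous_within)
next
  case (Suc k)
  then show ?case by (metis Ck_on.simps(2))
qed

lemma Ck_on_subset: "Ck_on k T f \<Longrightarrow> S \<subseteq> T \<Longrightarrow> Ck_on k S f"
proof (induction k arbitrary: f)
  case 0
  then show ?case by (auto intro: continuous_on_subset)
next
  case (Suc k)
  then show ?case by (auto simp: subset_iff)
qed

lemma Ck_on_cong:
  assumes "open S"
  shows "(\<And>x. x \<in> S \<Longrightarrow> f x = g x) \<Longrightarrow> Ck_on k S f \<Longrightarrow> Ck_on k S g"
proof (induction k arbitrary: f g)
  case 0
  then show ?case by (simp cong: continuous_on_cong)
next
  case (Suc k)
  have d: "g differentiable (at x)" if "x \<in> S" for x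
    using Suc.prems that differentiable_cong[OF assms that] by auto
  have "Ck_on k S (\<lambda>x. fderiv g x v)" for v
  proof (rule Suc.IH)
    show "Ck_on k S (\<lambda>x. fderiv f x v)" using Suc.prems by auto
    show "fderiv f x v = fderiv g x v" if "x \<in> S" for x
      using fderiv_cong[OF assms that, of f g] Suc.prems that by auto
  qed
  then show ?case using d by auto
qed

lemma Ck_on_SucI:
  assumes "open S" "\<And>x. x \<in> S \<Longrightarrow> (f has_derivative f' x) (at x)"
    "\<And>v. Ck_on k S (\<lambda>x. f' x v)"
  shows "Ck_on (Suc k) S f"
proof -
  have "Ck_on k S (\<lambda>x. fderiv f x v)" for v
    by (rule Ck_on_cong[OF assms(1) _ assms(3)[of v]]) (simp add: fderiv_eqI[OF assms(2)])
  then show ?thesis using assms(2) by (auto simp: differentiable_def)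
qed

lemma Ck_on_SucD:
  assumes "Ck_on (Suc k) S f" "x \<in> S"
  shows "(f has_derivative fderiv f x) (at x)"
  using assms by (simp add: frechet_derivative_works)

lemma Ck_on_const [simp]: "open S \<Longrightarrow> Ck_on k S (\<lambda>x. c)"
proof (induction k arbitrary: c)
  case (Suc k)
  show ?case by (rule Ck_on_SucI[OF Suc.prems, where f'="\<lambda>_ _. 0"]) (use Suc in auto)
qed simp

lemma Ck_on_linear:
  assumes "open S" "bounded_linear L"
  shows "Ck_on k S L"
proof (cases k)
  case 0
  then show ?thesis using assms by (simp add: linear_continuous_on)
next
  case (Suc l)
  show ?thesis unfolding Suc
    by (rule Ck_on_SucI[where f'="\<lambda>_. L"])
      (use assms in \<open>auto intro: bounded_linear.has_derivative[OF _ has_derivative_ident]\<close>)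
qed

lemma Ck_on_add:
  assumes "open S"
  shows "Ck_on k S f \<Longrightarrow> Ck_on k S g \<Longrightarrow> Ck_on k S (\<lambda>x. f x + g x)"
proof (induction k arbitrary: f g)
  case 0
  then show ?case by (auto intro: continuous_on_add)
next
  case (Suc k)
  show ?case
    by (rule Ck_on_SucI[OF assms, where f'="\<lambda>x v. fderiv f x v + fderiv g x v"])
      (use Suc in \<open>auto intro!: has_derivative_add simp: frechet_derivative_works\<close>)
qed

lemma Ck_on_sum:
  assumes "open S" "\<And>i. i \<in> I \<Longrightarrow> Ck_on k S (f i)"
  shows "Ck_on k S (\<lambda>x. \<Sum>i\<in>I. f i x)"
proof (cases "finite I")
  case True
  then show ?thesis using assms(2)
    by (induction I) (auto intro!: Ck_on_add simp: assms(1))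
qed (simp add: assms)

lemma Ck_on_bilinear:
  assumes "open S" "bounded_bilinear pr"
  shows "Ck_on k S f \<Longrightarrow> Ck_on k S g \<Longrightarrow> Ck_on k S (\<lambda>x. pr (f x) (g x))"
proof (induction k arbitrary: f g)
  case 0
  then show ?case by (auto intro: bounded_bilinear.continuous_on[OF assms(2)])
next
  case (Suc k)
  show ?case
    by (rule Ck_on_SucI[OF assms(1), where f'="\<lambda>x v. pr (f x) (fderiv g x v) + pr (fderiv f x v) (g x)"])
      (use Suc Ck_on_Suc_imp[OF Suc.prems(1)] Ck_on_Suc_imp[OF Suc.prems(2)] in
        \<open>auto intro!: bounded_bilinear.FDERIV[OF assms(2)] Ck_on_add[OF assms(1)]
          simp: frechet_derivative_works\<close>)
qed

lemma Ck_on_linear_comp: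
  assumes "open S" "bounded_linear L" "Ck_on k S f"
  shows "Ck_on k S (\<lambda>x. L (f x))"
proof -
  show ?thesis using assms(3)
  proof (induction k arbitrary: f)
    case 0
    then show ?case using bounded_linear.continuous_on[OF assms(2)] by auto
  next
    case (Suc k)
    show ?case
      by (rule Ck_on_SucI[OF assms(1), where f'="\<lambda>x v. L (fderiv f x v)"])
        (use Suc in \<open>auto intro!: bounded_linear.has_derivative[OF assms(2)] simp: frechet_derivative_works\<close>)
  qed
qed

text \<open>In the chain rule the direction \<open>fderiv g x v\<close> moves with \<open>x\<close>,
  while the induction hypothesis covers only fixed directions. Expanding the direction in the
  Euclidean basis gives a finite sum of products of functions already known to be
  \<open>Ck_on k\<close>; this is why the middle space is Euclidean.\<close>

lemma Ck_on_comp: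
  fixes f :: "'b::euclidean_space \<Rightarrow> 'c::real_normed_vector"
  assumes "open S" "open T" "\<And>x. x \<in> S \<Longrightarrow> g x \<in> T"
  shows "Ck_on k T f \<Longrightarrow> Ck_on k S g \<Longrightarrow> Ck_on k S (\<lambda>x. f (g x))"
proof (induction k arbitrary: f)
  case 0
  then show ?case using assms(3) by (auto intro!: continuous_on_compose2[of T f])
next
  case (Suc k)
  show ?case
  proof (rule Ck_on_SucI[OF assms(1), where f'="\<lambda>x v. fderiv f (g x) (fderiv g x v)"])
    fix x assume x: "x \<in> S"
    show "((\<lambda>x. f (g x)) has_derivative (\<lambda>v. fderiv f (g x) (fderiv g x v))) (at x)"
      by (rule has_derivative_compose[OF Ck_on_SucD[OF Suc.prems(2) x]
          Ck_on_SucD[OF Suc.prems(1) assms(3)[OF x]]])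
  next
    fix v
    have 1: "Ck_on k S (\<lambda>x. fderiv f (g x) b)" for b
      using Suc.IH[of "\<lambda>y. fderiv f y b"] Suc.prems Ck_on_Suc_imp[OF Suc.prems(2)] by auto
    have 2: "Ck_on k S (\<lambda>x. fderiv g x v \<bullet> b)" for b
      by (rule Ck_on_linear_comp[OF assms(1) bounded_linear_inner_left]) (use Suc.prems in auto)
    have "Ck_on k S (\<lambda>x. \<Sum>b\<in>Basis. (fderiv g x v \<bullet> b) *\<^sub>R fderiv f (g x) b)"
      by (intro Ck_on_sum Ck_on_bilinear[OF _ bounded_bilinear_scaleR] 1 2 assms(1))
    then show "Ck_on k S (\<lambda>x. fderiv f (g x) (fderiv g x v))"
    proof (rule Ck_on_cong[OF assms(1), rotated])
      fix x assume "x \<in> S"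
      then have "f differentiable (at (g x))" using Suc.prems assms(3) by auto
      from linear_euclidean_sum[OF linear_frechet_derivative[OF this], of "fderiv g x v"]
      show "(\<Sum>b\<in>Basis. (fderiv g x v \<bullet> b) *\<^sub>R fderiv f (g x) b) = fderiv f (g x) (fderiv g x v)"
        by simp
    qed
  qed
qed

lemma smooth_on_subset: "smooth_on T f \<Longrightarrow> S \<subseteq> T \<Longrightarrow> smooth_on S f"
  unfolding smooth_on_def using Ck_on_subset by blast

lemma smooth_on_cong:
  assumes "smooth_on S f" "open S" "\<And>x. x \<in> S \<Longrightarrow> f x = g x"
  shows "smooth_on S g"
  using assms Ck_on_cong[OF assms(2), of f g] unfolding smooth_on_def by blast

lemma smooth_on_const [simp]: "open S \<Longrightarrow> smooth_on S (\<lambda>x. c)"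
  by (simp add: smooth_on_def)

lemma smooth_on_linear: "open S \<Longrightarrow> bounded_linear L \<Longrightarrow> smooth_on S L"
  by (simp add: smooth_on_def Ck_on_linear)

lemma smooth_on_ident: "open S \<Longrightarrow> smooth_on S (\<lambda>x. x)"
  by (rule smooth_on_linear[OF _ bounded_linear_ident])

lemma smooth_on_add:
  "open S \<Longrightarrow> smooth_on S f \<Longrightarrow> smooth_on S g \<Longrightarrow> smooth_on S (\<lambda>x. f x + g x)"
  by (simp add: smooth_on_def Ck_on_add)

lemma smooth_on_sum:
  "open S \<Longrightarrow> (\<And>i. i \<in> I \<Longrightarrow> smooth_on S (f i)) \<Longrightarrow> smooth_on S (\<lambda>x. \<Sum>i\<in>I. f i x)"
  by (simp add: smooth_on_def Ck_on_sum)

lemma smooth_on_bilinear: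
  "open S \<Longrightarrow> bounded_bilinear pr \<Longrightarrow> smooth_on S f \<Longrightarrow> smooth_on S g \<Longrightarrow>
    smooth_on S (\<lambda>x. pr (f x) (g x))"
  by (simp add: smooth_on_def Ck_on_bilinear)

lemmas smooth_on_scaleR = smooth_on_bilinear[OF _ bounded_bilinear_scaleR]

lemma smooth_on_linear_comp:
  "open S \<Longrightarrow> bounded_linear L \<Longrightarrow> smooth_on S f \<Longrightarrow> smooth_on S (\<lambda>x. L (f x))"
  by (simp add: smooth_on_def Ck_on_linear_comp)

lemma smooth_on_diff:
  "open S \<Longrightarrow> smooth_on S f \<Longrightarrow> smooth_on S g \<Longrightarrow> smooth_on S (\<lambda>x. f x - g x)"
  using smooth_on_add[OF _ _ smooth_on_linear_comp[OF _ bounded_linear_minus[OF bounded_linear_ident]], of S f g]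
  by simp

lemma smooth_on_Pair:
  assumes "open S" "smooth_on S f" "smooth_on S g"
  shows "smooth_on S (\<lambda>x. (f x, g x))"
proof -
  have "smooth_on S (\<lambda>x. (f x, 0) + (0, g x))"
    by (intro smooth_on_add smooth_on_linear_comp[where L="\<lambda>y. (y, 0)"]
        smooth_on_linear_comp[where L="\<lambda>y. (0, y)"] assms)
      (auto intro!: bounded_linear_Pair bounded_linear_ident)
  then show ?thesis by simp
qed

lemma smooth_on_comp:
  fixes f :: "'b::euclidean_space \<Rightarrow> 'c::real_normed_vector"
  assumes "open S" "open T" "smooth_on T f" "smooth_on S g" "\<And>x. x \<in> S \<Longrightarrow> g x \<in> T"
  shows "smooth_on S (\<lambda>x. f (g x))"
  using assms Ck_on_comp[of S T g _ f] by (auto simp: smooth_on_def)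

lemma smooth_on_has_derivative:
  assumes "smooth_on S f" "x \<in> S"
  shows "(f has_derivative fderiv f x) (at x)"
proof -
  have "Ck_on (Suc 0) S f" using assms(1) by (simp only: smooth_on_def)
  then show ?thesis using Ck_on_SucD assms(2) by blast
qed

lemma smooth_on_differentiable: "smooth_on S f \<Longrightarrow> x \<in> S \<Longrightarrow> f differentiable (at x)"
  using smooth_on_has_derivative differentiable_def by blast

lemma smooth_on_continuous_on: "smooth_on S f \<Longrightarrow> continuous_on S f"
  unfolding smooth_on_def using Ck_on.simps(1) by blast

lemma smooth_on_fderiv_const: "smooth_on S f \<Longrightarrow> smooth_on S (\<lambda>x. fderiv f x v)"
  unfolding smooth_on_def using Ck_on.simps(2) by blast

lemma smooth_on_linear_field:
  fixes A :: "'x::real_normed_vector \<Rightarrow> 'a::euclidean_space \<Rightarrow> 'b::real_normed_vector"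
  assumes "open S" "\<And>x. x \<in> S \<Longrightarrow> linear (A x)" "\<And>b. b \<in> Basis \<Longrightarrow> smooth_on S (\<lambda>x. A x b)" "smooth_on S V"
  shows "smooth_on S (\<lambda>x. A x (V x))"
proof (rule smooth_on_cong[OF _ assms(1)])
  show "smooth_on S (\<lambda>x. \<Sum>b\<in>Basis. (V x \<bullet> b) *\<^sub>R A x b)"
    by (intro smooth_on_sum smooth_on_scaleR smooth_on_linear_comp[OF _ bounded_linear_inner_left] assms)
  show "(\<Sum>b\<in>Basis. (V x \<bullet> b) *\<^sub>R A x b) = A x (V x)" if "x \<in> S" for x
    using linear_euclidean_sum[OF assms(2)[OF that], of "V x"] by simp
qed

text \<open>The product rule for a field of linear maps that is known only through its values on
  fixed vectors; a basis expansion reduces it to finitely many products with scalars.\<close>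

lemma has_derivative_linear_field:
  fixes A :: "'x::real_normed_vector \<Rightarrow> 'a::euclidean_space \<Rightarrow> 'b::real_normed_vector"
  assumes "open S" "x0 \<in> S" "\<And>x. x \<in> S \<Longrightarrow> linear (A x)"
    "\<And>b. ((\<lambda>x. A x b) has_derivative (\<lambda>e. A' e b)) (at x0)" "(V has_derivative V') (at x0)"
  shows "((\<lambda>x. A x (V x)) has_derivative (\<lambda>e. A' e (V x0) + A x0 (V' e))) (at x0)"
proof -
  \<comment> \<open>Linearity of the derivative is inherited: \<open>A x\<close> is linear on a
    whole neighbourhood, and derivatives at a point are unique.\<close>
  have lin: "linear (A' e)" for e
  proof (rule linearI)
    fix u v :: 'a and r :: real
    have "((\<lambda>x. A x (u + v)) has_derivative (\<lambda>e. A' e u + A' e v)) (at x0)"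
    proof (rule has_derivative_transform_within_open[OF _ assms(1,2)])
      show "((\<lambda>x. A x u + A x v) has_derivative (\<lambda>e. A' e u + A' e v)) (at x0)"
        by (intro has_derivative_add assms)
    qed (simp add: linear_add[OF assms(3)])
    from has_derivative_unique[OF this assms(4)]
    show "A' e (u + v) = A' e u + A' e v" by metis
    have "((\<lambda>x. A x (r *\<^sub>R v)) has_derivative (\<lambda>e. r *\<^sub>R A' e v)) (at x0)"
    proof (rule has_derivative_transform_within_open[OF _ assms(1,2)])
      show "((\<lambda>x. r *\<^sub>R A x v) has_derivative (\<lambda>e. r *\<^sub>R A' e v)) (at x0)"
        by (intro has_derivative_scaleR_right assms)
    qed (simp add: linear_cmul[OF assms(3)])
    from has_derivative_unique[OF this assms(4)]
    show "A' e (r *\<^sub>R v) = r *\<^sub>R A' e v" by metis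
  qed
  have "((\<lambda>x. A x (V x)) has_derivative
      (\<lambda>e. \<Sum>b\<in>Basis. (V x0 \<bullet> b) *\<^sub>R A' e b + (V' e \<bullet> b) *\<^sub>R A x0 b)) (at x0)"
  proof (rule has_derivative_transform_within_open[OF _ assms(1,2)])
    show "((\<lambda>x. \<Sum>b\<in>Basis. (V x \<bullet> b) *\<^sub>R A x b) has_derivative
      (\<lambda>e. \<Sum>b\<in>Basis. (V x0 \<bullet> b) *\<^sub>R A' e b + (V' e \<bullet> b) *\<^sub>R A x0 b)) (at x0)"
      by (intro has_derivative_sum has_derivative_scaleR assms has_derivative_inner_left)
    show "(\<Sum>b\<in>Basis. (V x \<bullet> b) *\<^sub>R A x b) = A x (V x)" if "x \<in> S" for x
      using linear_euclidean_sum[OF assms(3)[OF that], of "V x"] by simp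
  qed
  moreover have "(\<Sum>b\<in>Basis. (V x0 \<bullet> b) *\<^sub>R A' e b + (V' e \<bullet> b) *\<^sub>R A x0 b) = A' e (V x0) + A x0 (V' e)" for e
    using linear_euclidean_sum[OF lin, of e "V x0"] linear_euclidean_sum[OF assms(3)[OF assms(2)], of "V' e"]
    by (simp add: sum.distrib)
  ultimately show ?thesis by simp
qed

text \<open>Since \<phi> vanishes at \<open>x0\<close>, the product is differentiable although
  \<psi> is merely continuous there. This breaks the circularity in differentiating an inverse
  operator, where differentiability of the second factor is what has to be shown.\<close>

lemma has_derivative_scaleR_at_zero:
  fixes \<phi> :: "'x::real_normed_vector \<Rightarrow> real" and \<psi> :: "'x \<Rightarrow> 'a::real_normed_vector"
  assumes d: "(\<phi> has_derivative \<phi>') (at x0)" and z: "\<phi> x0 = 0" and c: "(\<psi> \<longlongrightarrow> \<psi> x0) (at x0)"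
  shows "((\<lambda>x. \<phi> x *\<^sub>R \<psi> x) has_derivative (\<lambda>e. \<phi>' e *\<^sub>R \<psi> x0)) (at x0)"
proof -
  have bl: "bounded_linear \<phi>'" using d has_derivative_bounded_linear by blast
  obtain K where K: "\<And>e. norm (\<phi>' e) \<le> norm e * K" "K > 0"
    using bounded_linear.pos_bounded[OF bl] by blast
  have l1: "((\<lambda>x. (\<phi> x - \<phi>' (x - x0)) /\<^sub>R norm (x - x0)) \<longlongrightarrow> 0) (at x0)"
    using d z unfolding has_derivative_within by (simp add: divide_inverse_commute)
  have "((\<lambda>x. ((\<phi> x - \<phi>' (x - x0)) /\<^sub>R norm (x - x0)) *\<^sub>R \<psi> x) \<longlongrightarrow> 0 *\<^sub>R \<psi> x0) (at x0)"
    by (intro tendsto_scaleR l1 c)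
  moreover have "((\<lambda>x. (\<phi>' (x - x0) / norm (x - x0)) *\<^sub>R (\<psi> x - \<psi> x0)) \<longlongrightarrow> 0) (at x0)"
  proof (rule Lim_null_comparison)
    show "\<forall>\<^sub>F x in at x0. norm ((\<phi>' (x - x0) / norm (x - x0)) *\<^sub>R (\<psi> x - \<psi> x0)) \<le> K * norm (\<psi> x - \<psi> x0)"
    proof (rule eventuallyI)
      fix x
      have "\<bar>\<phi>' (x - x0)\<bar> / norm (x - x0) \<le> K"
        using K(1)[of "x - x0"] K(2) by (cases "x = x0") (auto simp: field_simps)
      then show "norm ((\<phi>' (x - x0) / norm (x - x0)) *\<^sub>R (\<psi> x - \<psi> x0)) \<le> K * norm (\<psi> x - \<psi> x0)"
        using mult_right_mono[of "\<bar>\<phi>' (x - x0)\<bar> / norm (x - x0)" K "norm (\<psi> x - \<psi> x0)"] by simp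
    qed
    have "((\<lambda>x. K * norm (\<psi> x - \<psi> x0)) \<longlongrightarrow> K * norm (\<psi> x0 - \<psi> x0)) (at x0)"
      by (intro tendsto_intros c)
    then show "((\<lambda>x. K * norm (\<psi> x - \<psi> x0)) \<longlongrightarrow> 0) (at x0)" by simp
  qed
  \<comment> \<open>The remainder quotient splits into the error quotient of \<phi> times \<psi> and
    a bounded quotient times the increment of \<psi>; both tend to zero.\<close>
  ultimately have "((\<lambda>x. ((\<phi> x - \<phi>' (x - x0)) /\<^sub>R norm (x - x0)) *\<^sub>R \<psi> x
     + (\<phi>' (x - x0) / norm (x - x0)) *\<^sub>R (\<psi> x - \<psi> x0)) \<longlongrightarrow> 0) (at x0)"
    using tendsto_add by fastforce
  moreover have "((\<phi> x - \<phi>' (x - x0)) /\<^sub>R norm (x - x0)) *\<^sub>R \<psi> x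
     + (\<phi>' (x - x0) / norm (x - x0)) *\<^sub>R (\<psi> x - \<psi> x0)
     = (1 / norm (x - x0)) *\<^sub>R (\<phi> x *\<^sub>R \<psi> x - (\<phi> x0 *\<^sub>R \<psi> x0 + \<phi>' (x - x0) *\<^sub>R \<psi> x0))" for x
    by (simp add: z algebra_simps divide_inverse)
  ultimately show ?thesis
    unfolding has_derivative_within
    using bounded_linear_scaleR_left[THEN bounded_linear_compose, OF bl] by (simp add: bounded_linear_compose)
qed

text \<open>The inverses converge because \<open>A x0\<close> is bounded below by a constant
  \<open>c\<close>, while \<open>A x\<close> differs from it in operator norm by at most
  \<open>\<delta> x\<close>, a finite sum of errors on basis vectors.\<close>

lemma tendsto_inverse_operator:
  fixes A R :: "'x::real_normed_vector \<Rightarrow> 'a::euclidean_space \<Rightarrow> 'a"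
  assumes "open S" "x0 \<in> S" "\<And>x. x \<in> S \<Longrightarrow> linear (A x)"
    "\<And>x v. x \<in> S \<Longrightarrow> R x (A x v) = v" "\<And>x v. x \<in> S \<Longrightarrow> A x (R x v) = v"
    "\<And>b. b \<in> Basis \<Longrightarrow> ((\<lambda>x. A x b) \<longlongrightarrow> A x0 b) (at x0)"
  shows "((\<lambda>x. R x w) \<longlongrightarrow> R x0 w) (at x0)"
proof -
  have "inj (A x0)" by (metis assms(2,4) injI)
  then obtain c where c: "c > 0" "\<And>v. c * norm v \<le> norm (A x0 v)"
    using linear_inj_bounded_below_pos[OF assms(3)[OF assms(2)]] by metis
  define \<delta> where "\<delta> x = (\<Sum>b\<in>Basis. norm (A x b - A x0 b))" for x
  have \<delta>0: "(\<delta> \<longlongrightarrow> 0) (at x0)"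
  proof -
    have "((\<lambda>x. \<Sum>b\<in>Basis. norm (A x b - A x0 b)) \<longlongrightarrow> (\<Sum>b\<in>(Basis::'a set). norm (A x0 b - A x0 b))) (at x0)"
      by (intro tendsto_sum tendsto_norm tendsto_diff assms tendsto_const)
    then show ?thesis by (simp add: \<delta>_def[abs_def])
  qed
  have diff: "norm (A x v - A x0 v) \<le> \<delta> x * norm v" if "x \<in> S" for x v
  proof -
    have "A x v - A x0 v = (\<Sum>b\<in>Basis. (v \<bullet> b) *\<^sub>R (A x b - A x0 b))"
      using linear_euclidean_sum[OF assms(3)[OF that], of v] linear_euclidean_sum[OF assms(3)[OF assms(2)], of v]
      by (simp add: scaleR_diff_right sum_subtractf)
    also have "norm \<dots> \<le> (\<Sum>b\<in>Basis. norm (A x b - A x0 b) * norm v)"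
      by (intro order_trans[OF norm_sum] sum_mono)
        (simp add: Basis_le_norm mult.commute mult_right_mono)
    finally show ?thesis by (simp add: \<delta>_def sum_distrib_right)
  qed
  have "\<forall>\<^sub>F x in at x0. \<delta> x < c / 2" by (rule order_tendstoD(2)[OF \<delta>0]) (use c(1) in simp)
  moreover have "\<forall>\<^sub>F x in at x0. x \<in> S" using assms(1,2) eventually_at_topological by blast
  ultimately have ev: "\<forall>\<^sub>F x in at x0. norm (R x w - R x0 w) \<le> (2 / c) * (\<delta> x * norm (R x0 w))"
  proof eventually_elim
    case (elim x)
    let ?d = "R x w - R x0 w"
    have e: "A x ?d = - (A x (R x0 w) - A x0 (R x0 w))"
      using assms(2,5) elim(2) by (simp add: linear_diff[OF assms(3)[OF elim(2)]])
    \<comment> \<open>For \<delta> below c/2 the term with \<open>norm ?d\<close> on the right is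
      absorbed into the left, which produces the factor 2/c.\<close>
    have "c * norm ?d \<le> norm (A x ?d) + norm (A x ?d - A x0 ?d)"
      using c(2)[of ?d] norm_triangle_ineq4[of "A x ?d" "A x ?d - A x0 ?d"] by simp
    also have "\<dots> \<le> \<delta> x * norm (R x0 w) + \<delta> x * norm ?d"
      using diff[OF elim(2), of "R x0 w"] diff[OF elim(2), of ?d] e by (intro add_mono) (metis norm_minus_cancel, assumption)
    also have "\<dots> \<le> \<delta> x * norm (R x0 w) + c / 2 * norm ?d"
      using elim(1) by (intro add_left_mono mult_right_mono) auto
    finally show ?case using c(1) by (simp add: field_simps)
  qed
  have "((\<lambda>x. (2 / c) * (\<delta> x * norm (R x0 w))) \<longlongrightarrow> (2 / c) * (0 * norm (R x0 w))) (at x0)"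
    by (intro tendsto_intros \<delta>0)
  then have "((\<lambda>x. R x w - R x0 w) \<longlongrightarrow> 0) (at x0)"
    using Lim_null_comparison[OF ev] by simp
  then show ?thesis by (simp add: LIM_zero_iff)
qed

text \<open>The derivative of \<open>R x w\<close> is minus \<open>R\<close> applied to the
  derivative of \<open>A\<close> at \<open>R x w\<close>. It is built from \<open>R\<close> itself
  and first derivatives of \<open>A\<close>, so each order of differentiability of \<open>R\<close>
  yields the next one.\<close>

lemma Ck_on_inverse_operator:
  fixes A R :: "'x::real_normed_vector \<Rightarrow> 'a::euclidean_space \<Rightarrow> 'a"
  assumes S: "open S" and lin: "\<And>x. x \<in> S \<Longrightarrow> linear (A x)"
    and inv: "\<And>x v. x \<in> S \<Longrightarrow> R x (A x v) = v" "\<And>x v. x \<in> S \<Longrightarrow> A x (R x v) = v"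
  shows "(\<And>b. b \<in> Basis \<Longrightarrow> Ck_on k S (\<lambda>x. A x b)) \<Longrightarrow> Ck_on k S (\<lambda>x. R x w)"
proof (induction k arbitrary: w)
  case 0
  then have "((\<lambda>x. A x b) \<longlongrightarrow> A x0 b) (at x0)" if "x0 \<in> S" "b \<in> Basis" for b x0
    using that S by (simp add: continuous_on_eq_continuous_at isCont_def)
  then show ?case
    unfolding Ck_on.simps continuous_on_eq_continuous_at[OF S] isCont_def
    by (intro ballI tendsto_inverse_operator[where S=S and A=A and R=R] S lin inv) auto
next
  case (Suc k)
  define D where "D x v e = (\<Sum>c\<in>Basis. (v \<bullet> c) *\<^sub>R fderiv (\<lambda>x. A x c) x e)" for x v e
  have linR: "linear (R x)" if "x \<in> S" for x
  proof (rule linearI)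
    show "R x (u + v) = R x u + R x v" for u v
      using inv(1)[OF that, of "R x u + R x v"] inv(2)[OF that] linear_add[OF lin[OF that]] by simp
    show "R x (r *\<^sub>R v) = r *\<^sub>R R x v" for r v
      using inv(1)[OF that, of "r *\<^sub>R R x v"] inv(2)[OF that] linear_cmul[OF lin[OF that]] by simp
  qed
  have Ak: "Ck_on k S (\<lambda>x. A x b)" if "b \<in> Basis" for b
    using Suc.prems[OF that] by (rule Ck_on_Suc_imp)
  have R: "Ck_on k S (\<lambda>x. R x v)" for v
    by (rule Suc.IH[OF Ak])
  have R0: "Ck_on 0 S (\<lambda>x. R x v)" for v
    using R[of v] by (induction k) (use Ck_on_Suc_imp in blast)+
  show ?case
  proof (rule Ck_on_SucI[OF S, where f'="\<lambda>x e. - (\<Sum>b\<in>Basis. (D x (R x w) e \<bullet> b) *\<^sub>R R x b)"])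
    fix x0 assume x0: "x0 \<in> S"
    define u where "u = R x0 w"
    have dA: "((\<lambda>x. A x u) has_derivative D x0 u) (at x0)"
    proof (rule has_derivative_transform_within_open[OF _ S x0])
      show "((\<lambda>x. \<Sum>c\<in>Basis. (u \<bullet> c) *\<^sub>R A x c) has_derivative D x0 u) (at x0)"
        unfolding D_def
        by (intro has_derivative_sum has_derivative_scaleR_right Ck_on_SucD[OF Suc.prems x0])
      show "(\<Sum>c\<in>Basis. (u \<bullet> c) *\<^sub>R A x c) = A x u" if "x \<in> S" for x
        using linear_euclidean_sum[OF lin[OF that], of u] by simp
    qed
    have 1: "((\<lambda>x. R x w) \<longlongrightarrow> R x0 w) (at x0)" for w
      using R0[of w] S x0 by (simp add: continuous_on_eq_continuous_at isCont_def)
    \<comment> \<open>By \<open>R x w = R x0 w - R x (A x u - A x0 u)\<close> with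
      \<open>u = R x0 w\<close>, the varying \<open>R x\<close> sits beside a factor that vanishes
      at \<open>x0\<close>, so continuity of \<open>R\<close> is enough to differentiate.\<close>
    have "((\<lambda>x. R x0 w - (\<Sum>b\<in>Basis. ((A x u - A x0 u) \<bullet> b) *\<^sub>R R x b)) has_derivative
       (\<lambda>e. 0 - (\<Sum>b\<in>Basis. ((D x0 u e - 0) \<bullet> b) *\<^sub>R R x0 b))) (at x0)"
      by (intro has_derivative_diff has_derivative_const has_derivative_sum has_derivative_scaleR_at_zero
          has_derivative_inner_left dA 1) simp
    then have "((\<lambda>x. R x0 w - (\<Sum>b\<in>Basis. ((A x u - A x0 u) \<bullet> b) *\<^sub>R R x b)) has_derivative
       (\<lambda>e. - (\<Sum>b\<in>Basis. (D x0 (R x0 w) e \<bullet> b) *\<^sub>R R x0 b))) (at x0)"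
      by (simp add: u_def)
    then show "((\<lambda>x. R x w) has_derivative (\<lambda>e. - (\<Sum>b\<in>Basis. (D x0 (R x0 w) e \<bullet> b) *\<^sub>R R x0 b))) (at x0)"
    proof (rule has_derivative_transform_within_open[OF _ S x0])
      fix x assume x: "x \<in> S"
      have "(\<Sum>b\<in>Basis. ((A x u - A x0 u) \<bullet> b) *\<^sub>R R x b) = R x (A x u - A x0 u)"
        using linear_euclidean_sum[OF linR[OF x], of "A x u - A x0 u"] by simp
      also have "\<dots> = u - R x w"
        using inv x x0 by (simp add: u_def linear_diff[OF linR[OF x]])
      finally show "R x0 w - (\<Sum>b\<in>Basis. ((A x u - A x0 u) \<bullet> b) *\<^sub>R R x b) = R x w"
        by (simp add: u_def)
    qed
  next
    fix e
    have "Ck_on k S (\<lambda>x. D x (R x w) e)"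
      unfolding D_def
      by (intro Ck_on_sum Ck_on_bilinear[OF _ bounded_bilinear_scaleR] Ck_on_linear_comp[OF _ bounded_linear_inner_left] S R)
        (use Suc.prems in auto)
    then have "Ck_on k S (\<lambda>x. \<Sum>b\<in>Basis. (D x (R x w) e \<bullet> b) *\<^sub>R R x b)"
      by (intro Ck_on_sum Ck_on_bilinear[OF _ bounded_bilinear_scaleR] Ck_on_linear_comp[OF _ bounded_linear_inner_left] S R)
    then show "Ck_on k S (\<lambda>x. - (\<Sum>b\<in>Basis. (D x (R x w) e \<bullet> b) *\<^sub>R R x b))"
      by (rule Ck_on_linear_comp[OF S bounded_linear_minus[OF bounded_linear_ident]])
  qed
qed

lemma smooth_on_inverse_operator:
  fixes A R :: "'x::real_normed_vector \<Rightarrow> 'a::euclidean_space \<Rightarrow> 'a"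
  assumes "open S" "\<And>x. x \<in> S \<Longrightarrow> linear (A x)"
    "\<And>x v. x \<in> S \<Longrightarrow> R x (A x v) = v" "\<And>x v. x \<in> S \<Longrightarrow> A x (R x v) = v"
    "\<And>b. b \<in> Basis \<Longrightarrow> smooth_on S (\<lambda>x. A x b)"
  shows "smooth_on S (\<lambda>x. R x w)"
  unfolding smooth_on_def using Ck_on_inverse_operator[of S A R] assms unfolding smooth_on_def by blast

section \<open>Symmetry of second derivatives\<close>

lemma fderiv_along_line:
  fixes f :: "'a::real_normed_vector \<Rightarrow> real"
  assumes "smooth_on S f" "x + s *\<^sub>R u \<in> S"
  shows "((\<lambda>s. f (x + s *\<^sub>R u)) has_real_derivative fderiv f (x + s *\<^sub>R u) u) (at s)"
proof -
  have "((\<lambda>s. x + s *\<^sub>R u) has_derivative (\<lambda>r. 0 + r *\<^sub>R u)) (at s)"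
    by (intro has_derivative_add has_derivative_const has_derivative_scaleR_left has_derivative_ident)
  from has_derivative_compose[OF this smooth_on_has_derivative[OF assms]]
  have "((\<lambda>s. f (x + s *\<^sub>R u)) has_derivative (\<lambda>r. r * fderiv f (x + s *\<^sub>R u) u)) (at s)"
    by (simp add: fderiv_scale[OF smooth_on_differentiable[OF assms]])
  then show ?thesis by (simp add: has_field_derivative_def mult_commute_abs)
qed

text \<open>Two applications of the mean value theorem, along \<open>u\<close> and then along
  \<open>v\<close>, identify the second difference with a mixed derivative at a nearby point.
  Exchanging \<open>u\<close> and \<open>v\<close> leaves the difference unchanged, which is how it
  yields symmetry.\<close>

lemma second_difference:
  fixes f :: "'a::real_normed_vector \<Rightarrow> real"
  assumes S: "open S" and x: "x \<in> S" and f: "smooth_on S f" and "\<epsilon> > 0"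
  shows "\<forall>\<^sub>F t in at_right 0. \<bar>(f (x + t *\<^sub>R u + t *\<^sub>R v) - f (x + t *\<^sub>R u) - f (x + t *\<^sub>R v) + f x) / t\<^sup>2
     - fderiv (\<lambda>y. fderiv f y u) x v\<bar> < \<epsilon>"
proof -
  let ?f1 = "\<lambda>y. fderiv f y u"
  let ?f2 = "\<lambda>y. fderiv ?f1 y v"
  have f1: "smooth_on S ?f1" by (rule smooth_on_fderiv_const[OF f])
  have f2: "smooth_on S ?f2" by (rule smooth_on_fderiv_const[OF f1])
  have "isCont ?f2 x" using smooth_on_continuous_on[OF f2] S x continuous_on_eq_continuous_at by blast
  then obtain d1 where d1: "d1 > 0" "\<And>y. dist y x < d1 \<Longrightarrow> \<bar>?f2 y - ?f2 x\<bar> < \<epsilon>"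
    unfolding continuous_at_eps_delta dist_real_def using \<open>\<epsilon> > 0\<close> by meson
  obtain d2 where d2: "d2 > 0" "ball x d2 \<subseteq> S" using S x openE by blast
  define d where "d = min d1 d2"
  \<comment> \<open>For steps below d/M the parallelogram spanned by \<open>t *\<^sub>R u\<close>
    and \<open>t *\<^sub>R v\<close> stays within distance \<open>d\<close> of \<open>x\<close>; the
    summand 1 keeps \<open>M\<close> positive when both directions vanish.\<close>
  define M where "M = norm u + norm v + 1"
  have M: "M > 0" by (simp add: M_def add_nonneg_pos)
  have near: "dist (x + r *\<^sub>R u + s *\<^sub>R v) x < d" if "0 < t" "t < d / M" "0 \<le> r" "r \<le> t" "0 \<le> s" "s \<le> t" for r s t
  proof -
    have "norm (r *\<^sub>R u + s *\<^sub>R v) \<le> r * norm u + s * norm v"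
      using norm_triangle_ineq[of "r *\<^sub>R u" "s *\<^sub>R v"] that by simp
    also have "\<dots> \<le> t * norm u + t * norm v" using that by (intro add_mono mult_right_mono) auto
    also have "\<dots> < t * M" using that by (simp add: M_def algebra_simps)
    also have "\<dots> < d" using that M by (simp add: field_simps)
    finally show ?thesis by (simp add: dist_norm add.assoc)
  qed
  have inS: "x + r *\<^sub>R u + s *\<^sub>R v \<in> S" if "0 < t" "t < d / M" "0 \<le> r" "r \<le> t" "0 \<le> s" "s \<le> t" for r s t
    using near[OF that] d2(2) by (auto simp: d_def dist_commute subset_iff)
  have main: "\<bar>(f (x + t *\<^sub>R u + t *\<^sub>R v) - f (x + t *\<^sub>R u) - f (x + t *\<^sub>R v) + f x) / t\<^sup>2 - ?f2 x\<bar> < \<epsilon>"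
    if t: "0 < t" "t < d / M" for t
  proof -
    \<comment> \<open>The increment of \<psi> over [0, t] is the whole second difference. The mean
      value theorem turns it into an increment of the first derivative along \<open>v\<close>, to
      which the theorem applies again.\<close>
    let ?\<psi> = "\<lambda>s. f (x + t *\<^sub>R v + s *\<^sub>R u) - f (x + s *\<^sub>R u)"
    have "\<exists>\<xi>>0. \<xi> < t \<and> ?\<psi> t - ?\<psi> 0 = (t - 0) * (fderiv f (x + t *\<^sub>R v + \<xi> *\<^sub>R u) u - fderiv f (x + \<xi> *\<^sub>R u) u)"
    proof (rule MVT2[OF t(1)])
      fix s assume s: "0 \<le> s" "s \<le> t"
      show "(?\<psi> has_real_derivative fderiv f (x + t *\<^sub>R v + s *\<^sub>R u) u - fderiv f (x + s *\<^sub>R u) u) (at s)"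
        using inS[OF t s, of t] inS[OF t s, of 0] t
        by (intro DERIV_diff fderiv_along_line[OF f]) (simp_all add: algebra_simps)
    qed
    then obtain \<xi> where \<xi>: "0 < \<xi>" "\<xi> < t"
      "?\<psi> t - ?\<psi> 0 = t * (?f1 (x + t *\<^sub>R v + \<xi> *\<^sub>R u) - ?f1 (x + \<xi> *\<^sub>R u))" by auto
    have "\<exists>\<eta>>0. \<eta> < t \<and> ?f1 (x + \<xi> *\<^sub>R u + t *\<^sub>R v) - ?f1 (x + \<xi> *\<^sub>R u + 0 *\<^sub>R v) = (t - 0) * ?f2 (x + \<xi> *\<^sub>R u + \<eta> *\<^sub>R v)"
      by (rule MVT2[OF t(1)], rule fderiv_along_line[OF f1]) (use inS[OF t] \<xi> in auto)
    then obtain \<eta> where \<eta>: "0 < \<eta>" "\<eta> < t"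
      "?f1 (x + \<xi> *\<^sub>R u + t *\<^sub>R v) - ?f1 (x + \<xi> *\<^sub>R u) = t * ?f2 (x + \<xi> *\<^sub>R u + \<eta> *\<^sub>R v)" by auto
    have "f (x + t *\<^sub>R u + t *\<^sub>R v) - f (x + t *\<^sub>R u) - f (x + t *\<^sub>R v) + f x = ?\<psi> t - ?\<psi> 0"
      by (simp add: algebra_simps)
    also have "\<dots> = t * (t * ?f2 (x + \<xi> *\<^sub>R u + \<eta> *\<^sub>R v))"
      using \<eta>(3) \<xi>(3) by (simp add: algebra_simps)
    finally have "(f (x + t *\<^sub>R u + t *\<^sub>R v) - f (x + t *\<^sub>R u) - f (x + t *\<^sub>R v) + f x) / t\<^sup>2 = ?f2 (x + \<xi> *\<^sub>R u + \<eta> *\<^sub>R v)"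
      using t by (simp add: power2_eq_square)
    then show ?thesis
      using d1(2)[of "x + \<xi> *\<^sub>R u + \<eta> *\<^sub>R v"] near[OF t, of \<xi> \<eta>] \<xi> \<eta> by (simp add: d_def)
  qed
  have "d / M > 0" using d1(1) d2(1) M by (simp add: d_def)
  then show ?thesis unfolding eventually_at_right_field using main by auto
qed

lemma fderiv_fderiv_commute_real:
  fixes f :: "'a::real_normed_vector \<Rightarrow> real"
  assumes "open S" "x \<in> S" "smooth_on S f"
  shows "fderiv (\<lambda>y. fderiv f y u) x v = fderiv (\<lambda>y. fderiv f y v) x u"
proof (rule ccontr)
  let ?a = "fderiv (\<lambda>y. fderiv f y u) x v" and ?b = "fderiv (\<lambda>y. fderiv f y v) x u"
  assume "?a \<noteq> ?b"
  then have e: "\<bar>?a - ?b\<bar> / 2 > 0" by simp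
  have "\<forall>\<^sub>F t in at_right (0::real). False"
    using second_difference[OF assms e, of u v] second_difference[OF assms e, of v u]
  proof eventually_elim
    case (elim t)
    have eq: "f (x + t *\<^sub>R v + t *\<^sub>R u) - f (x + t *\<^sub>R v) - f (x + t *\<^sub>R u) + f x =
      f (x + t *\<^sub>R u + t *\<^sub>R v) - f (x + t *\<^sub>R u) - f (x + t *\<^sub>R v) + f x"
      by (simp add: algebra_simps)
    \<comment> \<open>One number cannot lie within half their distance of two different
      limits.\<close>
    have "\<not> (\<bar>c - a\<bar> < \<bar>a - b\<bar> / 2 \<and> \<bar>c - b\<bar> < \<bar>a - b\<bar> / 2)" for a b c :: real
      by (auto simp: abs_if field_simps split: if_splits)
    then show ?case using elim(1) elim(2)[unfolded eq] by blast
  qed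
  then show False by simp
qed

lemma fderiv_fderiv_commute:
  fixes f :: "'a::real_normed_vector \<Rightarrow> 'b::euclidean_space"
  assumes "open S" "x \<in> S" "smooth_on S f"
  shows "fderiv (\<lambda>y. fderiv f y u) x v = fderiv (\<lambda>y. fderiv f y v) x u"
proof (rule euclidean_eqI)
  fix b :: 'b
  have D: "fderiv (\<lambda>y. g y \<bullet> b) z w = fderiv g z w \<bullet> b" if "smooth_on S g" "z \<in> S" for g :: "'a \<Rightarrow> 'b" and z w
    using fderiv_eqI[OF has_derivative_inner_left[OF smooth_on_has_derivative[OF that], of b]] by simp
  have D2: "fderiv (\<lambda>y. fderiv f y w \<bullet> b) x z = fderiv (\<lambda>y. fderiv (\<lambda>y. f y \<bullet> b) y w) x z" for w z
    by (intro fderiv_cong[THEN fun_cong, OF assms(1,2)])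
      (use D[OF assms(3)] smooth_on_differentiable[OF smooth_on_linear_comp[OF assms(1) bounded_linear_inner_left smooth_on_fderiv_const[OF assms(3)]]]
       assms in auto)
  have "fderiv (\<lambda>y. fderiv f y w) x z \<bullet> b = fderiv (\<lambda>y. fderiv (\<lambda>y. f y \<bullet> b) y w) x z" for w z
    using D[OF smooth_on_fderiv_const[OF assms(3)] assms(2)] D2 by metis
  then show "fderiv (\<lambda>y. fderiv f y u) x v \<bullet> b = fderiv (\<lambda>y. fderiv f y v) x u \<bullet> b"
    using fderiv_fderiv_commute_real[OF assms(1,2) smooth_on_linear_comp[OF assms(1) bounded_linear_inner_left assms(3)]]
    by simp
qed

subsection \<open>Inverse functions and transversal intersections\<close>

text \<open>Bootstrapping: the derivative of \<open>g\<close> inverts \<open>fderiv f (g y)\<close>,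
  so it is as differentiable as \<open>g\<close>, and \<open>g\<close> gains one order.\<close>

lemma Ck_on_local_inverse:
  fixes f :: "'a::euclidean_space \<Rightarrow> 'a"
  assumes U: "open U" "smooth_on U f" and V: "open V"
    and gU: "\<And>y. y \<in> V \<Longrightarrow> g y \<in> U"
    and der: "\<And>y. y \<in> V \<Longrightarrow> (g has_derivative R y) (at y)"
    and inv: "\<And>y v. y \<in> V \<Longrightarrow> R y (fderiv f (g y) v) = v" "\<And>y v. y \<in> V \<Longrightarrow> fderiv f (g y) (R y v) = v"
  shows "Ck_on k V g"
proof (induction k)
  case 0
  then show ?case
    by (auto intro!: continuous_at_imp_continuous_on has_derivative_continuous[OF der])
next
  case (Suc k)
  show ?case
  proof (rule Ck_on_SucI[OF V der])
    show "Ck_on k V (\<lambda>y. R y v)" for v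
    proof (rule Ck_on_inverse_operator[where A="\<lambda>y. fderiv f (g y)" and R=R, OF V _ inv])
      show "linear (fderiv f (g y))" if "y \<in> V" for y
        using linear_frechet_derivative smooth_on_differentiable[OF U(2) gU[OF that]] by blast
      show "Ck_on k V (\<lambda>y. fderiv f (g y) b)" for b
        by (rule Ck_on_comp[OF V U(1) gU _ Suc]) (use smooth_on_fderiv_const[OF U(2)] in \<open>auto simp: smooth_on_def\<close>)
    qed
  qed
qed

text \<open>Continuity of the operator-valued derivative gives a differentiable local inverse, and
  the formula for its derivative is exactly what \<open>Ck_on_local_inverse\<close> asks for.
  Injectivity of the derivative at \<open>x0\<close> provides the one-sided linear inverse that
  starts the argument.\<close>

lemma smooth_inverse_function:
  fixes f :: "'a::euclidean_space \<Rightarrow> 'a"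
  assumes U: "open U" "smooth_on U f" and x0: "x0 \<in> U" and inj: "inj (fderiv f x0)"
  obtains U' V g where "open U'" "U' \<subseteq> U" "x0 \<in> U'" "open V" "homeomorphism U' V f g" "smooth_on V g"
proof -
  have lin: "linear (fderiv f x)" if "x \<in> U" for x
    using linear_frechet_derivative smooth_on_differentiable[OF U(2) that] by blast
  define f' where "f' x = Blinfun (fderiv f x)" for x
  have f': "blinfun_apply (f' x) = fderiv f x" if "x \<in> U" for x
    unfolding f'_def by (rule bounded_linear_Blinfun_apply) (use lin[OF that] linear_conv_bounded_linear in blast)
  have cont: "continuous_on U f'"
  proof (rule continuous_on_blinfun_componentwise)
    fix i :: 'a
    have "continuous_on U (\<lambda>x. fderiv f x i)"
      by (rule smooth_on_continuous_on[OF smooth_on_fderiv_const[OF U(2)]])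
    then show "continuous_on U (\<lambda>x. blinfun_apply (f' x) i)"
      by (rule continuous_on_eq) (simp add: f')
  qed
  obtain L where L: "linear L" "L \<circ> fderiv f x0 = id"
    using linear_injective_left_inverse[OF lin[OF x0] inj] by blast
  then have "blinfun_apply (Blinfun L) = L"
    using linear_conv_bounded_linear by (intro bounded_linear_Blinfun_apply) blast
  then have invf: "Blinfun L o\<^sub>L f' x0 = id_blinfun"
    using L(2) f'[OF x0] by (intro blinfun_eqI) (simp add: fun_eq_iff)
  obtain U' V g g' where *: "open U'" "U' \<subseteq> U" "x0 \<in> U'" "open V" "homeomorphism U' V f g"
    "\<And>y. y \<in> V \<Longrightarrow> (g has_derivative (g' y)) (at y)"
    "\<And>y. y \<in> V \<Longrightarrow> g' y = inv (blinfun_apply (f'(g y)))"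
    "\<And>y. y \<in> V \<Longrightarrow> bij (blinfun_apply (f'(g y)))"
    using inverse_function_theorem[OF U(1) _ cont x0 invf] f' smooth_on_has_derivative[OF U(2)] by metis
  have gU: "g y \<in> U" if "y \<in> V" for y
    using *(2,5) that by (auto simp: homeomorphism_def)
  have "Ck_on k V g" for k
  proof (rule Ck_on_local_inverse[OF U *(4) gU *(6)])
    show "g' y (fderiv f (g y) v) = v" "fderiv f (g y) (g' y v) = v" if "y \<in> V" for y v
      using *(7,8)[OF that] by (simp_all add: f'[OF gU[OF that]] bij_is_inj bij_is_surj surj_f_inv_f)
  qed
  then show ?thesis using that *(1-5) by (simp add: smooth_on_def)
qed

text \<open>Composing with a linear left inverse \<open>A\<close> of the derivative makes
  \<open>A \<circ> F\<close> a local diffeomorphism, and \<open>P\<close> is its inverse after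
  \<open>A\<close>. \<open>P\<close> lives on an open set of the ambient space, not merely on the
  image of \<open>F\<close>, so it can be composed with any smooth map that runs into the
  image.\<close>

lemma immersion_left_inverse:
  fixes F :: "'f::euclidean_space \<Rightarrow> 'e::euclidean_space"
  assumes E: "open E" "smooth_on E F" and x0: "x0 \<in> E" and inj: "inj (fderiv F x0)"
  obtains B D P where "open B" "x0 \<in> B" "B \<subseteq> E" "open D" "F ` B \<subseteq> D" "smooth_on D P"
    "\<And>x. x \<in> B \<Longrightarrow> P (F x) = x"
proof -
  have lin: "linear (fderiv F x0)"
    using linear_frechet_derivative smooth_on_differentiable[OF E(2) x0] by blast
  obtain A where A: "linear A" "A \<circ> fderiv F x0 = id"
    using linear_injective_left_inverse[OF lin inj] by blast
  have bA: "bounded_linear A" using A linear_conv_bounded_linear by blast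
  have "fderiv (\<lambda>x. A (F x)) x0 = (\<lambda>v. A (fderiv F x0 v))"
    by (intro fderiv_eqI bounded_linear.has_derivative[OF bA] smooth_on_has_derivative[OF E(2) x0])
  then have "inj (fderiv (\<lambda>x. A (F x)) x0)"
    using fun_cong[OF A(2)] by (simp add: id_def[abs_def])
  then obtain U V g where *: "open U" "U \<subseteq> E" "x0 \<in> U" "open V" "homeomorphism U V (\<lambda>x. A (F x)) g" "smooth_on V g"
    using smooth_inverse_function[OF E(1) smooth_on_linear_comp[OF E(1) bA E(2)] x0] by blast
  have oD: "open (A -` V)"
    using *(4) bA linear_continuous_on[OF bA] by (simp add: open_vimage)
  show ?thesis
  proof (rule that[OF *(1,3,2) oD])
    show "F ` U \<subseteq> A -` V" using *(5) by (auto simp: homeomorphism_def)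
    show "smooth_on (A -` V) (\<lambda>z. g (A z))"
      by (rule smooth_on_comp[OF oD *(4,6) smooth_on_linear[OF oD bA]]) simp
    show "g (A (F x)) = x" if "x \<in> U" for x using *(5) that by (auto simp: homeomorphism_def)
  qed
qed

lemma dim_kernel_surjective:
  fixes L :: "'x::euclidean_space \<Rightarrow> 'e::euclidean_space"
  assumes L: "linear L" and B: "linear B" "\<And>w. L (B w) = w"
  shows "dim {z. L z = 0} + DIM('e) = DIM('x)"
proof -
  have sk: "subspace {z. L z = 0}" by (rule linear_subspace_kernel[OF L])
  have sr: "subspace (range B)" by (rule linear_subspace_image[OF B(1) subspace_UNIV])
  have "inj B" by (metis B(2) injI)
  then have dr: "dim (range B) = DIM('e)" using dim_image_eq[OF B(1), of UNIV] by simp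
  have i0: "{z. L z = 0} \<inter> range B = {0}"
    using linear_0[OF L] linear_0[OF B(1)] by (auto simp: B(2))
  have "{x + y |x y. x \<in> {z. L z = 0} \<and> y \<in> range B} = UNIV"
  proof -
    have "\<exists>x y. z = x + y \<and> L x = 0 \<and> y \<in> range B" for z
      by (rule exI[of _ "z - B (L z)"], rule exI[of _ "B (L z)"]) (simp add: linear_diff[OF L] B(2))
    then show ?thesis by blast
  qed
  then show ?thesis using dim_sums_Int[OF sk sr] unfolding i0 dr by simp
qed

text \<open>The pairs (x, y) with F x = H y form the zero set of \<open>g\<close>, whose derivative
  \<open>L\<close> at the base point is onto by transversality. Straightening \<open>g\<close> to
  \<open>L\<close> parametrizes this set by the kernel of \<open>L\<close>, which has the dimension
  of \<open>'h\<close>. One straightening serves all smaller \<open>A\<close> and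
  \<open>B\<close>.\<close>

lemma transversal_intersection:
  fixes F :: "'f::euclidean_space \<Rightarrow> 'e::euclidean_space" and H :: "'g::euclidean_space \<Rightarrow> 'e"
  assumes F: "open OF" "smooth_on OF F" "x0 \<in> OF" "inj (fderiv F x0)"
    and H: "open OH" "smooth_on OH H" "y0 \<in> OH" "inj (fderiv H y0)"
    and eq: "F x0 = H y0"
    and trans: "\<And>w. \<exists>u v. w = fderiv F x0 u + fderiv H y0 v"
    and dims: "DIM('h::euclidean_space) + DIM('e) = DIM('f) + DIM('g)"
  shows "\<exists>B1 B2. open B1 \<and> x0 \<in> B1 \<and> B1 \<subseteq> OF \<and> open B2 \<and> y0 \<in> B2 \<and> B2 \<subseteq> OH \<and>
    (\<forall>A B. open A \<and> A \<subseteq> B1 \<and> open B \<and> B \<subseteq> B2 \<longrightarrow>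
      (\<exists>Q (G::'h \<Rightarrow> 'e) D P. open Q \<and> smooth_on Q G \<and> open D \<and> smooth_on D P \<and>
         G ` Q = F ` A \<inter> H ` B \<and> G ` Q \<subseteq> D \<and> (\<forall>a\<in>Q. P (G a) = a)))"
proof -
  obtain B1 D1 P1 where 1: "open B1" "x0 \<in> B1" "B1 \<subseteq> OF" "open D1" "F ` B1 \<subseteq> D1" "smooth_on D1 P1"
    "\<And>x. x \<in> B1 \<Longrightarrow> P1 (F x) = x"
    using immersion_left_inverse[OF F] by blast
  obtain B2 D2 P2 where 2: "open B2" "y0 \<in> B2" "B2 \<subseteq> OH" "open D2" "H ` B2 \<subseteq> D2" "smooth_on D2 P2"
    "\<And>x. x \<in> B2 \<Longrightarrow> P2 (H x) = x"
    using immersion_left_inverse[OF H] by blast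
  define L where "L z = fderiv F x0 (fst z) - fderiv H y0 (snd z)" for z
  have linF: "linear (fderiv F x0)" and linH: "linear (fderiv H y0)"
    using linear_frechet_derivative smooth_on_differentiable F H by blast+
  have linL: "linear L"
    unfolding L_def by (intro linearI)
      (simp_all add: linear_add[OF linF] linear_add[OF linH] linear_cmul[OF linF] linear_cmul[OF linH] scaleR_diff_right)
  have "surj L"
  proof (rule surjI)
    fix w
    have "\<exists>z. L z = w"
    proof -
      obtain u v where "w = fderiv F x0 u + fderiv H y0 v" using trans by blast
      then have "L (u, - v) = w" by (simp add: L_def linear_neg[OF linH])
      then show ?thesis by blast
    qed
    then show "L (SOME z. L z = w) = w" by (rule someI_ex)
  qed
  then obtain R where R: "linear R" "L \<circ> R = id"
    using linear_surjective_right_inverse[OF linL] by blast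
  have LR: "L (R w) = w" for w using R(2) by (metis comp_apply id_apply)
  \<comment> \<open>Equal dimensions make the kernel linearly isomorphic to \<open>'h\<close>:
    \<iota> embeds \<open>'h\<close> as the kernel and \<pi> reads the parameter back.\<close>
  have "dim {z. L z = 0} = dim (UNIV::'h set)"
    using dim_kernel_surjective[OF linL R(1) LR] dims by simp
  from this[symmetric] obtain \<iota> \<pi> where i: "linear (\<iota>::'h \<Rightarrow> 'f \<times> 'g)" "linear \<pi>" "\<iota> ` UNIV = {z. L z = 0}" "\<And>a. \<pi> (\<iota> a) = a"
    "\<And>z. z \<in> {z. L z = 0} \<Longrightarrow> \<iota> (\<pi> z) = z"
    by (rule isometries_subspaces[OF subspace_UNIV linear_subspace_kernel[OF linL]]) auto
  have bL: "bounded_linear L" and bR: "bounded_linear R" and bi: "bounded_linear \<iota>" and bp: "bounded_linear \<pi>"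
    using linL R(1) i(1,2) linear_conv_bounded_linear by blast+
  define g where "g z = F (fst z) - H (snd z)" for z
  define z0 where "z0 = (x0, y0)"
  \<comment> \<open>The component \<open>R (L (z - z0))\<close> of the increment is replaced by
    \<open>R (g z)\<close>. Hence \<open>L (\<Theta> z) = g z\<close>, and the derivative at
    \<open>z0\<close> is the identity because that of \<open>g\<close> is \<open>L\<close>.\<close>
  define \<Theta> where "\<Theta> z = z - z0 - R (L (z - z0)) + R (g z)" for z
  let ?U = "B1 \<times> B2"
  have oU: "open ?U" using 1(1) 2(1) by (rule open_Times)
  have sfst: "smooth_on ?U fst" and ssnd: "smooth_on ?U snd"
    by (rule smooth_on_linear[OF oU bounded_linear_fst] smooth_on_linear[OF oU bounded_linear_snd])+
  have sg: "smooth_on ?U g"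
    unfolding g_def
    by (intro smooth_on_diff smooth_on_comp[OF oU F(1,2) sfst] smooth_on_comp[OF oU H(1,2) ssnd] oU)
      (use 1(3) 2(3) in auto)
  have s\<Theta>: "smooth_on ?U \<Theta>"
    unfolding \<Theta>_def
    by (intro smooth_on_add smooth_on_diff smooth_on_linear_comp[OF _ bR] smooth_on_linear_comp[OF _ bL] sg
        smooth_on_ident smooth_on_const oU)
  have L\<Theta>: "L (\<Theta> z) = g z" for z
    by (simp add: \<Theta>_def linear_add[OF linL] linear_diff[OF linL] LR)
  have z0: "z0 \<in> ?U" using 1(2) 2(2) by (simp add: z0_def)
  have dg: "(g has_derivative L) (at z0)"
  proof -
    have "((\<lambda>z. F (fst z)) has_derivative (\<lambda>v. fderiv F x0 (fst v))) (at z0)"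
      by (rule has_derivative_compose[OF has_derivative_fst[OF has_derivative_ident]])
        (simp add: z0_def smooth_on_has_derivative[OF F(2,3)])
    moreover have "((\<lambda>z. H (snd z)) has_derivative (\<lambda>v. fderiv H y0 (snd v))) (at z0)"
      by (rule has_derivative_compose[OF has_derivative_snd[OF has_derivative_ident]])
        (simp add: z0_def smooth_on_has_derivative[OF H(2,3)])
    ultimately show ?thesis
      unfolding g_def[abs_def] L_def[abs_def] by (rule has_derivative_diff)
  qed
  have "(\<Theta> has_derivative (\<lambda>v. v - 0 - R (L (v - 0)) + R (L v))) (at z0)"
    unfolding \<Theta>_def
    by (intro has_derivative_add has_derivative_diff has_derivative_ident has_derivative_const dg
        bounded_linear.has_derivative[OF bL] bounded_linear.has_derivative[OF bR])
  then have "fderiv \<Theta> z0 = (\<lambda>v. v)" by (intro fderiv_eqI) simp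
  then have "inj (fderiv \<Theta> z0)" by simp
  then obtain W V \<Xi> where W: "open W" "W \<subseteq> ?U" "z0 \<in> W" "open V" "homeomorphism W V \<Theta> \<Xi>" "smooth_on V \<Xi>"
    using smooth_inverse_function[OF oU s\<Theta> z0] by blast
  obtain C1 C2 where C: "open C1" "open C2" "z0 \<in> C1 \<times> C2" "C1 \<times> C2 \<subseteq> W"
    using W(1,3) open_prod_elim by blast
  have Csub: "C1 \<times> C2 \<subseteq> ?U" using C(4) W(2) by blast
  have xC: "x0 \<in> C1" "y0 \<in> C2" using C(3) by (auto simp: z0_def)
  have C1: "C1 \<subseteq> B1" and C2: "C2 \<subseteq> B2" using Csub xC by auto
  have main: "\<exists>Q (G::'h \<Rightarrow> 'e) D P. open Q \<and> smooth_on Q G \<and> open D \<and> smooth_on D P \<and>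
         G ` Q = F ` A \<inter> H ` B \<and> G ` Q \<subseteq> D \<and> (\<forall>a\<in>Q. P (G a) = a)"
    if A: "open A" "A \<subseteq> C1" and B: "open B" "B \<subseteq> C2" for A B
  proof -
    have AB: "A \<times> B \<subseteq> W" using A(2) B(2) C(4) by blast
    have oV: "open (\<Theta> ` (A \<times> B))"
    proof -
      have "openin (top_of_set V) (\<Theta> ` (A \<times> B))"
        using homeomorphism_imp_open_map[OF W(5), of "A \<times> B"] AB open_Times[OF A(1) B(1)]
        by (simp add: openin_open_eq W(1))
      then show ?thesis using W(4) openin_open_trans by blast
    qed
    have \<Xi>\<Theta>: "\<Xi> (\<Theta> z) = z" if "z \<in> W" for z using W(5) that by (auto simp: homeomorphism_def)
    \<comment> \<open>In the coordinates \<Theta> the zero set of \<open>g\<close> is the kernel of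
      \<open>L\<close>, and \<iota> pulls the relevant piece of it back to
      \<open>'h\<close>.\<close>
    define Q where "Q = \<iota> -` \<Theta> ` (A \<times> B)"
    define G where "G a = F (fst (\<Xi> (\<iota> a)))" for a
    \<comment> \<open>On \<open>D\<close> both left inverses are defined and the pair of their
      values lies in \<open>W\<close>, where \<Theta> is smooth. At a point of the intersection they
      recover \<open>x\<close> and \<open>y\<close> from the common value \<open>F x = H y\<close>,
      and \<pi> after \<Theta> recovers the parameter.\<close>
    define D where "D = (D1 \<inter> D2) \<inter> (\<lambda>z. (P1 z, P2 z)) -` W"
    define P where "P z = \<pi> (\<Theta> (P1 z, P2 z))" for z
    have oQ: "open Q" unfolding Q_def by (rule open_vimage[OF oV linear_continuous_on[OF bi]])
    have Q: "\<exists>x\<in>A. \<exists>y\<in>B. \<Xi> (\<iota> a) = (x, y) \<and> \<iota> a = \<Theta> (x, y) \<and> F x = H y" if a: "a \<in> Q" for a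
    proof -
      obtain x y where xy: "x \<in> A" "y \<in> B" "\<iota> a = \<Theta> (x, y)" using a by (auto simp: Q_def)
      have "L (\<iota> a) = 0" using i(3) by blast
      then have "F x = H y" using L\<Theta>[of "(x, y)"] xy by (simp add: g_def)
      moreover have "\<Xi> (\<iota> a) = (x, y)" using xy AB \<Xi>\<Theta> by auto
      ultimately show ?thesis using xy by blast
    qed
    have si: "smooth_on Q \<iota>" by (rule smooth_on_linear[OF oQ bi])
    have iV: "\<iota> a \<in> V" if "a \<in> Q" for a
      using that AB W(5) by (auto simp: Q_def homeomorphism_def)
    have s\<Xi>: "smooth_on Q (\<lambda>a. fst (\<Xi> (\<iota> a)))"
      by (rule smooth_on_linear_comp[OF oQ bounded_linear_fst smooth_on_comp[OF oQ W(4,6) si iV]])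
    have sG: "smooth_on Q G"
      unfolding G_def by (rule smooth_on_comp[OF oQ F(1,2) s\<Xi>]) (use Q A(2) C1 1(3) in fastforce)
    have oD12: "open (D1 \<inter> D2)" using 1 2 by blast
    have sP: "smooth_on (D1 \<inter> D2) (\<lambda>z. (P1 z, P2 z))"
      by (intro smooth_on_Pair oD12 smooth_on_subset[OF 1(6)] smooth_on_subset[OF 2(6)]) auto
    have oD: "open D"
      unfolding D_def by (rule continuous_open_preimage[OF smooth_on_continuous_on[OF sP] oD12 W(1)])
    have sPD: "smooth_on D P"
      unfolding P_def
      by (intro smooth_on_linear_comp[OF oD bp] smooth_on_comp[OF oD oU s\<Theta>] smooth_on_subset[OF sP])
        (use W(2) in \<open>auto simp: D_def\<close>)
    have G: "G a \<in> D \<and> P (G a) = a \<and> G a \<in> F ` A \<and> G a \<in> H ` B" if a: "a \<in> Q" for a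
    proof -
      obtain x y where xy: "x \<in> A" "y \<in> B" "\<Xi> (\<iota> a) = (x, y)" "\<iota> a = \<Theta> (x, y)" "F x = H y" using Q[OF a] by blast
      have G: "G a = F x" by (simp add: G_def xy(3))
      have xB: "x \<in> B1" "y \<in> B2" using xy A(2) B(2) C1 C2 by auto
      have P: "P1 (G a) = x" "P2 (G a) = y" using 1(7)[OF xB(1)] 2(7)[OF xB(2)] G xy(5) by auto
      have "G a \<in> D1" "G a \<in> D2" using 1(5) 2(5) xB G xy(5) by auto
      then have "G a \<in> D" using P AB xy(1,2) by (auto simp: D_def)
      moreover have "P (G a) = a" using P xy(4) i(4) by (simp add: P_def flip: xy(4))
      moreover have "G a \<in> F ` A" "G a \<in> H ` B" using G xy(1,2,5) by (metis imageI)+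
      ultimately show ?thesis by blast
    qed
    have "F ` A \<inter> H ` B \<subseteq> G ` Q"
    proof
      fix w assume "w \<in> F ` A \<inter> H ` B"
      then obtain x y where xy: "x \<in> A" "y \<in> B" "w = F x" "w = H y" by blast
      have "\<Theta> (x, y) \<in> {z. L z = 0}" using L\<Theta>[of "(x, y)"] xy by (simp add: g_def)
      then have e: "\<iota> (\<pi> (\<Theta> (x, y))) = \<Theta> (x, y)" by (rule i(5))
      then have "\<pi> (\<Theta> (x, y)) \<in> Q" using xy by (auto simp: Q_def)
      moreover have "G (\<pi> (\<Theta> (x, y))) = w" using e \<Xi>\<Theta>[of "(x, y)"] AB xy by (auto simp: G_def)
      ultimately show "w \<in> G ` Q" by blast
    qed
    then have "G ` Q = F ` A \<inter> H ` B" using G by blast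
    then show ?thesis using oQ sG oD sPD G by blast
  qed
  show ?thesis
    using C(1,2) xC C1 C2 1(3) 2(3) main by (intro exI[of _ C1] exI[of _ C2]) auto
qed

subsection \<open>Ordinary differential equations\<close>

text \<open>The derivative is bounded on a compact ball, and convexity of the ball turns the bound
  into a Lipschitz constant.\<close>

lemma smooth_on_locally_lipschitz:
  fixes X :: "'a::euclidean_space \<Rightarrow> 'b::real_normed_vector"
  assumes "open S" "smooth_on S X" "z0 \<in> S"
  obtains \<rho> K where "\<rho> > 0" "K > 0" "cball z0 \<rho> \<subseteq> S"
    "\<And>x y. x \<in> cball z0 \<rho> \<Longrightarrow> y \<in> cball z0 \<rho> \<Longrightarrow> norm (X x - X y) \<le> K * norm (x - y)"
proof -
  obtain \<rho> where \<rho>: "\<rho> > 0" "cball z0 \<rho> \<subseteq> S" using assms(1,3) open_contains_cball by blast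
  define \<beta> where "\<beta> x = (\<Sum>b\<in>Basis. norm (fderiv X x b))" for x
  have "continuous_on S \<beta>"
    unfolding \<beta>_def
    by (intro continuous_on_sum continuous_on_norm smooth_on_continuous_on[OF smooth_on_fderiv_const[OF assms(2)]])
  then have "continuous_on (cball z0 \<rho>) \<beta>" using \<rho>(2) continuous_on_subset by blast
  then have "bounded (\<beta> ` cball z0 \<rho>)"
    by (intro compact_imp_bounded compact_continuous_image) auto
  then obtain K where K: "K > 0" "\<And>x. x \<in> cball z0 \<rho> \<Longrightarrow> norm (\<beta> x) \<le> K"
    unfolding bounded_pos by blast
  have on: "onorm (fderiv X x) \<le> K" if x: "x \<in> cball z0 \<rho>" for x
  proof (rule onorm_le)
    fix v
    have d: "X differentiable (at x)" using smooth_on_differentiable[OF assms(2)] x \<rho>(2) by blast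
    have "norm (fderiv X x v) \<le> (\<Sum>b\<in>Basis. norm (fderiv X x b) * norm v)"
      unfolding linear_euclidean_sum[OF linear_frechet_derivative[OF d], of v]
      by (intro order_trans[OF norm_sum] sum_mono) (simp add: Basis_le_norm mult.commute mult_right_mono)
    also have "\<dots> = \<beta> x * norm v" by (simp add: \<beta>_def sum_distrib_right)
    also have "\<dots> \<le> K * norm v" using K(2)[OF x] by (intro mult_right_mono) auto
    finally show "norm (fderiv X x v) \<le> K * norm v" .
  qed
  show ?thesis
  proof (rule that[OF \<rho>(1) K(1) \<rho>(2)])
    fix x y assume xy: "x \<in> cball z0 \<rho>" "y \<in> cball z0 \<rho>"
    show "norm (X x - X y) \<le> K * norm (x - y)"
      by (rule differentiable_bound[OF convex_cball _ on xy(1) xy(2)])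
        (use smooth_on_has_derivative[OF assms(2)] \<rho>(2) has_derivative_at_withinI in blast)+
  qed
qed

text \<open>Each order of differentiability of \<open>z\<close> passes through \<open>X\<close> to
  its derivative \<open>X (z t)\<close>.\<close>

lemma ode_solution_smooth:
  fixes X :: "'z::euclidean_space \<Rightarrow> 'z"
  assumes "open S" "smooth_on S X" "open I"
    and z: "\<And>t. t \<in> I \<Longrightarrow> z t \<in> S" "\<And>t. t \<in> I \<Longrightarrow> (z has_vector_derivative X (z t)) (at t)"
  shows "smooth_on I z"
proof -
  have d: "(z has_derivative (\<lambda>h. h *\<^sub>R X (z t))) (at t)" if "t \<in> I" for t
    using z(2)[OF that] by (simp add: has_vector_derivative_def)
  have "Ck_on k I z" for k
  proof (induction k)
    case 0
    then show ?case by (auto intro!: continuous_at_imp_continuous_on has_derivative_continuous[OF d])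
  next
    case (Suc k)
    have "Ck_on k S X" using assms(2) by (simp add: smooth_on_def)
    then show ?case
      by (intro Ck_on_SucI[OF assms(3) d] Ck_on_linear_comp[OF assms(3) bounded_linear_scaleR_right]
          Ck_on_comp[OF assms(3,1) z(1) _ Suc])
  qed
  then show ?thesis by (simp add: smooth_on_def)
qed

text \<open>Picard iteration: extending \<open>X\<close> from a ball by the nearest-point projection makes the
  integral operator a contraction on all bounded continuous functions on the line.\<close>

lemma ode_local_existence:
  fixes X :: "'z::euclidean_space \<Rightarrow> 'z"
  assumes S: "open S" "smooth_on S X" "z0 \<in> S"
  obtains \<epsilon> z where "\<epsilon> > 0" "z 0 = z0" "\<And>t. t \<in> {-\<epsilon><..<\<epsilon>} \<Longrightarrow> z t \<in> S"
    "\<And>t. t \<in> {-\<epsilon><..<\<epsilon>} \<Longrightarrow> (z has_vector_derivative X (z t)) (at t)"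
    "smooth_on {-\<epsilon><..<\<epsilon>} z"
proof -
  obtain \<rho> K where \<rho>: "\<rho> > 0" "K > 0" "cball z0 \<rho> \<subseteq> S"
    and lip: "\<And>x y. x \<in> cball z0 \<rho> \<Longrightarrow> y \<in> cball z0 \<rho> \<Longrightarrow> norm (X x - X y) \<le> K * norm (x - y)"
    using smooth_on_locally_lipschitz[OF S] by blast
  let ?B = "cball z0 \<rho>"
  have B: "convex ?B" "closed ?B" "?B \<noteq> {}" "z0 \<in> ?B" using \<rho>(1) by auto
  define Y where "Y x = X (closest_point ?B x)" for x
  have cp: "closest_point ?B x \<in> ?B" for x by (rule closest_point_in_set[OF B(2,3)])
  have Ylip: "norm (Y x - Y y) \<le> K * norm (x - y)" for x y
  proof -
    have "norm (Y x - Y y) \<le> K * norm (closest_point ?B x - closest_point ?B y)"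
      unfolding Y_def by (rule lip[OF cp cp])
    also have "\<dots> \<le> K * norm (x - y)"
      using closest_point_lipschitz[OF B(1-3), of x y] \<rho>(2) by (intro mult_left_mono) (auto simp: dist_norm)
    finally show ?thesis .
  qed
  define M where "M = norm (X z0) + K * \<rho> + 1"
  have M: "M > 0" using \<rho> by (simp add: M_def add_nonneg_pos)
  have YM: "norm (Y x) \<le> M" for x
  proof -
    have "norm (X (closest_point ?B x) - X z0) \<le> K * norm (closest_point ?B x - z0)"
      by (rule lip[OF cp B(4)])
    also have "\<dots> \<le> K * \<rho>" using cp[of x] \<rho>(2) by (intro mult_left_mono) (auto simp: dist_norm norm_minus_commute)
    finally show ?thesis using norm_triangle_ineq2[of "X (closest_point ?B x)" "X z0"] by (simp add: Y_def M_def)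
  qed
  have Ycont: "continuous_on UNIV Y"
  proof (rule continuous_at_imp_continuous_on, rule ballI)
    fix x :: 'z
    have "(\<lambda>y. K * norm (y - x)) \<midarrow>x\<rightarrow> K * norm (x - x)" by (rule tendsto_mult[OF tendsto_const tendsto_norm[OF tendsto_diff[OF tendsto_ident_at tendsto_const]]])
    then have "(\<lambda>y. K * norm (y - x)) \<midarrow>x\<rightarrow> 0" by simp
    then have "(\<lambda>y. Y y - Y x) \<midarrow>x\<rightarrow> 0"
      by (rule Lim_null_comparison[rotated]) (simp add: Ylip)
    then show "isCont Y x" by (simp add: isCont_def LIM_zero_iff)
  qed
  \<comment> \<open>The first bound keeps the iterates within distance \<rho> of \<open>z0\<close>,
    the second makes the iteration contract by 1/2. The factor 3 arises because the integral from 0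
    to t is written as a difference of two integrals starting at -\<epsilon>, over lengths at most
    2\<epsilon> and \<epsilon>.\<close>
  define \<epsilon> where "\<epsilon> = min (\<rho> / (3 * M)) (1 / (6 * K))"
  have \<epsilon>: "\<epsilon> > 0" "3 * \<epsilon> * M \<le> \<rho>" "3 * \<epsilon> * K \<le> 1 / 2"
    using \<rho> M by (auto simp: \<epsilon>_def min_def field_simps)
  \<comment> \<open>Freezing the time outside [-\<epsilon>, \<epsilon>] keeps the integrals bounded,
    so that the operator acts on bounded continuous functions on the whole line.\<close>
  define c where "c t = max (-\<epsilon>) (min \<epsilon> t)" for t :: real
  have c: "c t \<in> {-\<epsilon>..\<epsilon>}" for t using \<epsilon>(1) by (auto simp: c_def)
  define J where "J f t = integral {-\<epsilon>..c t} f - integral {-\<epsilon>..0} f" for f :: "real \<Rightarrow> 'z" and t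
  have Jb: "norm (J f t) \<le> 3 * \<epsilon> * b" if f: "continuous_on UNIV f" "\<And>s. norm (f s) \<le> b" for f b t
  proof -
    have b: "b \<ge> 0" using f(2)[of 0] norm_ge_zero order_trans by blast
    have "norm (integral {-\<epsilon>..c t} f) \<le> b * (c t - -\<epsilon>)"
      using c[of t] f(2) by (intro integral_bound continuous_on_subset[OF f(1)]) auto
    moreover have "b * (c t - -\<epsilon>) \<le> b * (2 * \<epsilon>)" using c[of t] b by (intro mult_left_mono) auto
    moreover have "norm (integral {-\<epsilon>..0} f) \<le> b * (0 - -\<epsilon>)"
      using \<epsilon>(1) f(2) by (intro integral_bound continuous_on_subset[OF f(1)]) auto
    moreover have "norm (J f t) \<le> norm (integral {-\<epsilon>..c t} f) + norm (integral {-\<epsilon>..0} f)"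
      unfolding J_def by (rule norm_triangle_ineq4)
    ultimately show ?thesis by (simp add: algebra_simps)
  qed
  have Jc: "continuous_on UNIV (J f)" if f: "continuous_on UNIV f" for f
  proof -
    have "continuous_on {-\<epsilon>..\<epsilon>} (\<lambda>x. integral {-\<epsilon>..x} f)"
      by (intro indefinite_integral_continuous_1 integrable_continuous_real continuous_on_subset[OF f]) auto
    moreover have "continuous_on UNIV c" unfolding c_def by (intro continuous_intros)
    ultimately have "continuous_on UNIV (\<lambda>t. integral {-\<epsilon>..c t} f)"
      using c by (intro continuous_on_compose2[of "{-\<epsilon>..\<epsilon>}" "\<lambda>x. integral {-\<epsilon>..x} f" UNIV c]) auto
    then show ?thesis unfolding J_def by (intro continuous_intros)
  qed
  define T where "T w t = z0 + J (\<lambda>s. Y (apply_bcontfun w s)) t" for w :: "real \<Rightarrow>\<^sub>C 'z" and t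
  have Yw: "continuous_on UNIV (\<lambda>s. Y (apply_bcontfun w s))" for w :: "real \<Rightarrow>\<^sub>C 'z"
    by (rule continuous_on_compose2[OF Ycont]) auto
  have Tb: "T w \<in> bcontfun" for w
  proof (rule bcontfun_normI)
    show "continuous_on UNIV (T w)" unfolding T_def by (intro continuous_intros Jc Yw)
    show "norm (T w t) \<le> norm z0 + 3 * \<epsilon> * M" for t
      unfolding T_def by (rule order_trans[OF norm_triangle_ineq]) (intro add_left_mono Jb Yw YM)
  qed
  have Tap: "apply_bcontfun (Bcontfun (T w)) = T w" for w by (rule Bcontfun_inverse[OF Tb])
  have "\<exists>!w. Bcontfun (T w) = w"
  proof (rule banach_fix_type[where c="1/2"])
    show "\<forall>w v. dist (Bcontfun (T w)) (Bcontfun (T v)) \<le> 1/2 * dist w v"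
    proof (intro allI dist_bound)
      fix w v :: "real \<Rightarrow>\<^sub>C 'z" and t :: real
      let ?f = "\<lambda>s. Y (apply_bcontfun w s)" and ?g = "\<lambda>s. Y (apply_bcontfun v s)"
      have int: "?f integrable_on {a..b}" "?g integrable_on {a..b}" for a b
        by (intro integrable_continuous_real continuous_on_subset[OF Yw] subset_UNIV)+
      have "T w t - T v t = J (\<lambda>s. ?f s - ?g s) t"
        unfolding T_def J_def by (simp add: integral_diff int)
      also have "norm \<dots> \<le> 3 * \<epsilon> * (K * dist w v)"
      proof (rule Jb)
        show "continuous_on UNIV (\<lambda>s. ?f s - ?g s)" by (intro continuous_on_diff Yw)
        show "norm (?f s - ?g s) \<le> K * dist w v" for s
          using order_trans[OF Ylip[folded dist_norm] mult_left_mono[OF dist_bounded, of K]] \<rho>(2) by (simp add: dist_norm)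
      qed
      also have "\<dots> = 3 * \<epsilon> * K * dist w v" by simp
      also have "\<dots> \<le> 1/2 * dist w v" by (rule mult_right_mono[OF \<epsilon>(3)]) simp
      finally show "dist (apply_bcontfun (Bcontfun (T w)) t) (apply_bcontfun (Bcontfun (T v)) t) \<le> 1/2 * dist w v"
        by (simp add: Tap dist_norm)
    qed
  qed auto
  then obtain w where "Bcontfun (T w) = w" by blast
  then have w: "apply_bcontfun w = T w" using Tap[of w] by simp
  define z where "z = apply_bcontfun w"
  let ?f = "\<lambda>s. Y (z s)"
  have zT: "z t = z0 + J ?f t" for t using fun_cong[OF w, of t] by (simp only: z_def T_def)
  have cf: "continuous_on UNIV ?f" using Yw by (simp add: z_def)
  \<comment> \<open>The fixed point never leaves the ball, so the projection is trivial along it and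
    \<open>Y\<close> agrees with \<open>X\<close> there.\<close>
  have zB: "z t \<in> ?B" for t
    using Jb[OF cf YM, of t] \<epsilon>(2) zT[of t] by (auto simp only: dist_norm mem_cball norm_minus_commute[of z0] add_diff_cancel_left')
  have Yz: "Y (z t) = X (z t)" for t by (simp add: Y_def closest_point_self[OF zB])
  have der: "(z has_vector_derivative X (z t)) (at t)" if t: "t \<in> {-\<epsilon><..<\<epsilon>}" for t
  proof -
    have "((\<lambda>u. integral {-\<epsilon>..u} ?f) has_vector_derivative ?f t) (at t within {-\<epsilon>..\<epsilon>})"
      using t by (intro integral_has_vector_derivative continuous_on_subset[OF cf]) auto
    moreover have "at t within {-\<epsilon>..\<epsilon>} = at t" using t by (intro at_within_interior) (simp add: interior_atLeastAtMost_real)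
    ultimately have "((\<lambda>u. integral {-\<epsilon>..u} ?f) has_vector_derivative ?f t) (at t)" by simp
    then have "((\<lambda>u. (z0 - integral {-\<epsilon>..0} ?f) + integral {-\<epsilon>..u} ?f) has_vector_derivative 0 + ?f t) (at t)"
      by (intro has_vector_derivative_add has_vector_derivative_const)
    then have "(z has_vector_derivative 0 + ?f t) (at t)"
      by (rule has_vector_derivative_transform_within_open[OF _ open_greaterThanLessThan t])
        (subst zT, simp add: J_def c_def)
    then show ?thesis by (simp add: Yz)
  qed
  show ?thesis
  proof (rule that[OF \<epsilon>(1) _ _ der])
    show "z 0 = z0" using \<epsilon>(1) by (subst zT) (simp add: J_def c_def)
    show zS: "z t \<in> S" if "t \<in> {-\<epsilon><..<\<epsilon>}" for t using zB \<rho>(3) by blast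
    show "smooth_on {-\<epsilon><..<\<epsilon>} z"
      by (rule ode_solution_smooth[OF S(1,2) open_greaterThanLessThan zS der])
  qed
qed

subsection \<open>Riemannian metrics on open sets\<close>

definition pos_form :: "('e::euclidean_space \<Rightarrow> 'e \<Rightarrow> real) \<Rightarrow> bool" where
  "pos_form g \<longleftrightarrow> (\<forall>a b. g a b = g b a) \<and> (\<forall>a. linear (g a)) \<and> (\<forall>a. a \<noteq> 0 \<longrightarrow> g a a > 0)"

lemma pos_form_sym: "pos_form g \<Longrightarrow> g a b = g b a"
  and pos_form_linear: "pos_form g \<Longrightarrow> linear (g a)"
  and pos_form_pos: "pos_form g \<Longrightarrow> a \<noteq> 0 \<Longrightarrow> g a a > 0"
  by (auto simp: pos_form_def)

lemma pos_form_linear_left: "pos_form g \<Longrightarrow> linear (\<lambda>a. g a b)"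
  using pos_form_linear[of g b] by (simp add: pos_form_sym[of g _ b])

lemma pos_form_add:
  assumes "pos_form g"
  shows "g (a + b) c = g a c + g b c" "g c (a + b) = g c a + g c b"
  using linear_add[OF pos_form_linear[OF assms, of c]] pos_form_sym[OF assms] by simp_all

lemma pos_form_diff:
  assumes "pos_form g"
  shows "g (a - b) c = g a c - g b c" "g c (a - b) = g c a - g c b"
  using linear_diff[OF pos_form_linear[OF assms, of c]] pos_form_sym[OF assms] by simp_all

lemma pos_form_scale:
  assumes "pos_form g"
  shows "g (r *\<^sub>R a) c = r * g a c" "g c (r *\<^sub>R a) = r * g c a"
  using linear_cmul[OF pos_form_linear[OF assms, of c]] pos_form_sym[OF assms] by simp_all

lemma pos_form_eqI:
  assumes "pos_form g" "\<And>c. g a c = g b c"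
  shows "a = b"
proof (rule ccontr)
  assume "a \<noteq> b"
  then have "g (a - b) (a - b) > 0" by (intro pos_form_pos[OF assms(1)]) simp
  then show False by (simp add: pos_form_diff[OF assms(1)] assms(2))
qed

text \<open>The Gram matrix of \<open>g\<close> as an endomorphism of Euclidean space. Representing
  a functional by \<open>g\<close> becomes inverting this operator, and
  \<open>smooth_on_inverse_operator\<close> then controls how the solution depends on the base
  point.\<close>

definition form_operator :: "('e::euclidean_space \<Rightarrow> 'e \<Rightarrow> real) \<Rightarrow> 'e \<Rightarrow> 'e" where
  "form_operator g w = (\<Sum>b\<in>Basis. g w b *\<^sub>R b)"

lemma form_operator_bij:
  assumes "pos_form g"
  shows "linear (form_operator g)" "bij (form_operator g)" "g w a = form_operator g w \<bullet> a"
proof -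
  show lin: "linear (form_operator g)"
    unfolding form_operator_def
    by (intro linearI) (simp_all add: pos_form_add[OF assms] pos_form_scale[OF assms] scaleR_add_left sum.distrib
        scaleR_sum_right)
  show eq: "g w a = form_operator g w \<bullet> a" for w a
    using linear_euclidean_sum[OF pos_form_linear[OF assms, of w], of a]
    by (simp add: form_operator_def inner_sum_left mult.commute) (simp add: inner_commute)
  have "inj (form_operator g)" by (rule injI) (use pos_form_eqI[OF assms] eq in metis)
  then show "bij (form_operator g)" using linear_injective_imp_surjective[OF lin] by (simp add: bij_def)
qed

lemma pos_form_riesz:
  assumes "pos_form g" "linear \<phi>"
  obtains w where "\<And>b. g w b = \<phi> b"
proof -
  obtain w where w: "form_operator g w = (\<Sum>b\<in>Basis. \<phi> b *\<^sub>R b)"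
    using form_operator_bij(2)[OF assms(1)] by (metis bij_pointE)
  have "g w b = \<phi> b" for b
    using form_operator_bij(3)[OF assms(1), of w b] linear_euclidean_sum[OF assms(2), of b]
    by (simp add: w inner_sum_left mult.commute) (simp add: inner_commute)
  then show ?thesis using that by blast
qed

definition metric_on :: "'e::euclidean_space set \<Rightarrow> ('e \<Rightarrow> 'e \<Rightarrow> 'e \<Rightarrow> real) \<Rightarrow> bool" where
  "metric_on S g \<longleftrightarrow> open S \<and> (\<forall>x\<in>S. pos_form (g x)) \<and> (\<forall>a b. smooth_on S (\<lambda>x. g x a b))"

lemma metric_onD:
  assumes "metric_on S g"
  shows "open S" "x \<in> S \<Longrightarrow> pos_form (g x)" "smooth_on S (\<lambda>x. g x a b)"
    "x \<in> S \<Longrightarrow> (\<lambda>x. g x a b) differentiable (at x)"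
  using assms smooth_on_differentiable unfolding metric_on_def by blast+

text \<open>The product rule for linear fields, applied once in each argument of the form; the first
  term is the change of the metric itself.\<close>

lemma has_derivative_metric:
  assumes g: "metric_on S g" and T: "open T" "x \<in> T" "\<And>y. y \<in> T \<Longrightarrow> P y \<in> S"
    and P: "(P has_derivative P') (at x)" and U: "(U has_derivative U') (at x)" and V: "(V has_derivative V') (at x)"
  shows "((\<lambda>y. g (P y) (U y) (V y)) has_derivative
    (\<lambda>e. fderiv (\<lambda>z. g z (U x) (V x)) (P x) (P' e) + g (P x) (U' e) (V x) + g (P x) (U x) (V' e))) (at x)"
proof -
  have 1: "((\<lambda>y. g (P y) a b) has_derivative (\<lambda>e. fderiv (\<lambda>z. g z a b) (P x) (P' e))) (at x)" for a b
    by (rule has_derivative_compose[OF P smooth_on_has_derivative[OF metric_onD(3)[OF g] T(3)[OF T(2)]]])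
  have 2: "((\<lambda>y. g (P y) (U y) b) has_derivative
     (\<lambda>e. fderiv (\<lambda>z. g z (U x) b) (P x) (P' e) + g (P x) (U' e) b)) (at x)" for b
    using has_derivative_linear_field[OF T(1,2), of "\<lambda>y a. g (P y) a b"
        "\<lambda>e a. fderiv (\<lambda>z. g z a b) (P x) (P' e)", OF pos_form_linear_left[OF metric_onD(2)[OF g T(3)]] 1 U] .
  show ?thesis
    using has_derivative_linear_field[OF T(1,2), of "\<lambda>y b. g (P y) (U y) b"
        "\<lambda>e b. fderiv (\<lambda>z. g z (U x) b) (P x) (P' e) + g (P x) (U' e) b",
        OF pos_form_linear[OF metric_onD(2)[OF g T(3)]] 2 V] .
qed

text \<open>Bilinearity and symmetry hold on a whole neighbourhood, so they pass to the derivatives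
  of the coefficients.\<close>

lemma fderiv_metric_linear:
  assumes g: "metric_on S g" and x: "x \<in> S"
  shows "linear (\<lambda>a. fderiv (\<lambda>y. g y a b) x e)" "linear (\<lambda>b. fderiv (\<lambda>y. g y a b) x e)"
    "linear (\<lambda>e. fderiv (\<lambda>y. g y a b) x e)" "fderiv (\<lambda>y. g y a b) x = fderiv (\<lambda>y. g y b a) x"
proof -
  note S = metric_onD(1)[OF g]
  have d: "((\<lambda>y. g y a b) has_derivative fderiv (\<lambda>y. g y a b) x) (at x)" for a b
    by (rule smooth_on_has_derivative[OF metric_onD(3)[OF g] x])
  show sym: "fderiv (\<lambda>y. g y a b) x = fderiv (\<lambda>y. g y b a) x" for a b
    by (rule fderiv_cong[OF S x _ metric_onD(4)[OF g x]]) (rule pos_form_sym[OF metric_onD(2)[OF g]])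
  show lin: "linear (\<lambda>b. fderiv (\<lambda>y. g y a b) x e)" for a e
  proof (rule linearI)
    fix b c :: 'a and r :: real
    have "fderiv (\<lambda>y. g y a (b + c)) x = fderiv (\<lambda>y. g y a b + g y a c) x"
      by (rule fderiv_cong[OF S x _ metric_onD(4)[OF g x]]) (rule pos_form_add(2)[OF metric_onD(2)[OF g]])
    also have "\<dots> = (\<lambda>e. fderiv (\<lambda>y. g y a b) x e + fderiv (\<lambda>y. g y a c) x e)"
      by (rule fderiv_eqI[OF has_derivative_add[OF d d]])
    finally show "fderiv (\<lambda>y. g y a (b + c)) x e = fderiv (\<lambda>y. g y a b) x e + fderiv (\<lambda>y. g y a c) x e" by simp
    have "fderiv (\<lambda>y. g y a (r *\<^sub>R b)) x = fderiv (\<lambda>y. r * g y a b) x"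
      by (rule fderiv_cong[OF S x _ metric_onD(4)[OF g x]]) (rule pos_form_scale(2)[OF metric_onD(2)[OF g]])
    also have "\<dots> = (\<lambda>e. r * fderiv (\<lambda>y. g y a b) x e)"
      by (rule fderiv_eqI[OF has_derivative_mult_right[OF d]])
    finally show "fderiv (\<lambda>y. g y a (r *\<^sub>R b)) x e = r *\<^sub>R fderiv (\<lambda>y. g y a b) x e" by simp
  qed
  have "(\<lambda>a. fderiv (\<lambda>y. g y a b) x e) = (\<lambda>a. fderiv (\<lambda>y. g y b a) x e)"
    by (rule ext, rule fun_cong[OF sym])
  then show "linear (\<lambda>a. fderiv (\<lambda>y. g y a b) x e)" using lin[of b e] by simp
  show "linear (\<lambda>e. fderiv (\<lambda>y. g y a b) x e)"
    by (rule linear_frechet_derivative[OF metric_onD(4)[OF g x]])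
qed

section \<open>The Levi-Civita connection in coordinates\<close>

definition is_christoffel :: "('e::euclidean_space \<Rightarrow> 'e \<Rightarrow> 'e \<Rightarrow> real) \<Rightarrow> 'e \<Rightarrow> ('e \<Rightarrow> 'e \<Rightarrow> 'e) \<Rightarrow> bool" where
  "is_christoffel g x \<Gamma> \<longleftrightarrow> (\<forall>a b. \<Gamma> a b = \<Gamma> b a) \<and>
     (\<forall>a b e. fderiv (\<lambda>y. g y a b) x e = g x (\<Gamma> e a) b + g x a (\<Gamma> e b))"

definition christoffel_of :: "('e::euclidean_space \<Rightarrow> 'e \<Rightarrow> 'e \<Rightarrow> real) \<Rightarrow> 'e \<Rightarrow> 'e \<Rightarrow> 'e \<Rightarrow> 'e" where
  "christoffel_of g x = (THE \<Gamma>. is_christoffel g x \<Gamma>)"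

lemma christoffel_eq: "christoffel M c x = christoffel_of (metric_coeff M c) x"
  by (simp add: christoffel_def christoffel_of_def is_christoffel_def)

text \<open>The Koszul formula for coordinate fields, whose brackets vanish; equivalently, the
  Christoffel symbols of the first kind.\<close>

definition koszul :: "('e::euclidean_space \<Rightarrow> 'e \<Rightarrow> 'e \<Rightarrow> real) \<Rightarrow> 'e \<Rightarrow> 'e \<Rightarrow> 'e \<Rightarrow> 'e \<Rightarrow> real" where
  "koszul g x e a b = (fderiv (\<lambda>y. g y a b) x e + fderiv (\<lambda>y. g y e b) x a - fderiv (\<lambda>y. g y e a) x b) / 2"

text \<open>Three instances of the compatibility identity, added with the signs of the Koszul
  formula, cancel by the symmetry of \<Gamma> down to twice a single term. Nondegeneracy of the
  metric then makes \<Gamma> unique.\<close>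

lemma is_christoffel_koszul:
  assumes g: "metric_on S g" and x: "x \<in> S" and \<Gamma>: "is_christoffel g x \<Gamma>"
  shows "g x (\<Gamma> e a) b = koszul g x e a b"
proof -
  have s: "\<And>a b. \<Gamma> a b = \<Gamma> b a" and
    c: "\<And>a b e. fderiv (\<lambda>y. g y a b) x e = g x (\<Gamma> e a) b + g x a (\<Gamma> e b)"
    using \<Gamma> by (auto simp: is_christoffel_def)
  show ?thesis
    unfolding koszul_def c using s[of e b] s[of a b] s[of a e] pos_form_sym[OF metric_onD(2)[OF g x]]
    by (simp add: field_simps)
qed

lemma koszul_linear:
  assumes g: "metric_on S g" and x: "x \<in> S"
  shows "linear (koszul g x e a)" "linear (\<lambda>a. koszul g x e a b)"
proof -
  have *: "linear (\<lambda>b. (A b + B b - C b) / 2)" if "linear A" "linear B" "linear C" for A B C :: "'a \<Rightarrow> real"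
    by (intro linearI)
      (simp_all add: linear_add[OF that(1)] linear_add[OF that(2)] linear_add[OF that(3)]
        linear_cmul[OF that(1)] linear_cmul[OF that(2)] linear_cmul[OF that(3)] field_simps)
  note lin = fderiv_metric_linear[OF g x]
  show "linear (koszul g x e a)" "linear (\<lambda>a. koszul g x e a b)"
    unfolding koszul_def by (intro * lin)+
qed

text \<open>\<Gamma> is the Riesz representative of the Koszul functional. Its symmetry and its
  compatibility with the metric both reduce to the symmetry of the metric coefficients.\<close>

lemma is_christoffel_exists:
  assumes g: "metric_on S g" and x: "x \<in> S"
  shows "\<exists>\<Gamma>. is_christoffel g x \<Gamma>"
proof -
  note lin = fderiv_metric_linear[OF g x]
  have "\<exists>w. \<forall>b. g x w b = koszul g x e a b" for e a
    using pos_form_riesz[OF metric_onD(2)[OF g x] koszul_linear(1)[OF g x]] by metis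
  then obtain \<Gamma> where \<Gamma>: "\<And>e a b. g x (\<Gamma> e a) b = koszul g x e a b" by metis
  have "\<Gamma> a b = \<Gamma> b a" for a b
  proof (rule pos_form_eqI[OF metric_onD(2)[OF g x]])
    show "g x (\<Gamma> a b) c = g x (\<Gamma> b a) c" for c
      unfolding \<Gamma> koszul_def using lin(4)[of a b] by simp
  qed
  moreover have "fderiv (\<lambda>y. g y a b) x e = g x (\<Gamma> e a) b + g x a (\<Gamma> e b)" for a b e
    unfolding pos_form_sym[OF metric_onD(2)[OF g x], of a] \<Gamma> koszul_def using lin(4)[of a b]
    by (simp add: field_simps)
  ultimately show ?thesis unfolding is_christoffel_def by blast
qed

lemma christoffel_of_unique:
  assumes g: "metric_on S g" and x: "x \<in> S" and \<Gamma>: "is_christoffel g x \<Gamma>"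
  shows "christoffel_of g x = \<Gamma>"
  unfolding christoffel_of_def
proof (rule the_equality[where P="is_christoffel g x", OF \<Gamma>])
  fix \<Gamma>' assume \<Gamma>': "is_christoffel g x \<Gamma>'"
  show "\<Gamma>' = \<Gamma>"
  proof (intro ext, rule pos_form_eqI[OF metric_onD(2)[OF g x]])
    show "g x (\<Gamma>' e a) b = g x (\<Gamma> e a) b" for e a b
      using is_christoffel_koszul[OF g x] \<Gamma> \<Gamma>' by metis
  qed
qed

lemma is_christoffel_of:
  assumes g: "metric_on S g" and x: "x \<in> S"
  shows "is_christoffel g x (christoffel_of g x)"
  using is_christoffel_exists[OF assms] christoffel_of_unique[OF assms] by metis

lemma christoffel_of_koszul:
  assumes g: "metric_on S g" and x: "x \<in> S"
  shows "g x (christoffel_of g x e a) b = koszul g x e a b"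
  by (rule is_christoffel_koszul[OF assms is_christoffel_of[OF assms]])

lemma christoffel_of_sym:
  assumes g: "metric_on S g" and x: "x \<in> S"
  shows "christoffel_of g x a b = christoffel_of g x b a"
  using is_christoffel_of[OF assms] by (auto simp: is_christoffel_def)

lemma christoffel_of_linear:
  assumes g: "metric_on S g" and x: "x \<in> S"
  shows "linear (christoffel_of g x e)" "linear (\<lambda>a. christoffel_of g x a e)"
proof -
  note pf = metric_onD(2)[OF g x] and l = koszul_linear(2)[OF g x]
  show 1: "linear (christoffel_of g x e)" for e
  proof (rule linearI; rule pos_form_eqI[OF pf])
    show "g x (christoffel_of g x e (a + b)) c = g x (christoffel_of g x e a + christoffel_of g x e b) c" for a b c
      by (simp add: pos_form_add[OF pf] christoffel_of_koszul[OF assms] linear_add[OF l])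
    show "g x (christoffel_of g x e (r *\<^sub>R a)) c = g x (r *\<^sub>R christoffel_of g x e a) c" for r a c
      by (simp add: pos_form_scale[OF pf] christoffel_of_koszul[OF assms] linear_cmul[OF l])
  qed
  show "linear (\<lambda>a. christoffel_of g x a e)" using 1[of e] by (simp add: christoffel_of_sym[OF assms, of _ e])
qed

text \<open>The symbols solve a linear system with the Gram operator as matrix and the Koszul
  functional as right-hand side; both are smooth, and so is the inverse of the operator.\<close>

lemma smooth_on_christoffel_of:
  assumes g: "metric_on S g"
  shows "smooth_on S (\<lambda>x. christoffel_of g x e a)"
proof -
  note S = metric_onD(1)[OF g]
  let ?A = "\<lambda>x. form_operator (g x)"
  let ?R = "\<lambda>x. inv (form_operator (g x))"
  have lin: "linear (?A x)" if "x \<in> S" for x by (rule form_operator_bij(1)[OF metric_onD(2)[OF g that]])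
  have b: "bij (?A x)" if "x \<in> S" for x by (rule form_operator_bij(2)[OF metric_onD(2)[OF g that]])
  have i: "?R x (?A x v) = v" "?A x (?R x v) = v" if "x \<in> S" for x v
    using b[OF that] by (simp_all add: bij_is_inj bij_is_surj surj_f_inv_f)
  have sA: "smooth_on S (\<lambda>x. ?A x v)" for v
    unfolding form_operator_def
    by (intro smooth_on_sum smooth_on_scaleR S smooth_on_const metric_onD(3)[OF g])
  have sR: "smooth_on S (\<lambda>x. ?R x w)" for w
    by (rule smooth_on_inverse_operator[where A="?A" and R="?R", OF S lin i sA])
  have linR: "linear (?R x)" if "x \<in> S" for x
    by (rule inj_linear_imp_inv_linear[OF lin[OF that] bij_is_inj[OF b[OF that]]])
  have sk: "smooth_on S (\<lambda>x. koszul g x e a b)" for b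
  proof -
    have "smooth_on S (\<lambda>x. (1/2) *\<^sub>R (fderiv (\<lambda>y. g y a b) x e + fderiv (\<lambda>y. g y e b) x a - fderiv (\<lambda>y. g y e a) x b))"
      by (intro smooth_on_scaleR smooth_on_const S smooth_on_diff smooth_on_add smooth_on_fderiv_const metric_onD(3)[OF g])
    then show ?thesis by (simp add: koszul_def)
  qed
  have "smooth_on S (\<lambda>x. ?R x (\<Sum>b\<in>Basis. koszul g x e a b *\<^sub>R b))"
    by (rule smooth_on_linear_field[OF S linR sR]) (assumption, intro smooth_on_sum smooth_on_scaleR smooth_on_const S sk)
  then show ?thesis
  proof (rule smooth_on_cong[OF _ S])
    fix x assume x: "x \<in> S"
    have "?A x (christoffel_of g x e a) = (\<Sum>b\<in>Basis. koszul g x e a b *\<^sub>R b)"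
      by (simp add: form_operator_def christoffel_of_koszul[OF g x])
    then show "?R x (\<Sum>b\<in>Basis. koszul g x e a b *\<^sub>R b) = christoffel_of g x e a"
      using i(1)[OF x] by metis
  qed
qed

section \<open>Second derivatives and the covariant Hessian\<close>

definition hess :: "('a::real_normed_vector \<Rightarrow> 'b::real_normed_vector) \<Rightarrow> 'a \<Rightarrow> 'a \<Rightarrow> 'a \<Rightarrow> 'b" where
  "hess F x u v = fderiv (\<lambda>y. fderiv F y v) x u"

lemma has_derivative_fderiv_field:
  fixes F :: "'a::euclidean_space \<Rightarrow> 'b::real_normed_vector"
  assumes F: "smooth_on S F" and T: "open T" "x \<in> T" "\<And>y. y \<in> T \<Longrightarrow> P y \<in> S"
    and P: "(P has_derivative P') (at x)" and V: "(V has_derivative V') (at x)"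
  shows "((\<lambda>y. fderiv F (P y) (V y)) has_derivative
    (\<lambda>e. hess F (P x) (P' e) (V x) + fderiv F (P x) (V' e))) (at x)"
proof (rule has_derivative_linear_field[OF T(1,2), of "\<lambda>y. fderiv F (P y)" "\<lambda>e. hess F (P x) (P' e)"])
  show "linear (fderiv F (P y))" if "y \<in> T" for y
    using linear_frechet_derivative smooth_on_differentiable[OF F T(3)[OF that]] by blast
  show "((\<lambda>y. fderiv F (P y) b) has_derivative (\<lambda>e. hess F (P x) (P' e) b)) (at x)" for b
    unfolding hess_def
    by (rule has_derivative_compose[OF P smooth_on_has_derivative[OF smooth_on_fderiv_const[OF F] T(3)[OF T(2)]]])
qed (rule V)

lemma fderiv_compose:
  assumes "smooth_on S F" "smooth_on T P" "x \<in> T" "P x \<in> S"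
  shows "fderiv (\<lambda>y. F (P y)) x v = fderiv F (P x) (fderiv P x v)"
  using fderiv_eqI[OF has_derivative_compose[OF smooth_on_has_derivative[OF assms(2,3)] smooth_on_has_derivative[OF assms(1,4)]]]
  by simp

lemma hess_compose:
  fixes F :: "'a::euclidean_space \<Rightarrow> 'b::real_normed_vector"
  assumes F: "smooth_on S F" and T: "open T" "x \<in> T" "\<And>y. y \<in> T \<Longrightarrow> P y \<in> S" and P: "smooth_on T P"
  shows "hess (\<lambda>y. F (P y)) x u v = hess F (P x) (fderiv P x u) (fderiv P x v) + fderiv F (P x) (hess P x u v)"
proof -
  have d: "((\<lambda>y. fderiv F (P y) (fderiv P y v)) has_derivative
    (\<lambda>e. hess F (P x) (fderiv P x e) (fderiv P x v) + fderiv F (P x) (hess P x e v))) (at x)"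
    unfolding hess_def[of P]
    by (intro has_derivative_fderiv_field[OF F T] smooth_on_has_derivative[OF P T(2)]
        smooth_on_has_derivative[OF smooth_on_fderiv_const[OF P] T(2)])
  have "hess (\<lambda>y. F (P y)) x u v = fderiv (\<lambda>y. fderiv F (P y) (fderiv P y v)) x u"
    unfolding hess_def
  proof (rule fun_cong[OF fderiv_cong[OF T(1,2), symmetric]])
    show "fderiv F (P y) (fderiv P y v) = fderiv (\<lambda>y. F (P y)) y v" if "y \<in> T" for y
      using fderiv_compose[OF F P that T(3)[OF that]] by simp
    show "(\<lambda>y. fderiv F (P y) (fderiv P y v)) differentiable at x"
      using d by (auto simp: differentiable_def)
  qed
  then show ?thesis using fderiv_eqI[OF d] by simp
qed

text \<open>The ambient covariant derivative, in direction \<open>u\<close>, of the field along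
  \<open>F\<close> that is the image of the constant coordinate field \<open>v\<close>. It contains
  no Christoffel term of the domain: that term is tangent to the image, and submanifolds are
  compared modulo such vectors.\<close>

definition cov_hess :: "('e::euclidean_space \<Rightarrow> 'e \<Rightarrow> 'e \<Rightarrow> real) \<Rightarrow> ('a::real_normed_vector \<Rightarrow> 'e) \<Rightarrow> 'a \<Rightarrow> 'a \<Rightarrow> 'a \<Rightarrow> 'e" where
  "cov_hess g F x u v = hess F x u v + christoffel_of g (F x) (fderiv F x u) (fderiv F x v)"

lemma hess_cong:
  assumes "open S" "x \<in> S" "\<And>y. y \<in> S \<Longrightarrow> f y = g y" "smooth_on S f"
  shows "hess f x = hess g x"
proof (intro ext)
  fix u v
  have "fderiv (\<lambda>y. fderiv f y v) x = fderiv (\<lambda>y. fderiv g y v) x"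
  proof (rule fderiv_cong[OF assms(1,2)])
    show "fderiv f y v = fderiv g y v" if "y \<in> S" for y
      using fderiv_cong[OF assms(1) that assms(3) smooth_on_differentiable[OF assms(4) that]] by simp
    show "(\<lambda>y. fderiv f y v) differentiable at x"
      by (rule smooth_on_differentiable[OF smooth_on_fderiv_const[OF assms(4)] assms(2)])
  qed
  then show "hess f x u v = hess g x u v" by (simp add: hess_def)
qed

text \<open>The second-order chain rule. Its only correction,
  \<open>fderiv F (P x) (hess P x u v)\<close>, is tangent to the image of \<open>F\<close>, so a
  lift preserves the covariant Hessian modulo tangent vectors.\<close>

lemma cov_hess_compose:
  fixes F :: "'a::euclidean_space \<Rightarrow> 'e::euclidean_space"
  assumes F: "smooth_on S F" and T: "open T" "x \<in> T" "\<And>y. y \<in> T \<Longrightarrow> P y \<in> S" and P: "smooth_on T P"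
    and G: "\<And>y. y \<in> T \<Longrightarrow> G y = F (P y)" "smooth_on T G"
  shows "fderiv G x v = fderiv F (P x) (fderiv P x v)"
    "cov_hess g G x u v = cov_hess g F (P x) (fderiv P x u) (fderiv P x v) + fderiv F (P x) (hess P x u v)"
proof -
  have e: "fderiv G x = fderiv (\<lambda>y. F (P y)) x"
    by (rule fderiv_cong[OF T(1,2) G(1) smooth_on_differentiable[OF G(2) T(2)]])
  have h: "hess G x = hess (\<lambda>y. F (P y)) x" by (rule hess_cong[OF T(1,2) G])
  show f: "fderiv G x v = fderiv F (P x) (fderiv P x v)" for v
    using fderiv_compose[OF F P T(2) T(3)[OF T(2)]] e by simp
  show "cov_hess g G x u v = cov_hess g F (P x) (fderiv P x u) (fderiv P x v) + fderiv F (P x) (hess P x u v)"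
    using hess_compose[OF F T P, of u v] by (simp add: cov_hess_def f h G(1)[OF T(2)])
qed

text \<open>The Christoffel symbols of the pulled-back metric are determined by uniqueness: the
  vectors defined below by the Riesz representation satisfy both defining conditions.\<close>

lemma cov_hess_tangential:
  fixes F :: "'a::euclidean_space \<Rightarrow> 'e::euclidean_space"
  assumes N: "metric_on S gN" and M: "metric_on T gM" and F: "smooth_on S F" "\<And>x. x \<in> S \<Longrightarrow> F x \<in> T"
    and iso: "\<And>x a b. x \<in> S \<Longrightarrow> gN x a b = gM (F x) (fderiv F x a) (fderiv F x b)" and x: "x \<in> S"
  shows "gM (F x) (cov_hess gM F x u v) (fderiv F x e) = gN x (christoffel_of gN x u v) e"
proof -
  note S = metric_onD(1)[OF N] and pN = metric_onD(2)[OF N x] and pM = metric_onD(2)[OF M F(2)[OF x]]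
  let ?B = "cov_hess gM F x"
  have linF: "linear (fderiv F x)" by (rule linear_frechet_derivative[OF smooth_on_differentiable[OF F(1) x]])
  have "linear (\<lambda>e. gM (F x) (?B u v) (fderiv F x e))" for u v
    by (intro linearI) (simp_all add: linear_add[OF linF] linear_cmul[OF linF] pos_form_add[OF pM] pos_form_scale[OF pM])
  then have "\<exists>w. \<forall>e. gN x w e = gM (F x) (?B u v) (fderiv F x e)" for u v
    using pos_form_riesz[OF pN] by metis
  then obtain \<Gamma> where \<Gamma>: "\<And>u v e. gN x (\<Gamma> u v) e = gM (F x) (?B u v) (fderiv F x e)" by metis
  have B_sym: "?B u v = ?B v u" for u v
    using fderiv_fderiv_commute[OF S x F(1), of v u] christoffel_of_sym[OF M F(2)[OF x]]
    by (simp add: cov_hess_def hess_def)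
  have "is_christoffel gN x \<Gamma>"
    unfolding is_christoffel_def
  proof (intro conjI allI)
    show "\<Gamma> a b = \<Gamma> b a" for a b
      by (rule pos_form_eqI[OF pN]) (simp add: \<Gamma> B_sym[of a b])
    fix a b e
    have d: "((\<lambda>y. gM (F y) (fderiv F y a) (fderiv F y b)) has_derivative
       (\<lambda>e. fderiv (\<lambda>z. gM z (fderiv F x a) (fderiv F x b)) (F x) (fderiv F x e)
          + gM (F x) (hess F x e a) (fderiv F x b) + gM (F x) (fderiv F x a) (hess F x e b))) (at x)"
      unfolding hess_def
      by (intro has_derivative_metric[OF M S x F(2)] smooth_on_has_derivative[OF F(1) x]
          smooth_on_has_derivative[OF smooth_on_fderiv_const[OF F(1)] x]) auto
    have "fderiv (\<lambda>y. gN y a b) x e = fderiv (\<lambda>y. gM (F y) (fderiv F y a) (fderiv F y b)) x e"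
      by (rule fun_cong[OF fderiv_cong[OF S x iso metric_onD(4)[OF N x]]])
    also have "\<dots> = fderiv (\<lambda>z. gM z (fderiv F x a) (fderiv F x b)) (F x) (fderiv F x e)
          + gM (F x) (hess F x e a) (fderiv F x b) + gM (F x) (fderiv F x a) (hess F x e b)"
      using fderiv_eqI[OF d] by simp
    \<comment> \<open>Metric compatibility of the ambient symbols turns the derivative of
      \<open>gM\<close> into the two Christoffel terms that complete each Hessian to a covariant
      one.\<close>
    also have "\<dots> = gM (F x) (?B e a) (fderiv F x b) + gM (F x) (fderiv F x a) (?B e b)"
      using is_christoffel_of[OF M F(2)[OF x]]
      by (simp add: is_christoffel_def cov_hess_def pos_form_add[OF pM])
    also have "\<dots> = gN x (\<Gamma> e a) b + gN x a (\<Gamma> e b)"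
      by (simp add: \<Gamma> pos_form_sym[OF pN, of a] pos_form_sym[OF pM, of "fderiv F x a"])
    finally show "fderiv (\<lambda>y. gN y a b) x e = gN x (\<Gamma> e a) b + gN x a (\<Gamma> e b)" .
  qed
  then show ?thesis using christoffel_of_unique[OF N x] \<Gamma> by metis
qed

text \<open>When the derivative is onto, the tangential identity tests against all vectors and so
  determines the whole covariant Hessian. For chart transitions this is the transformation law of
  the Christoffel symbols.\<close>

lemma christoffel_transform:
  fixes F :: "'a::euclidean_space \<Rightarrow> 'e::euclidean_space"
  assumes N: "metric_on S gN" and M: "metric_on T gM" and F: "smooth_on S F" "\<And>x. x \<in> S \<Longrightarrow> F x \<in> T"
    and iso: "\<And>x a b. x \<in> S \<Longrightarrow> gN x a b = gM (F x) (fderiv F x a) (fderiv F x b)" and x: "x \<in> S"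
    and surj: "surj (fderiv F x)"
  shows "cov_hess gM F x u v = fderiv F x (christoffel_of gN x u v)"
proof (rule pos_form_eqI[OF metric_onD(2)[OF M F(2)[OF x]]])
  fix c
  obtain e where "c = fderiv F x e" using surj by (metis surjD)
  then show "gM (F x) (cov_hess gM F x u v) c = gM (F x) (fderiv F x (christoffel_of gN x u v)) c"
    using cov_hess_tangential[OF N M F iso x] iso[OF x] by simp
qed

text \<open>The geodesic equation as a first-order system for position and velocity; velocities are
  unrestricted, so the phase space is \<open>S \<times> UNIV\<close>.\<close>

lemma geodesic_equation_local_solution:
  fixes g :: "'e::euclidean_space \<Rightarrow> 'e \<Rightarrow> 'e \<Rightarrow> real"
  assumes g: "metric_on S g" and x0: "x0 \<in> S"
  obtains \<epsilon> x v where "\<epsilon> > 0" "x 0 = x0" "v 0 = a" "smooth_on {-\<epsilon><..<\<epsilon>} x" "smooth_on {-\<epsilon><..<\<epsilon>} v"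
    "\<And>t. t \<in> {-\<epsilon><..<\<epsilon>} \<Longrightarrow> x t \<in> S"
    "\<And>t. t \<in> {-\<epsilon><..<\<epsilon>} \<Longrightarrow> (x has_vector_derivative v t) (at t)"
    "\<And>t. t \<in> {-\<epsilon><..<\<epsilon>} \<Longrightarrow> (v has_vector_derivative - christoffel_of g (x t) (v t) (v t)) (at t)"
proof -
  note S = metric_onD(1)[OF g]
  have oS: "open (S \<times> (UNIV::'e set))" using S by (simp add: open_Times)
  let ?X = "\<lambda>z::'e\<times>'e. (snd z, - christoffel_of g (fst z) (snd z) (snd z))"
  have f: "smooth_on (S \<times> UNIV) (fst :: 'e \<times> 'e \<Rightarrow> 'e)"
    and s: "smooth_on (S \<times> UNIV) (snd :: 'e \<times> 'e \<Rightarrow> 'e)"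
    by (auto intro!: smooth_on_linear oS bounded_linear_fst bounded_linear_snd)
  have 1: "smooth_on (S \<times> UNIV) (\<lambda>z::'e\<times>'e. christoffel_of g (fst z) b c)" for b c
    by (rule smooth_on_comp[OF oS S smooth_on_christoffel_of[OF g, of b c] f]) auto
  have 2: "smooth_on (S \<times> UNIV) (\<lambda>z::'e\<times>'e. christoffel_of g (fst z) b (snd z))" for b
    by (rule smooth_on_linear_field[OF oS _ 1 s]) (auto intro: christoffel_of_linear[OF g])
  have 3: "smooth_on (S \<times> UNIV) (\<lambda>z::'e\<times>'e. christoffel_of g (fst z) (snd z) (snd z))"
    by (rule smooth_on_linear_field[OF oS _ 2 s])
      (auto intro: christoffel_of_linear[OF g])
  have sX: "smooth_on (S \<times> UNIV) ?X"
    by (intro smooth_on_Pair oS s smooth_on_linear_comp[OF oS bounded_linear_minus[OF bounded_linear_ident]] 3)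
  obtain \<epsilon> z where z: "\<epsilon> > 0" "z 0 = (x0, a)" "\<And>t. t \<in> {-\<epsilon><..<\<epsilon>} \<Longrightarrow> z t \<in> S \<times> UNIV"
    "\<And>t. t \<in> {-\<epsilon><..<\<epsilon>} \<Longrightarrow> (z has_vector_derivative ?X (z t)) (at t)"
    "smooth_on {-\<epsilon><..<\<epsilon>} z"
    using ode_local_existence[OF oS sX, of "(x0, a)"] x0 by (metis SigmaI UNIV_I)
  show ?thesis
  proof (rule that[of \<epsilon> "\<lambda>t. fst (z t)" "\<lambda>t. snd (z t)"])
    show "smooth_on {-\<epsilon><..<\<epsilon>} (\<lambda>t. fst (z t))" "smooth_on {-\<epsilon><..<\<epsilon>} (\<lambda>t. snd (z t))"
      using smooth_on_linear_comp[OF _ bounded_linear_fst z(5)] smooth_on_linear_comp[OF _ bounded_linear_snd z(5)] by auto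
    fix t assume t: "t \<in> {-\<epsilon><..<\<epsilon>}"
    show "fst (z t) \<in> S" using z(3)[OF t] by auto
    show "((\<lambda>t. fst (z t)) has_vector_derivative snd (z t)) (at t)"
      using bounded_linear.has_vector_derivative[OF bounded_linear_fst z(4)[OF t]] by simp
    show "((\<lambda>t. snd (z t)) has_vector_derivative - christoffel_of g (fst (z t)) (snd (z t)) (snd (z t))) (at t)"
      using bounded_linear.has_vector_derivative[OF bounded_linear_snd z(4)[OF t]] by simp
  qed (use z in auto)
qed

subsection \<open>Charts and tangent vectors\<close>

declare split_paired_All [simp del] split_paired_Ex [simp del]

text \<open>The chart conditions of \<open>smooth_manifold\<close> in isolation. The calculus of
  tangent vectors and covariant derivatives is local, and intervals enter on the same footing as
  parameter manifolds of curves.\<close>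

definition smooth_charts :: "('a, 'e::euclidean_space, 'z) smooth_structure_scheme \<Rightarrow> bool" where
  "smooth_charts M \<longleftrightarrow> topspace (mtop M) = (\<Union>c\<in>atlas M. fst c) \<and>
     (\<forall>c\<in>atlas M. openin (mtop M) (fst c) \<and> open (snd c ` fst c) \<and>
        homeomorphic_map (subtopology (mtop M) (fst c)) (top_of_set (snd c ` fst c)) (snd c)) \<and>
     (\<forall>c\<in>atlas M. \<forall>d\<in>atlas M.
        smooth_on (snd c ` (fst c \<inter> fst d)) (snd d \<circ> chart_inv c))"

lemma smooth_manifold_charts: "smooth_manifold M \<Longrightarrow> smooth_charts M"
  by (simp add: smooth_manifold_def smooth_charts_def)

lemma charts_at_iff: "c \<in> charts_at M p \<longleftrightarrow> c \<in> atlas M \<and> p \<in> fst c"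
  by (simp add: charts_at_def)

lemma charts_at_nonempty:
  assumes "smooth_charts M" "p \<in> topspace (mtop M)"
  shows "(SOME c. c \<in> charts_at M p) \<in> charts_at M p"
proof -
  have "\<exists>c. c \<in> charts_at M p" using assms by (auto simp: smooth_charts_def charts_at_iff)
  then show ?thesis by (rule someI_ex)
qed

context
  fixes M :: "('a, 'e::euclidean_space, 'z) smooth_structure_scheme" and c :: "('a, 'e) chart"
  assumes M: "smooth_charts M" and c: "c \<in> atlas M"
begin

lemma chart_openin: "openin (mtop M) (fst c)"
  using M c by (simp add: smooth_charts_def)

lemma chart_image_open: "open (snd c ` fst c)"
  using M c by (simp add: smooth_charts_def)

lemma chart_subset: "fst c \<subseteq> topspace (mtop M)"
  using chart_openin by (rule openin_subset)

lemma chart_homeomorphic: "homeomorphic_map (subtopology (mtop M) (fst c)) (top_of_set (snd c ` fst c)) (snd c)"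
  using M c by (simp add: smooth_charts_def)

lemma chart_inj: "inj_on (snd c) (fst c)"
  using homeomorphic_imp_injective_map[OF chart_homeomorphic] chart_subset
  by (simp add: Int_absorb1)

lemma chart_inv_left: "p \<in> fst c \<Longrightarrow> chart_inv c (snd c p) = p"
  by (simp add: chart_inv_def chart_inj)

lemma chart_inv_right: "x \<in> snd c ` fst c \<Longrightarrow> snd c (chart_inv c x) = x"
  by (simp add: chart_inv_def f_inv_into_f)

lemma chart_inv_in: "x \<in> snd c ` fst c \<Longrightarrow> chart_inv c x \<in> fst c"
  by (simp add: chart_inv_def inv_into_into)

lemma chart_image_open_Int:
  assumes "openin (mtop M) W"
  shows "open (snd c ` (fst c \<inter> W))"
proof -
  have "openin (subtopology (mtop M) (fst c)) (fst c \<inter> W)"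
    using openin_subtopology_Int2[OF assms] .
  then have "openin (top_of_set (snd c ` fst c)) (snd c ` (fst c \<inter> W))"
    using homeomorphic_imp_open_map[OF chart_homeomorphic] by (simp add: open_map_def)
  then show ?thesis using chart_image_open openin_open_trans by blast
qed

lemma chart_continuous: "continuous_map (subtopology (mtop M) (fst c)) euclidean (snd c)"
  using homeomorphic_imp_continuous_map[OF chart_homeomorphic] by (simp add: continuous_map_in_subtopology)

lemma chart_preimage_open:
  assumes "open B"
  shows "openin (mtop M) {y \<in> fst c. snd c y \<in> B}"
proof -
  have "openin (subtopology (mtop M) (fst c)) {y \<in> topspace (subtopology (mtop M) (fst c)). snd c y \<in> B}"
    using openin_continuous_map_preimage[OF chart_continuous] assms by simp
  then have "openin (subtopology (mtop M) (fst c)) {y \<in> fst c. snd c y \<in> B}"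
    using chart_subset by (simp add: Collect_conj_eq Int_absorb1 flip: Int_assoc)
  then show ?thesis using chart_openin openin_trans_full by blast
qed

lemma chart_inv_continuous: "continuous_map (top_of_set (snd c ` fst c)) (mtop M) (chart_inv c)"
proof -
  obtain g where g: "homeomorphic_maps (subtopology (mtop M) (fst c)) (top_of_set (snd c ` fst c)) (snd c) g"
    using chart_homeomorphic by (auto simp: homeomorphic_map_maps)
  have "g x = chart_inv c x" if x: "x \<in> snd c ` fst c" for x
  proof -
    obtain p where p: "p \<in> fst c" "x = snd c p" using x by blast
    have "g (snd c p) = p" using g p(1) chart_subset by (auto simp: homeomorphic_maps_def)
    then show ?thesis using p chart_inv_left by simp
  qed
  then have eq: "\<And>x. x \<in> topspace (top_of_set (snd c ` fst c)) \<Longrightarrow> g x = chart_inv c x" by simp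
  have "continuous_map (top_of_set (snd c ` fst c)) (mtop M) g"
    using g by (simp add: homeomorphic_maps_def continuous_map_in_subtopology)
  then show ?thesis by (rule continuous_map_eq) (rule eq)
qed

end

lemma transition_smooth:
  assumes "smooth_charts M" "c \<in> atlas M" "d \<in> atlas M"
  shows "smooth_on (snd c ` (fst c \<inter> fst d)) (\<lambda>x. snd d (chart_inv c x))"
  using assms by (simp add: smooth_charts_def comp_def)

lemma transition_open:
  assumes "smooth_charts M" "c \<in> atlas M" "d \<in> atlas M"
  shows "open (snd c ` (fst c \<inter> fst d))"
  by (rule chart_image_open_Int[OF assms(1,2) chart_openin[OF assms(1,3)]])

text \<open>The cocycle law of transition derivatives: the chain rule on the triple overlap of the
  charts. It makes \<open>coord_vector\<close> a tangent vector in the sense of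
  \<open>tangent_space\<close>.\<close>

lemma fderiv_transition_compose:
  assumes M: "smooth_charts M" and c: "c \<in> charts_at M p" "d \<in> charts_at M p" "e \<in> charts_at M p"
  shows "fderiv (\<lambda>x. snd e (chart_inv d x)) (snd d p) (fderiv (\<lambda>x. snd d (chart_inv c x)) (snd c p) a)
    = fderiv (\<lambda>x. snd e (chart_inv c x)) (snd c p) a"
proof -
  have A: "c \<in> atlas M" "d \<in> atlas M" "e \<in> atlas M" "p \<in> fst c" "p \<in> fst d" "p \<in> fst e"
    using c by (auto simp: charts_at_iff)
  let ?S = "snd c ` (fst c \<inter> (fst d \<inter> fst e))"
  have oS: "open ?S" by (intro chart_image_open_Int[OF M A(1)] openin_Int chart_openin[OF M] A)
  have S1: "?S \<subseteq> snd c ` (fst c \<inter> fst d)" by auto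
  have inS: "snd c p \<in> ?S" using A by blast
  have "fderiv (\<lambda>x. snd e (chart_inv d (snd d (chart_inv c x)))) (snd c p) a =
    fderiv (\<lambda>x. snd e (chart_inv d x)) (snd d (chart_inv c (snd c p))) (fderiv (\<lambda>x. snd d (chart_inv c x)) (snd c p) a)"
    by (rule fderiv_compose[OF transition_smooth[OF M A(2,3)] smooth_on_subset[OF transition_smooth[OF M A(1,2)] S1] inS])
      (use A chart_inv_left[OF M A(1)] in auto)
  moreover have "fderiv (\<lambda>x. snd e (chart_inv c x)) (snd c p) = fderiv (\<lambda>x. snd e (chart_inv d (snd d (chart_inv c x)))) (snd c p)"
  proof (rule fderiv_cong[OF oS inS])
    show "(\<lambda>x. snd e (chart_inv c x)) differentiable at (snd c p)"
      by (rule smooth_on_differentiable[OF transition_smooth[OF M A(1,3)]]) (use A in auto)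
  qed (auto simp: chart_inv_left[OF M A(1)] chart_inv_left[OF M A(2)])
  ultimately show ?thesis by (simp add: chart_inv_left[OF M A(1,4)])
qed

lemma fderiv_transition_self:
  assumes M: "smooth_charts M" and c: "c \<in> charts_at M p"
  shows "fderiv (\<lambda>x. snd c (chart_inv c x)) (snd c p) a = a"
proof -
  have A: "c \<in> atlas M" "p \<in> fst c" using c by (auto simp: charts_at_iff)
  have "fderiv (\<lambda>x. x) (snd c p) = fderiv (\<lambda>x. snd c (chart_inv c x)) (snd c p)"
    by (rule fderiv_cong[OF chart_image_open[OF M A(1)]]) (use A chart_inv_right[OF M A(1)] in auto)
  then show ?thesis by (metis frechet_derivative_ident)
qed

lemma tangent_spaceD:
  assumes "u \<in> tangent_space M p" "c \<in> charts_at M p" "d \<in> charts_at M p"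
  shows "u d = fderiv (\<lambda>x. snd d (chart_inv c x)) (snd c p) (u c)"
  using assms unfolding tangent_space_def comp_def by blast

lemma coord_vector_tangent:
  assumes "smooth_charts M" "c \<in> charts_at M p"
  shows "coord_vector M c p a \<in> tangent_space M p"
  using fderiv_transition_compose[OF assms] by (simp add: tangent_space_def coord_vector_def comp_def)

lemma coord_vector_chart:
  assumes "smooth_charts M" "c \<in> charts_at M p"
  shows "coord_vector M c p a c = a"
  using fderiv_transition_self[OF assms] assms(2) by (simp add: coord_vector_def comp_def)

lemma tangent_space_eqI:
  assumes "u \<in> tangent_space M p" "v \<in> tangent_space M p" "c \<in> charts_at M p" "u c = v c"
  shows "u = v"
proof (rule ext)
  fix d
  show "u d = v d"
  proof (cases "d \<in> charts_at M p")
    case True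
    then show ?thesis using tangent_spaceD[OF assms(1,3) True] tangent_spaceD[OF assms(2,3) True] assms(4) by simp
  next
    case False
    then show ?thesis using assms(1,2) by (simp add: tangent_space_def)
  qed
qed

lemma coord_vector_eq:
  assumes "smooth_charts M" "u \<in> tangent_space M p" "c \<in> charts_at M p"
  shows "coord_vector M c p (u c) = u"
  by (rule tangent_space_eqI[OF coord_vector_tangent[OF assms(1,3)] assms(2,3) coord_vector_chart[OF assms(1,3)]])

lemma transition_differentiable:
  assumes M: "smooth_charts M" and c: "c \<in> charts_at M p" "d \<in> charts_at M p"
  shows "(\<lambda>x. snd d (chart_inv c x)) differentiable at (snd c p)"
  by (rule smooth_on_differentiable[OF transition_smooth[OF M]]) (use c in \<open>auto simp: charts_at_iff\<close>)

lemma coord_vector_add: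
  assumes "smooth_charts M" "c \<in> charts_at M p"
  shows "coord_vector M c p (a + b) = (\<lambda>d. coord_vector M c p a d + coord_vector M c p b d)"
    "coord_vector M c p (r *\<^sub>R a) = (\<lambda>d. r *\<^sub>R coord_vector M c p a d)"
  by (rule ext, simp add: coord_vector_def comp_def fderiv_add[OF transition_differentiable[OF assms]]
      fderiv_scale[OF transition_differentiable[OF assms]])+

text \<open>The chart hidden in \<open>deriv_along\<close> is exchanged for \<open>c\<close> by the
  chain rule, and the transformation rule of \<open>u\<close> absorbs the transition
  derivative.\<close>

lemma deriv_along_chart:
  assumes N: "smooth_charts N" and c: "c \<in> charts_at N p" and u: "u \<in> tangent_space N p"
    and h: "(\<lambda>x. h (chart_inv c x)) differentiable at (snd c p)"
  shows "deriv_along N p u h = fderiv (\<lambda>x. h (chart_inv c x)) (snd c p) (u c)"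
proof -
  define c' where "c' = (SOME c. c \<in> charts_at N p)"
  have c': "c' \<in> charts_at N p" unfolding c'_def using c by (rule someI)
  have A: "c \<in> atlas N" "c' \<in> atlas N" "p \<in> fst c" "p \<in> fst c'" using c c' by (auto simp: charts_at_iff)
  have p: "chart_inv c' (snd c' p) = p" by (rule chart_inv_left[OF N A(2,4)])
  have d: "((\<lambda>x. h (chart_inv c (snd c (chart_inv c' x)))) has_derivative
      (\<lambda>v. fderiv (\<lambda>x. h (chart_inv c x)) (snd c p) (fderiv (\<lambda>x. snd c (chart_inv c' x)) (snd c' p) v))) (at (snd c' p))"
    by (rule has_derivative_compose)
      (use h transition_differentiable[OF N c' c] in \<open>simp_all add: frechet_derivative_works p\<close>)
  have "fderiv (\<lambda>x. h (chart_inv c (snd c (chart_inv c' x)))) (snd c' p) = fderiv (\<lambda>x. h (chart_inv c' x)) (snd c' p)"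
    by (rule fderiv_cong[OF transition_open[OF N A(2,1)]])
      (use A d in \<open>auto simp: chart_inv_left[OF N A(1)] chart_inv_left[OF N A(2)] differentiable_def\<close>)
  then have "deriv_along N p u h = fderiv (\<lambda>x. h (chart_inv c x)) (snd c p) (fderiv (\<lambda>x. snd c (chart_inv c' x)) (snd c' p) (u c'))"
    unfolding deriv_along_def c'_def[symmetric] Let_def using fun_cong[OF fderiv_eqI[OF d], of "u c'"] by (simp add: comp_def)
  then show ?thesis using tangent_spaceD[OF u c' c] by simp
qed

section \<open>Local representatives of maps and pushforwards\<close>

definition loc_rep :: "('a \<Rightarrow> 'b) \<Rightarrow> ('a, 'e) chart \<Rightarrow> ('b, 'f) chart \<Rightarrow> 'e \<Rightarrow> 'f" where
  "loc_rep f c d = (\<lambda>x. snd d (f (chart_inv c x)))"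

definition loc_dom :: "('a \<Rightarrow> 'b) \<Rightarrow> ('a, 'e) chart \<Rightarrow> ('b, 'f) chart \<Rightarrow> 'e set" where
  "loc_dom f c d = snd c ` (fst c \<inter> f -` fst d)"

context
  fixes N :: "('a, 'e::euclidean_space, 'y) smooth_structure_scheme"
    and M :: "('b, 'f::euclidean_space, 'z) smooth_structure_scheme" and f :: "'a \<Rightarrow> 'b"
  assumes N: "smooth_charts N" and M: "smooth_charts M" and f: "smooth_map N M f"
begin

lemma smooth_map_preimage_openin:
  assumes "c \<in> atlas N" "openin (mtop M) W"
  shows "openin (mtop N) (fst c \<inter> f -` W)"
proof -
  have "openin (mtop N) {x \<in> topspace (mtop N). f x \<in> W}"
    using f assms openin_continuous_map_preimage unfolding smooth_map_def by blast
  then have "openin (mtop N) (fst c \<inter> {x \<in> topspace (mtop N). f x \<in> W})"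
    using chart_openin[OF N assms(1)] by (rule openin_Int[rotated])
  moreover have "fst c \<inter> {x \<in> topspace (mtop N). f x \<in> W} = fst c \<inter> f -` W"
    using chart_subset[OF N assms(1)] by blast
  ultimately show ?thesis by simp
qed

lemma loc_dom_open:
  assumes "c \<in> atlas N" "d \<in> atlas M"
  shows "open (loc_dom f c d)"
proof -
  have "open (snd c ` (fst c \<inter> (fst c \<inter> f -` fst d)))"
    by (rule chart_image_open_Int[OF N assms(1) smooth_map_preimage_openin[OF assms(1) chart_openin[OF M assms(2)]]])
  then show ?thesis by (simp add: loc_dom_def)
qed

lemma loc_rep_smooth:
  assumes "c \<in> atlas N" "d \<in> atlas M"
  shows "smooth_on (loc_dom f c d) (loc_rep f c d)"
  using f assms by (simp add: smooth_map_def loc_rep_def loc_dom_def comp_def)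

lemma loc_rep_at:
  assumes "c \<in> charts_at N p"
  shows "loc_rep f c d (snd c p) = snd d (f p)"
  using assms chart_inv_left[OF N] by (auto simp: loc_rep_def charts_at_iff)

lemma loc_dom_at:
  assumes "c \<in> charts_at N p" "d \<in> charts_at M (f p)"
  shows "snd c p \<in> loc_dom f c d"
  using assms by (auto simp: loc_dom_def charts_at_iff)

lemma loc_rep_in:
  assumes "c \<in> atlas N" "x \<in> loc_dom f c d"
  shows "loc_rep f c d x \<in> snd d ` fst d" "chart_inv c x \<in> fst c" "f (chart_inv c x) \<in> fst d"
    "snd c (chart_inv c x) = x"
  using assms chart_inv_left[OF N assms(1)] by (auto simp: loc_dom_def loc_rep_def)

lemma pushforward_chart:
  assumes c: "c \<in> charts_at N p" and d: "d \<in> charts_at M (f p)" and u: "u \<in> tangent_space N p"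
  shows "pushforward N M f p u d = fderiv (loc_rep f c d) (snd c p) (u c)"
proof -
  have A: "c \<in> atlas N" "d \<in> atlas M" using c d by (auto simp: charts_at_iff)
  have "loc_rep f c d differentiable at (snd c p)"
    by (rule smooth_on_differentiable[OF loc_rep_smooth[OF A] loc_dom_at[OF c d]])
  then show ?thesis
    using deriv_along_chart[OF N c u, of "snd d \<circ> f"] d by (simp add: pushforward_def loc_rep_def comp_def)
qed

lemma loc_rep_transition:
  assumes c: "c \<in> charts_at N p" and d: "d \<in> charts_at M (f p)" "d' \<in> charts_at M (f p)"
  shows "fderiv (loc_rep f c d') (snd c p) a =
    fderiv (\<lambda>x. snd d' (chart_inv d x)) (snd d (f p)) (fderiv (loc_rep f c d) (snd c p) a)"
proof -
  have A: "c \<in> atlas N" "d \<in> atlas M" "d' \<in> atlas M" using c d by (auto simp: charts_at_iff)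
  let ?S = "loc_dom f c d \<inter> loc_dom f c d'"
  have oS: "open ?S" by (intro open_Int loc_dom_open A)
  have inS: "snd c p \<in> ?S" using loc_dom_at[OF c] d by blast
  have 1: "fderiv (\<lambda>x. snd d' (chart_inv d (loc_rep f c d x))) (snd c p) a =
    fderiv (\<lambda>x. snd d' (chart_inv d x)) (loc_rep f c d (snd c p)) (fderiv (loc_rep f c d) (snd c p) a)"
    by (rule fderiv_compose[OF transition_smooth[OF M A(2,3)] loc_rep_smooth[OF A(1,2)]])
      (use inS d in \<open>auto simp: loc_rep_at[OF c] charts_at_iff\<close>)
  have "fderiv (loc_rep f c d') (snd c p) = fderiv (\<lambda>x. snd d' (chart_inv d (loc_rep f c d x))) (snd c p)"
  proof (rule fderiv_cong[OF oS inS])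
    show "loc_rep f c d' differentiable at (snd c p)"
      by (rule smooth_on_differentiable[OF loc_rep_smooth[OF A(1,3)]]) (use inS in auto)
    show "loc_rep f c d' x = snd d' (chart_inv d (loc_rep f c d x))" if "x \<in> ?S" for x
      using loc_rep_in(3)[OF A(1), of x d] that by (simp add: loc_rep_def chart_inv_left[OF M A(2)])
  qed
  then show ?thesis using 1 by (simp add: loc_rep_at[OF c])
qed

lemma pushforward_tangent:
  assumes p: "p \<in> topspace (mtop N)" and u: "u \<in> tangent_space N p"
  shows "pushforward N M f p u \<in> tangent_space M (f p)"
proof -
  obtain c where c: "c \<in> charts_at N p" using charts_at_nonempty[OF N p] by blast
  show ?thesis
    unfolding tangent_space_def comp_def
  proof (intro CollectI conjI ballI allI impI)
    show "pushforward N M f p u d' = fderiv (\<lambda>x. snd d' (chart_inv d x)) (snd d (f p)) (pushforward N M f p u d)"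
      if "d \<in> charts_at M (f p)" "d' \<in> charts_at M (f p)" for d d'
      using loc_rep_transition[OF c that] pushforward_chart[OF c that(1) u] pushforward_chart[OF c that(2) u] by simp
  qed (simp add: pushforward_def)
qed

end

section \<open>Metrics in charts\<close>

lemma riemannian_charts: "riemannian_manifold M \<Longrightarrow> smooth_charts M"
  by (simp add: riemannian_manifold_def smooth_manifold_charts)

lemma metric_in_chart:
  assumes M: "smooth_charts M" and c: "c \<in> charts_at M p" and u: "u \<in> tangent_space M p" "v \<in> tangent_space M p"
  shows "metric M p u v = metric_coeff M c (snd c p) (u c) (v c)"
proof -
  have "chart_inv c (snd c p) = p" using c chart_inv_left[OF M] by (auto simp: charts_at_iff)
  then show ?thesis by (simp add: metric_coeff_def coord_vector_eq[OF M u(1) c] coord_vector_eq[OF M u(2) c])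
qed

lemma metric_on_chart:
  assumes M: "riemannian_manifold M" and c: "c \<in> atlas M"
  shows "metric_on (snd c ` fst c) (metric_coeff M c)"
proof -
  note C = riemannian_charts[OF M]
  have "pos_form (metric_coeff M c x)" if x: "x \<in> snd c ` fst c" for x
  proof -
    define p where "p = chart_inv c x"
    have pc: "c \<in> charts_at M p" using chart_inv_in[OF C c x] c by (simp add: charts_at_iff p_def)
    have p: "p \<in> topspace (mtop M)" using chart_inv_in[OF C c x] chart_subset[OF C c] by (auto simp: p_def)
    note t = coord_vector_tangent[OF C pc] and R = M[unfolded riemannian_manifold_def, THEN conjunct2, THEN conjunct1, rule_format, OF p]
    have g: "metric_coeff M c x a b = metric M p (coord_vector M c p a) (coord_vector M c p b)" for a b
      by (simp add: metric_coeff_def p_def Let_def)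
    have sym: "metric_coeff M c x a b = metric_coeff M c x b a" for a b
      unfolding g using R[OF t t] by blast
    have "linear (\<lambda>a. metric_coeff M c x a b)" for b
    proof (rule linearI)
      show "metric_coeff M c x (a + a') b = metric_coeff M c x a b + metric_coeff M c x a' b" for a a'
        unfolding g coord_vector_add[OF C pc] using R[OF t t, of a a'] t by blast
      show "metric_coeff M c x (r *\<^sub>R a) b = r *\<^sub>R metric_coeff M c x a b" for r a
        unfolding g coord_vector_add[OF C pc] using R[OF t t, of a b] by simp
    qed
    then have "linear (metric_coeff M c x b)" for b using sym by presburger
    moreover have "metric_coeff M c x a a > 0" if "a \<noteq> 0" for a
    proof -
      have "coord_vector M c p a \<noteq> (\<lambda>_. 0)" using coord_vector_chart[OF C pc, of a] that by metis
      then show ?thesis unfolding g using R[OF t t, of a a] by blast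
    qed
    ultimately show ?thesis using sym by (simp add: pos_form_def)
  qed
  then show ?thesis using M c chart_image_open[OF C c] by (simp add: metric_on_def riemannian_manifold_def)
qed

text \<open>Supplies the isometry hypothesis of \<open>christoffel_transform\<close> for chart
  transitions.\<close>

lemma metric_coeff_transition:
  assumes M: "riemannian_manifold M" and c: "c \<in> atlas M" "d \<in> atlas M" and x: "x \<in> snd c ` (fst c \<inter> fst d)"
  shows "metric_coeff M c x a b = metric_coeff M d (snd d (chart_inv c x))
    (fderiv (\<lambda>x. snd d (chart_inv c x)) x a) (fderiv (\<lambda>x. snd d (chart_inv c x)) x b)"
proof -
  note C = riemannian_charts[OF M]
  obtain p where p: "x = snd c p" "p \<in> fst c" "p \<in> fst d" using x by blast
  have pc: "c \<in> charts_at M p" "d \<in> charts_at M p" using p c by (auto simp: charts_at_iff)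
  have ip: "chart_inv c x = p" using p chart_inv_left[OF C c(1)] by simp
  have "metric_coeff M c x a b = metric M p (coord_vector M c p a) (coord_vector M c p b)"
    by (simp add: metric_coeff_def ip)
  also have "\<dots> = metric_coeff M d (snd d p) (coord_vector M c p a d) (coord_vector M c p b d)"
    by (intro metric_in_chart coord_vector_tangent C pc)
  finally show ?thesis using pc by (simp add: coord_vector_def ip p(1)[symmetric] comp_def)
qed

text \<open>Supplies the isometry hypothesis of \<open>cov_hess_tangential\<close> for the local
  representative of an isometric immersion.\<close>

lemma isometric_metric_coeff:
  assumes N: "riemannian_manifold N" and M: "riemannian_manifold M" and f: "isometric_immersion N M f"
    and c: "c \<in> atlas N" and d: "d \<in> atlas M" and x: "x \<in> loc_dom f c d"
  shows "metric_coeff N c x a b =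
    metric_coeff M d (loc_rep f c d x) (fderiv (loc_rep f c d) x a) (fderiv (loc_rep f c d) x b)"
proof -
  note CN = riemannian_charts[OF N] and CM = riemannian_charts[OF M]
  have sf: "smooth_map N M f" using f by (simp add: isometric_immersion_def immersion_def)
  define p where "p = chart_inv c x"
  note l = loc_rep_in[OF CN CM sf c x, folded p_def]
  have pc: "c \<in> charts_at N p" and pd: "d \<in> charts_at M (f p)" using l c d by (auto simp: charts_at_iff)
  have p: "p \<in> topspace (mtop N)" using l(2) chart_subset[OF CN c] by blast
  note t = coord_vector_tangent[OF CN pc]
  have "metric_coeff N c x a b = metric N p (coord_vector N c p a) (coord_vector N c p b)"
    by (simp add: metric_coeff_def p_def Let_def)
  also have "\<dots> = metric M (f p) (pushforward N M f p (coord_vector N c p a)) (pushforward N M f p (coord_vector N c p b))"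
    using f p t by (simp add: isometric_immersion_def)
  also have "\<dots> = metric_coeff M d (snd d (f p)) (pushforward N M f p (coord_vector N c p a) d)
      (pushforward N M f p (coord_vector N c p b) d)"
    by (intro metric_in_chart[OF CM pd] pushforward_tangent[OF CN CM sf p] t)
  finally show ?thesis
    by (simp add: pushforward_chart[OF CN CM sf pc pd t] coord_vector_chart[OF CN pc] l(4) p_def[symmetric] loc_rep_def)
qed

lemma immersion_fderiv_inj:
  assumes N: "smooth_charts N" and M: "smooth_charts M" and f: "immersion N M f"
    and c: "c \<in> charts_at N p" and d: "d \<in> charts_at M (f p)"
  shows "inj (fderiv (loc_rep f c d) (snd c p))"
proof (rule injI)
  have sf: "smooth_map N M f" using f by (simp add: immersion_def)
  have p: "p \<in> topspace (mtop N)" using c chart_subset[OF N, of c] unfolding charts_at_iff by blast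
  note t = coord_vector_tangent[OF N c]
  fix a b assume eq: "fderiv (loc_rep f c d) (snd c p) a = fderiv (loc_rep f c d) (snd c p) b"
  have "pushforward N M f p (coord_vector N c p a) = pushforward N M f p (coord_vector N c p b)"
    by (rule tangent_space_eqI[OF pushforward_tangent[OF N M sf p t] pushforward_tangent[OF N M sf p t] d])
      (simp add: pushforward_chart[OF N M sf c d t] coord_vector_chart[OF N c] eq)
  then have "coord_vector N c p a = coord_vector N c p b"
    using f p t unfolding immersion_def inj_on_def by blast
  then show "a = b" using coord_vector_chart[OF N c] by metis
qed

subsection \<open>The second fundamental form\<close>

text \<open>The same choice as inside \<open>deriv_along\<close>, which therefore unfolds in this
  chart without any differentiability hypothesis.\<close>

definition chart0 :: "('a, 'e, 'z) smooth_structure_scheme \<Rightarrow> 'a \<Rightarrow> ('a, 'e) chart" where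
  "chart0 M p = (SOME c. c \<in> charts_at M p)"

lemma chart0_in: "smooth_charts M \<Longrightarrow> p \<in> topspace (mtop M) \<Longrightarrow> chart0 M p \<in> charts_at M p"
  unfolding chart0_def by (rule charts_at_nonempty)

lemma deriv_along_chart0:
  "deriv_along M p u h = fderiv (\<lambda>x. h (chart_inv (chart0 M p) x)) (snd (chart0 M p) p) (u (chart0 M p))"
  by (simp add: deriv_along_def chart0_def Let_def comp_def)

text \<open>Provides a local field extending any given tangent vector: the witness behind uniqueness
  in the description of the second fundamental form.\<close>

lemma coordinate_vector_field:
  assumes N: "smooth_charts N" and c: "c \<in> atlas N"
  shows "vector_field_on N (fst c) (\<lambda>y. coord_vector N c y a)"
  unfolding vector_field_on_def
proof (intro conjI ballI)
  show "openin (mtop N) (fst c)" by (rule chart_openin[OF N c])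
  show "coord_vector N c y a \<in> tangent_space N y" if "y \<in> fst c" for y
    by (rule coord_vector_tangent[OF N]) (use c that in \<open>simp add: charts_at_iff\<close>)
  fix d assume d: "d \<in> atlas N"
  have o: "open (snd d ` (fst d \<inter> fst c))" by (rule transition_open[OF N d c])
  have "smooth_on (snd d ` (fst d \<inter> fst c)) (\<lambda>x. fderiv (\<lambda>x. snd d (chart_inv c x)) (snd c (chart_inv d x)) a)"
    by (rule smooth_on_comp[OF o transition_open[OF N c d]
          smooth_on_fderiv_const[OF transition_smooth[OF N c d]] transition_smooth[OF N d c]])
      (use chart_inv_left[OF N d] in force)
  then show "smooth_on (snd d ` (fst d \<inter> fst c)) (\<lambda>x. coord_vector N c (chart_inv d x) a d)"
  proof (rule smooth_on_cong[OF _ o])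
    fix x assume "x \<in> snd d ` (fst d \<inter> fst c)"
    then have "d \<in> charts_at N (chart_inv d x)"
      using chart_inv_in[OF N d, of x] d unfolding charts_at_iff by blast
    then show "fderiv (\<lambda>x. snd d (chart_inv c x)) (snd c (chart_inv d x)) a = coord_vector N c (chart_inv d x) a d"
      by (simp add: coord_vector_def comp_def)
  qed
qed

text \<open>The derivative of the coefficients of \<open>Y\<close> enters both sides through
  \<open>fderiv F x (fderiv Yc x (u c))\<close> and cancels. What remains depends on
  \<open>Y p\<close> alone: this is the tensoriality of the second fundamental form in
  coordinates.\<close>

lemma cov_deriv_pushforward:
  fixes N :: "('a, 'e::euclidean_space) riemannian" and M :: "('b, 'f::euclidean_space) riemannian"
  assumes N: "smooth_charts N" and M: "smooth_charts M" and f: "smooth_map N M f"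
    and p: "p \<in> topspace (mtop N)" and d: "d \<in> charts_at M (f p)"
    and Y: "vector_field_on N W Y" "p \<in> W"
  defines "c \<equiv> chart0 N p"
  defines "F \<equiv> loc_rep f c d" and "x \<equiv> snd c p"
  shows "cov_deriv N M f p u (\<lambda>y. pushforward N M f y (Y y)) d =
    pushforward N M f p (cov_deriv N N id p u Y) d +
     (cov_hess (metric_coeff M d) F x (u c) (Y p c) - fderiv F x (christoffel_of (metric_coeff N c) x (u c) (Y p c)))"
proof -
  have c: "c \<in> charts_at N p" unfolding c_def by (rule chart0_in[OF N p])
  have A: "c \<in> atlas N" "d \<in> atlas M" "p \<in> fst c" "f p \<in> fst d" using c d by (auto simp: charts_at_iff)
  have ip: "chart_inv c x = p" using chart_inv_left[OF N A(1,3)] by (simp add: x_def)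
  define Yc where "Yc z = Y (chart_inv c z) c" for z
  define S where "S = snd c ` (fst c \<inter> W) \<inter> loc_dom f c d"
  have oW: "open (snd c ` (fst c \<inter> W))"
    using chart_image_open_Int[OF N A(1)] Y(1) by (simp add: vector_field_on_def)
  have oS: "open S" unfolding S_def by (intro open_Int oW loc_dom_open[OF N M f A(1,2)])
  have xS: "x \<in> S" using A Y(2) loc_dom_at[OF N M f c d] by (auto simp: S_def x_def)
  have sY: "smooth_on (snd c ` (fst c \<inter> W)) Yc"
    using Y(1) A(1) by (simp add: vector_field_on_def Yc_def[abs_def])
  have dY: "(Yc has_derivative fderiv Yc x) (at x)"
    by (rule smooth_on_has_derivative[OF sY]) (use xS in \<open>auto simp: S_def\<close>)
  have Fs: "smooth_on (loc_dom f c d) F" unfolding F_def by (rule loc_rep_smooth[OF N M f A(1,2)])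
  have Fx: "F x = snd d (f p)" unfolding F_def x_def by (rule loc_rep_at[OF N M f c])
  have xd: "x \<in> loc_dom f c d" using xS by (simp add: S_def)
  have lin: "linear (fderiv F x)" by (rule linear_frechet_derivative[OF smooth_on_differentiable[OF Fs xd]])
  have pf: "pushforward N M f (chart_inv c z) (Y (chart_inv c z)) d = fderiv F z (Yc z)" if z: "z \<in> S" for z
  proof -
    let ?y = "chart_inv c z"
    have z': "z \<in> loc_dom f c d" and zW: "z \<in> snd c ` (fst c \<inter> W)" using z by (auto simp: S_def)
    note l = loc_rep_in[OF N M f A(1) z']
    have cy: "c \<in> charts_at N ?y" and dy: "d \<in> charts_at M (f ?y)" using l A by (auto simp: charts_at_iff)
    have yW: "?y \<in> W" using zW chart_inv_left[OF N A(1)] by auto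
    then have "Y ?y \<in> tangent_space N ?y" using Y(1) by (simp add: vector_field_on_def)
    from pushforward_chart[OF N M f cy dy this] show ?thesis by (simp add: l(4) F_def Yc_def)
  qed
  have e1: "deriv_along N p u (\<lambda>y. pushforward N M f y (Y y) d) = hess F x (u c) (Yc x) + fderiv F x (fderiv Yc x (u c))"
  proof -
    have D: "((\<lambda>z. fderiv F z (Yc z)) has_derivative (\<lambda>e. hess F x e (Yc x) + fderiv F x (fderiv Yc x e))) (at x)"
      by (rule has_derivative_fderiv_field[OF Fs oS xS _ has_derivative_ident dY]) (auto simp: S_def)
    have "fderiv (\<lambda>z. fderiv F z (Yc z)) x = fderiv (\<lambda>z. pushforward N M f (chart_inv c z) (Y (chart_inv c z)) d) x"
      by (rule fderiv_cong[OF oS xS]) (use pf D in \<open>auto simp: differentiable_def\<close>)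
    then show ?thesis
      using fun_cong[OF fderiv_eqI[OF D], of "u c"]
      unfolding deriv_along_chart0 c_def[symmetric] x_def[symmetric] by simp
  qed
  have Yx: "Yc x = Y p c" by (simp add: Yc_def ip)
  have e2: "deriv_along N p u (snd d \<circ> f) = fderiv F x (u c)"
    unfolding deriv_along_chart0 c_def[symmetric] x_def[symmetric] F_def by (simp add: loc_rep_def)
  have lhs: "cov_deriv N M f p u (\<lambda>y. pushforward N M f y (Y y)) d =
    hess F x (u c) (Y p c) + fderiv F x (fderiv Yc x (u c)) +
      christoffel_of (metric_coeff M d) (F x) (fderiv F x (u c)) (fderiv F x (Y p c))"
    using d pf[OF xS] by (simp add: cov_deriv_def e1 e2 Fx christoffel_eq Yx ip)
  have e3: "deriv_along N p u (snd c \<circ> id) = u c"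
    unfolding deriv_along_chart0 c_def[symmetric] using fderiv_transition_self[OF N c] by simp
  have "cov_deriv N N id p u Y c = fderiv Yc x (u c) + christoffel_of (metric_coeff N c) x (u c) (Y p c)"
    using c e3 unfolding cov_deriv_def
    by (simp add: christoffel_eq x_def[symmetric] deriv_along_chart0 c_def[symmetric] Yc_def[abs_def])
  moreover have "pushforward N M f p V d = fderiv F x (V c)" for V
    using d unfolding pushforward_def deriv_along_chart0 c_def[symmetric] x_def[symmetric] F_def
    by (simp add: loc_rep_def)
  ultimately have "pushforward N M f p (cov_deriv N N id p u Y) d =
    fderiv F x (fderiv Yc x (u c)) + fderiv F x (christoffel_of (metric_coeff N c) x (u c) (Y p c))"
    by (simp add: linear_add[OF lin])
  then show ?thesis using lhs by (simp add: cov_hess_def)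
qed

text \<open>Existence is the preceding computation, valid for every extension of \<open>v\<close>;
  uniqueness needs one extension, the coordinate field through \<open>v\<close>. Outside the charts
  around \<open>f p\<close> all terms have the default value 0.\<close>

lemma second_fundamental_form_chart:
  fixes N :: "('a, 'e::euclidean_space) riemannian" and M :: "('b, 'f::euclidean_space) riemannian"
  assumes N: "smooth_charts N" and M: "smooth_charts M" and f: "smooth_map N M f"
    and p: "p \<in> topspace (mtop N)" and v: "v \<in> tangent_space N p"
  defines "c \<equiv> chart0 N p"
  shows "second_fundamental_form N M f p u v d = (if d \<in> charts_at M (f p)
    then cov_hess (metric_coeff M d) (loc_rep f c d) (snd c p) (u c) (v c)
      - fderiv (loc_rep f c d) (snd c p) (christoffel_of (metric_coeff N c) (snd c p) (u c) (v c))
    else 0)"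
proof -
  define w where "w d = (if d \<in> charts_at M (f p)
    then cov_hess (metric_coeff M d) (loc_rep f c d) (snd c p) (u c) (v c)
      - fderiv (loc_rep f c d) (snd c p) (christoffel_of (metric_coeff N c) (snd c p) (u c) (v c))
    else 0)" for d
  have c: "c \<in> charts_at N p" unfolding c_def by (rule chart0_in[OF N p])
  have cA: "c \<in> atlas N" "p \<in> fst c" using c by (auto simp: charts_at_iff)
  let ?P = "\<lambda>w. \<forall>W Y. vector_field_on N W Y \<and> p \<in> W \<and> Y p = v \<longrightarrow>
       cov_deriv N M f p u (\<lambda>y. pushforward N M f y (Y y)) =
       (\<lambda>d. pushforward N M f p (cov_deriv N N id p u Y) d + w d)"
  have "second_fundamental_form N M f p u v = w"
    unfolding second_fundamental_form_def
  proof (rule the_equality)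
    show w: "?P w"
    proof (intro allI impI ext)
      fix W Y d assume Y: "vector_field_on N W Y \<and> p \<in> W \<and> Y p = v"
      show "cov_deriv N M f p u (\<lambda>y. pushforward N M f y (Y y)) d =
         pushforward N M f p (cov_deriv N N id p u Y) d + w d"
      proof (cases "d \<in> charts_at M (f p)")
        case True
        then show ?thesis
          using cov_deriv_pushforward[OF N M f p True, of W Y u] Y by (simp add: w_def c_def)
      next
        case False
        then show ?thesis by (simp add: cov_deriv_def pushforward_def w_def)
      qed
    qed
    fix w' assume w': "?P w'"
    have Y: "vector_field_on N (fst c) (\<lambda>y. coord_vector N c y (v c)) \<and> p \<in> fst c \<and> coord_vector N c p (v c) = v"
      using coordinate_vector_field[OF N cA(1)] cA(2) coord_vector_eq[OF N v c] by simp
    show "w' = w"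
    proof (rule ext)
      fix d
      show "w' d = w d" using fun_cong[OF w'[rule_format, OF Y], of d] fun_cong[OF w[rule_format, OF Y], of d] by simp
    qed
  qed
  then show ?thesis by (simp add: w_def)
qed

text \<open>Gram-Schmidt, one vector at a time: fewer than \<open>DIM('e)\<close> vectors do not
  span, so a vector outside their span has a nonzero component orthogonal to them.\<close>

lemma orthonormal_family_exists:
  assumes g: "pos_form (g :: 'e::euclidean_space \<Rightarrow> 'e \<Rightarrow> real)"
  shows "k \<le> DIM('e) \<Longrightarrow> \<exists>B. finite B \<and> card B = k \<and> (\<forall>b\<in>B. \<forall>b'\<in>B. g b b' = (if b = b' then 1 else 0))"
proof (induction k)
  case 0
  show ?case by (intro exI[of _ "{}"]) simp
next
  case (Suc k)
  then obtain B where B: "finite B" "card B = k" "\<And>b b'. b \<in> B \<Longrightarrow> b' \<in> B \<Longrightarrow> g b b' = (if b = b' then 1 else 0)"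
    by auto
  have "dim (span B) \<le> k" using dim_le_card'[OF B(1)] B(2) by simp
  then have "span B \<noteq> UNIV" using Suc.prems by (metis dim_UNIV not_less_eq_eq)
  then obtain v where v: "v \<notin> span B" by blast
  define w where "w = v - (\<Sum>b\<in>B. g v b *\<^sub>R b)"
  have "w \<noteq> 0"
  proof
    assume "w = 0"
    then have "v = (\<Sum>b\<in>B. g v b *\<^sub>R b)" by (simp add: w_def)
    moreover have "(\<Sum>b\<in>B. g v b *\<^sub>R b) \<in> span B" by (intro span_sum span_scale span_base)
    ultimately show False using v by simp
  qed
  then have pos: "g w w > 0" by (rule pos_form_pos[OF g])
  have orth: "g w b = 0" if b: "b \<in> B" for b
  proof -
    have "g (\<Sum>b\<in>B. g v b *\<^sub>R b) b = (\<Sum>b'\<in>B. g v b' * g b' b)"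
      by (simp add: linear_sum[OF pos_form_linear_left[OF g]] pos_form_scale[OF g])
    also have "\<dots> = (\<Sum>b'\<in>B. if b' = b then g v b' else 0)"
      by (rule sum.cong) (use B(3) b in auto)
    also have "\<dots> = g v b" using B(1) b by simp
    finally show ?thesis by (simp add: w_def pos_form_diff[OF g])
  qed
  define e where "e = (1 / sqrt (g w w)) *\<^sub>R w"
  have ee: "g e e = 1" using pos by (simp add: e_def pos_form_scale[OF g] flip: real_sqrt_mult)
  have eb: "g e b = 0" "g b e = 0" if "b \<in> B" for b
    using orth[OF that] by (simp_all add: e_def pos_form_scale[OF g] pos_form_sym[OF g, of b])
  have "e \<notin> B" using ee eb by force
  then show ?case
    using B ee eb by (intro exI[of _ "insert e B"]) auto
qed

text \<open>Gives meaning to the choice made in \<open>mean_curvature\<close>; an orthonormal family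
  of the coefficient form is carried to the tangent space by \<open>coord_vector\<close>.\<close>

lemma orthonormal_basis_exists:
  fixes N :: "('a, 'e::euclidean_space) riemannian"
  assumes N: "riemannian_manifold N" and p: "p \<in> topspace (mtop N)"
  shows "orthonormal_basis N p (SOME E. orthonormal_basis N p E)"
proof (rule someI_ex)
  note C = riemannian_charts[OF N]
  define c where "c = chart0 N p"
  have c: "c \<in> charts_at N p" unfolding c_def by (rule chart0_in[OF C p])
  then have cA: "c \<in> atlas N" "snd c p \<in> snd c ` fst c" by (auto simp: charts_at_iff)
  let ?g = "metric_coeff N c (snd c p)"
  have g: "pos_form ?g" by (rule metric_onD(2)[OF metric_on_chart[OF N cA(1)] cA(2)])
  obtain B where B: "finite B" "card B = DIM('e)" "\<And>b b'. b \<in> B \<Longrightarrow> b' \<in> B \<Longrightarrow> ?g b b' = (if b = b' then 1 else 0)"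
    using orthonormal_family_exists[OF g order_refl] by blast
  have inj: "inj (coord_vector N c p)" by (rule injI) (use coord_vector_chart[OF C c] in metis)
  have "orthonormal_basis N p (coord_vector N c p ` B)"
    unfolding orthonormal_basis_def
  proof (intro conjI ballI)
    show "card (coord_vector N c p ` B) = DIM('e)" using B(2) inj by (simp add: card_image inj_on_subset)
    show "coord_vector N c p ` B \<subseteq> tangent_space N p" using coord_vector_tangent[OF C c] by auto
    fix e e' assume e: "e \<in> coord_vector N c p ` B" "e' \<in> coord_vector N c p ` B"
    then obtain b b' where b: "b \<in> B" "b' \<in> B" "e = coord_vector N c p b" "e' = coord_vector N c p b'" by blast
    have "metric N p e e' = ?g b b'"
      unfolding b by (simp add: metric_in_chart[OF C c coord_vector_tangent[OF C c] coord_vector_tangent[OF C c]]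
          coord_vector_chart[OF C c])
    then show "metric N p e e' = (if e = e' then 1 else 0)" using B(3)[OF b(1,2)] b inj by (simp add: inj_eq)
  qed (use B(1) in simp)
  then show "\<exists>E. orthonormal_basis N p E" by blast
qed

subsection \<open>Geodesics\<close>

lemma interval_charts:
  assumes "open I"
  shows "smooth_charts (interval_manifold I)"
proof -
  have "smooth_on I (id \<circ> chart_inv (I, id))"
    by (rule smooth_on_cong[OF smooth_on_ident[OF assms] assms]) (use inv_into_f_f[of id I] in \<open>simp add: chart_inv_def\<close>)
  then show ?thesis using assms
    by (simp add: smooth_charts_def interval_manifold_def subtopology_subtopology)
qed

lemma interval_charts_at: "charts_at (interval_manifold I) t = (if t \<in> I then {(I, id)} else {})"
  by (auto simp: charts_at_def interval_manifold_def)

lemma chart_inv_interval: "t \<in> I \<Longrightarrow> chart_inv (I, id) t = t"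
  using inv_into_f_f[of id I t] by (simp add: chart_inv_def)

lemma chart0_interval: "t \<in> I \<Longrightarrow> chart0 (interval_manifold I) t = (I, id)"
  by (simp add: chart0_def interval_charts_at)

lemma unit_tangent_chart:
  assumes "open I" "t \<in> I"
  shows "unit_tangent I t (I, id) = 1"
  using coord_vector_chart[OF interval_charts[OF assms(1)], of "(I, id)" t 1] assms(2)
  by (simp add: unit_tangent_def interval_charts_at)

lemma smooth_curve_chart:
  fixes M :: "('a, 'e::euclidean_space) riemannian"
  assumes I: "open I" and \<gamma>: "smooth_map (interval_manifold I) M \<gamma>" and d: "d \<in> atlas M" and M: "smooth_charts M"
  shows "open (I \<inter> \<gamma> -` fst d)" "smooth_on (I \<inter> \<gamma> -` fst d) (\<lambda>t. snd d (\<gamma> t))"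
proof -
  have a: "(I, id) \<in> atlas (interval_manifold I)" by (simp add: interval_manifold_def)
  have L: "loc_dom \<gamma> (I, id) d = I \<inter> \<gamma> -` fst d" by (simp add: loc_dom_def)
  show o: "open (I \<inter> \<gamma> -` fst d)"
    using loc_dom_open[OF interval_charts[OF I] M \<gamma> a d] by (simp add: L)
  show "smooth_on (I \<inter> \<gamma> -` fst d) (\<lambda>t. snd d (\<gamma> t))"
    by (rule smooth_on_cong[OF loc_rep_smooth[OF interval_charts[OF I] M \<gamma> a d, unfolded L] o])
      (simp add: loc_rep_def chart_inv_interval)
qed

text \<open>The acceleration of a curve is its covariant Hessian in the directions 1 and 1, so the
  chain rule \<open>cov_hess_compose\<close> serves geodesics as well as submanifolds.\<close>

lemma cov_deriv_velocity_chart: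
  fixes M :: "('a, 'e::euclidean_space) riemannian"
  assumes I: "open I" "t \<in> I" and \<gamma>: "smooth_map (interval_manifold I) M \<gamma>"
    and M: "smooth_charts M" and d: "d \<in> charts_at M (\<gamma> t)"
  shows "cov_deriv (interval_manifold I) M \<gamma> t (unit_tangent I t) (velocity M I \<gamma>) d =
    cov_hess (metric_coeff M d) (\<lambda>t. snd d (\<gamma> t)) t 1 1"
proof -
  let ?y = "\<lambda>t. snd d (\<gamma> t)"
  have dA: "d \<in> atlas M" "\<gamma> t \<in> fst d" using d by (auto simp: charts_at_iff)
  note sm = smooth_curve_chart[OF I(1) \<gamma> dA(1) M]
  have tS: "t \<in> I \<inter> \<gamma> -` fst d" using I(2) dA by simp
  have da: "deriv_along (interval_manifold I) s (unit_tangent I s) h = fderiv h s 1"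
    if s: "s \<in> I" and h: "h differentiable at s" for s and h :: "real \<Rightarrow> 'e"
  proof -
    have "fderiv h s = fderiv (\<lambda>x. h (chart_inv (I, id) x)) s"
      by (rule fderiv_cong[OF I(1) s _ h]) (simp add: chart_inv_interval)
    then show ?thesis
      by (simp add: deriv_along_chart0 chart0_interval[OF s] unit_tangent_chart[OF I(1) s])
  qed
  have v: "velocity M I \<gamma> s d = fderiv ?y s 1" if s: "s \<in> I \<inter> \<gamma> -` fst d" for s
    using s dA(1) da[of s ?y] smooth_on_differentiable[OF sm(2) s]
    by (simp add: velocity_def pushforward_def charts_at_iff comp_def)
  have dd: "(\<lambda>s. fderiv ?y s 1) differentiable at t"
    by (rule smooth_on_differentiable[OF smooth_on_fderiv_const[OF sm(2)] tS])
  have vd: "(\<lambda>s. velocity M I \<gamma> s d) differentiable at t"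
    by (rule differentiable_cong[OF sm(1) tS _ dd]) (simp only: v)
  have "fderiv (\<lambda>s. velocity M I \<gamma> s d) t = fderiv (\<lambda>s. fderiv ?y s 1) t"
    by (rule fderiv_cong[OF sm(1) tS v vd])
  then show ?thesis
    using d da[OF I(2) vd] da[OF I(2) smooth_on_differentiable[OF sm(2) tS]] v[OF tS]
    by (simp add: cov_deriv_def cov_hess_def hess_def christoffel_eq comp_def)
qed

lemma transition_fderiv_surj:
  assumes M: "smooth_charts M" and c: "c \<in> charts_at M p" "d \<in> charts_at M p"
  shows "surj (fderiv (\<lambda>x. snd d (chart_inv c x)) (snd c p))"
proof (rule surjI)
  show "fderiv (\<lambda>x. snd d (chart_inv c x)) (snd c p) (fderiv (\<lambda>x. snd c (chart_inv d x)) (snd d p) a) = a" for a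
    using fderiv_transition_compose[OF M c(2,1,2)] fderiv_transition_self[OF M c(2)] by simp
qed

text \<open>The equation is solved in the single chart \<open>c\<close>, whereas
  \<open>geodesic\<close> requires it in all charts around each point of the curve; the
  transformation law of the Christoffel symbols carries it over.\<close>

lemma geodesic_exists:
  fixes M :: "('a, 'e::euclidean_space) riemannian"
  assumes M: "riemannian_manifold M" and c: "c \<in> charts_at M r"
  obtains I \<gamma> where "geodesic M I \<gamma>" "0 \<in> I" "\<gamma> 0 = r" "\<gamma> ` I \<subseteq> fst c"
    "smooth_on I (\<lambda>t. snd c (\<gamma> t))" "fderiv (\<lambda>t. snd c (\<gamma> t)) 0 1 = a"
proof -
  note C = riemannian_charts[OF M]
  have cA: "c \<in> atlas M" "r \<in> fst c" using c by (auto simp: charts_at_iff)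
  let ?g = "metric_coeff M c"
  note mc = metric_on_chart[OF M cA(1)]
  obtain \<epsilon> x v where e: "\<epsilon> > 0" "x 0 = snd c r" "v 0 = a" and sx: "smooth_on {-\<epsilon><..<\<epsilon>} x"
    and xS: "\<And>t. t \<in> {-\<epsilon><..<\<epsilon>} \<Longrightarrow> x t \<in> snd c ` fst c"
    and dx: "\<And>t. t \<in> {-\<epsilon><..<\<epsilon>} \<Longrightarrow> (x has_vector_derivative v t) (at t)"
    and dv: "\<And>t. t \<in> {-\<epsilon><..<\<epsilon>} \<Longrightarrow> (v has_vector_derivative - christoffel_of ?g (x t) (v t) (v t)) (at t)"
    using geodesic_equation_local_solution[OF mc, of "snd c r" a] cA(2) by (metis imageI)
  define I where "I = {-\<epsilon><..<\<epsilon>}"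
  have oI: "open I" by (simp add: I_def)
  note sx = sx[folded I_def] and xS = xS[folded I_def] and dx = dx[folded I_def] and dv = dv[folded I_def]
  define \<gamma> where "\<gamma> t = chart_inv c (x t)" for t
  have \<gamma>c: "\<gamma> t \<in> fst c" if "t \<in> I" for t using chart_inv_in[OF C cA(1) xS[OF that]] by (simp add: \<gamma>_def)
  have c\<gamma>: "snd c (\<gamma> t) = x t" if "t \<in> I" for t using chart_inv_right[OF C cA(1) xS[OF that]] by (simp add: \<gamma>_def)
  have fx: "fderiv x t 1 = v t" if "t \<in> I" for t
    using fderiv_eqI[OF dx[OF that, unfolded has_vector_derivative_def]] by simp
  have hx: "hess x t 1 1 = - christoffel_of ?g (x t) (v t) (v t)" if t: "t \<in> I" for t
  proof -
    have "fderiv v t = fderiv (\<lambda>s. fderiv x s 1) t"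
      by (rule fderiv_cong[OF oI t]) (use fx dv[OF t] in \<open>auto simp: has_vector_derivative_def differentiable_def\<close>)
    then show ?thesis
      using fun_cong[OF fderiv_eqI[OF dv[OF t, unfolded has_vector_derivative_def]], of 1] by (simp add: hess_def)
  qed
  have cont: "continuous_map (top_of_set I) (mtop M) \<gamma>"
  proof -
    have "continuous_map (top_of_set I) (top_of_set (snd c ` fst c)) x"
      using smooth_on_continuous_on[OF sx] xS by (auto simp: continuous_map_in_subtopology)
    from continuous_map_compose[OF this chart_inv_continuous[OF C cA(1)]]
    show ?thesis by (simp add: \<gamma>_def[abs_def] comp_def)
  qed
  have oD: "open (I \<inter> \<gamma> -` fst d)" if d: "d \<in> atlas M" for d
  proof -
    have "openin (top_of_set I) {t \<in> I. \<gamma> t \<in> fst d}"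
      using openin_continuous_map_preimage[OF cont chart_openin[OF C d]] by simp
    then have "open {t \<in> I. \<gamma> t \<in> fst d}" using oI openin_open_trans by blast
    moreover have "{t \<in> I. \<gamma> t \<in> fst d} = I \<inter> \<gamma> -` fst d" by auto
    ultimately show ?thesis by simp
  qed
  have xd: "x t \<in> snd c ` (fst c \<inter> fst d)" if "t \<in> I \<inter> \<gamma> -` fst d" for t d
    using that \<gamma>c c\<gamma> by (metis IntD1 IntD2 IntI image_eqI vimageE)
  have sd: "smooth_on (I \<inter> \<gamma> -` fst d) (\<lambda>t. snd d (\<gamma> t))" if d: "d \<in> atlas M" for d
    unfolding \<gamma>_def[of _]
    by (rule smooth_on_comp[OF oD[OF d, unfolded \<gamma>_def] transition_open[OF C cA(1) d] transition_smooth[OF C cA(1) d]])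
      (use smooth_on_subset[OF sx] xd in \<open>auto simp: \<gamma>_def\<close>)
  have sm: "smooth_map (interval_manifold I) M \<gamma>"
    unfolding smooth_map_def
  proof (intro conjI ballI)
    show "continuous_map (mtop (interval_manifold I)) (mtop M) \<gamma>" using cont by (simp add: interval_manifold_def)
    fix b d assume b: "b \<in> atlas (interval_manifold I)" and d: "d \<in> atlas M"
    have b: "b = (I, id)" using b by (simp add: interval_manifold_def)
    have "smooth_on (I \<inter> \<gamma> -` fst d) (snd d \<circ> \<gamma> \<circ> chart_inv (I, id))"
      by (rule smooth_on_cong[OF sd[OF d] oD[OF d]]) (simp add: chart_inv_interval)
    then show "smooth_on (snd b ` (fst b \<inter> \<gamma> -` fst d)) (snd d \<circ> \<gamma> \<circ> chart_inv b)" by (simp add: b)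
  qed
  have geo: "cov_deriv (interval_manifold I) M \<gamma> t (unit_tangent I t) (velocity M I \<gamma>) = (\<lambda>_. 0)" if t: "t \<in> I" for t
  proof (rule ext)
    fix d
    show "cov_deriv (interval_manifold I) M \<gamma> t (unit_tangent I t) (velocity M I \<gamma>) d = 0"
    proof (cases "d \<in> charts_at M (\<gamma> t)")
      case False
      then show ?thesis by (simp add: cov_deriv_def)
    next
      case d: True
      then have dA: "d \<in> atlas M" "\<gamma> t \<in> fst d" by (auto simp: charts_at_iff)
      have c': "c \<in> charts_at M (\<gamma> t)" using \<gamma>c[OF t] cA by (simp add: charts_at_iff)
      define T where "T = (\<lambda>x. snd d (chart_inv c x))"
      let ?S = "snd c ` (fst c \<inter> fst d)" and ?J = "I \<inter> \<gamma> -` fst d"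
      have tJ: "t \<in> ?J" using t dA by simp
      have sT: "smooth_on ?S T" unfolding T_def by (rule transition_smooth[OF C cA(1) dA(1)])
      have sxJ: "smooth_on ?J x" by (rule smooth_on_subset[OF sx]) auto
      have eq: "(\<lambda>t. snd d (\<gamma> t)) = (\<lambda>t. T (x t))" by (simp add: T_def \<gamma>_def)
      have mS: "metric_on ?S ?g"
        using mc transition_open[OF C cA(1) dA(1)] smooth_on_subset[of "snd c ` fst c" _ ?S]
        by (auto simp: metric_on_def)
      \<comment> \<open>This image of the Christoffel term is cancelled below by the chain rule
        correction \<open>fderiv T (x t) (hess x t 1 1)\<close>, because \<open>x\<close> solves the
        equation in \<open>c\<close>.\<close>
      have "cov_hess (metric_coeff M d) T (x t) (v t) (v t) = fderiv T (x t) (christoffel_of ?g (x t) (v t) (v t))"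
      proof (rule christoffel_transform[OF mS metric_on_chart[OF M dA(1)] sT])
        show "T z \<in> snd d ` fst d" if "z \<in> ?S" for z
          using that chart_inv_left[OF C cA(1)] by (auto simp: T_def)
        show "?g z a b = metric_coeff M d (T z) (fderiv T z a) (fderiv T z b)" if "z \<in> ?S" for z a b
          unfolding T_def by (rule metric_coeff_transition[OF M cA(1) dA(1) that])
        show "x t \<in> ?S" by (rule xd[OF tJ])
        show "surj (fderiv T (x t))"
          using transition_fderiv_surj[OF C c' d] by (simp add: T_def c\<gamma>[OF t])
      qed
      moreover have "cov_hess (metric_coeff M d) (\<lambda>t. snd d (\<gamma> t)) t 1 1 =
          cov_hess (metric_coeff M d) T (x t) (v t) (v t) + fderiv T (x t) (hess x t 1 1)"
        using cov_hess_compose(2)[OF sT oD[OF dA(1)] tJ xd sxJ fun_cong[OF eq] sd[OF dA(1)], of _ 1 1]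
        by (simp add: fx[OF t])
      moreover have "linear (fderiv T (x t))"
        by (rule linear_frechet_derivative[OF smooth_on_differentiable[OF sT xd[OF tJ]]])
      ultimately have "cov_hess (metric_coeff M d) (\<lambda>t. snd d (\<gamma> t)) t 1 1 = 0"
        by (simp add: hx[OF t] linear_neg)
      then show ?thesis using cov_deriv_velocity_chart[OF oI t sm C d] by simp
    qed
  qed
  show ?thesis
  proof (rule that)
    show "geodesic M I \<gamma>" using sm geo oI is_interval_oo by (auto simp: geodesic_def I_def)
    show "0 \<in> I" using e(1) by (simp add: I_def)
    show "\<gamma> 0 = r" using e(2) chart_inv_left[OF C cA] by (simp add: \<gamma>_def)
    show "\<gamma> ` I \<subseteq> fst c" using \<gamma>c by blast
    show "smooth_on I (\<lambda>t. snd c (\<gamma> t))" by (rule smooth_on_cong[OF sx oI]) (simp add: c\<gamma>)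
    have "fderiv x 0 = fderiv (\<lambda>t. snd c (\<gamma> t)) 0"
      by (rule fderiv_cong[OF oI \<open>0 \<in> I\<close>]) (use c\<gamma> \<open>0 \<in> I\<close> smooth_on_differentiable[OF sx] in auto)
    then show "fderiv (\<lambda>t. snd c (\<gamma> t)) 0 1 = a" using fx[OF \<open>0 \<in> I\<close>] e(3) by simp
  qed
qed

text \<open>For the geodesic \<gamma> of \<open>N\<close> with initial velocity \<open>a\<close>,
  the accelerations of \<gamma> in \<open>N\<close> and of \<open>f \<circ> \<gamma>\<close> in
  \<open>M\<close> both vanish at 0, and the chain rule relates them. In view of the chart formula,
  the second fundamental form vanishes on the diagonal.\<close>

lemma totally_geodesic_cov_hess:
  fixes N :: "('a, 'e::euclidean_space) riemannian" and M :: "('b, 'f::euclidean_space) riemannian"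
  assumes N: "riemannian_manifold N" and M: "smooth_charts M" and f: "smooth_map N M f"
    and tg: "totally_geodesic_at N M f p" and c: "c \<in> charts_at N p" and d: "d \<in> charts_at M (f p)"
  shows "cov_hess (metric_coeff M d) (loc_rep f c d) (snd c p) a a
    = fderiv (loc_rep f c d) (snd c p) (christoffel_of (metric_coeff N c) (snd c p) a a)"
proof -
  note C = riemannian_charts[OF N]
  have A: "c \<in> atlas N" "p \<in> fst c" "d \<in> atlas M" "f p \<in> fst d" using c d by (auto simp: charts_at_iff)
  obtain I \<gamma> where geo: "geodesic N I \<gamma>" and I0: "0 \<in> I" and \<gamma>0: "\<gamma> 0 = p" and \<gamma>c: "\<gamma> ` I \<subseteq> fst c"
    and sx: "smooth_on I (\<lambda>t. snd c (\<gamma> t))" and x': "fderiv (\<lambda>t. snd c (\<gamma> t)) 0 1 = a"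
    by (rule geodesic_exists[OF N c, where a=a])
  define x where "x t = snd c (\<gamma> t)" for t
  note sx = sx[folded x_def] and x' = x'[folded x_def]
  have x0: "x 0 = snd c p" by (simp add: x_def \<gamma>0)
  obtain \<epsilon> where \<epsilon>: "\<epsilon> > 0" "{-\<epsilon><..<\<epsilon>} \<subseteq> I" and geo': "geodesic M {-\<epsilon><..<\<epsilon>} (f \<circ> \<gamma>)"
    using tg geo I0 \<gamma>0 unfolding totally_geodesic_at_def by blast
  define J where "J = {-\<epsilon><..<\<epsilon>}"
  have J: "open J" "0 \<in> J" "J \<subseteq> I" using \<epsilon> by (auto simp: J_def)
  have sm: "smooth_map (interval_manifold I) N \<gamma>" and sm': "smooth_map (interval_manifold J) M (f \<circ> \<gamma>)"
    and oI: "open I" using geo geo' by (simp_all add: geodesic_def J_def)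
  have "cov_hess (metric_coeff N c) (\<lambda>t. snd c (\<gamma> t)) 0 1 1 = 0"
    using cov_deriv_velocity_chart[OF oI I0 sm C, of c] geo I0 c by (simp add: geodesic_def \<gamma>0)
  then have hx: "hess x 0 1 1 = - christoffel_of (metric_coeff N c) (snd c p) a a"
    by (simp add: cov_hess_def x_def[symmetric] x0 x' add_eq_0_iff2)
  have z: "cov_hess (metric_coeff M d) (\<lambda>t. snd d ((f \<circ> \<gamma>) t)) 0 1 1 = 0"
    using cov_deriv_velocity_chart[OF J(1,2) sm' M, of d] geo' J(2) d by (simp add: geodesic_def \<gamma>0 J_def)
  let ?K = "J \<inter> (f \<circ> \<gamma>) -` fst d" and ?F = "loc_rep f c d"
  note K = smooth_curve_chart[OF J(1) sm' A(3) M]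
  have K0: "0 \<in> ?K" using J(2) A(4) \<gamma>0 by simp
  have sF: "smooth_on (loc_dom f c d) ?F" by (rule loc_rep_smooth[OF C M f A(1,3)])
  have xK: "x t \<in> loc_dom f c d" if "t \<in> ?K" for t
    using that \<gamma>c J(3) by (auto simp: x_def loc_dom_def)
  have FK: "snd d ((f \<circ> \<gamma>) t) = ?F (x t)" if "t \<in> ?K" for t
  proof -
    have "\<gamma> t \<in> fst c" using that \<gamma>c J(3) by blast
    then show ?thesis using chart_inv_left[OF C A(1), of "\<gamma> t"] by (simp add: x_def loc_rep_def)
  qed
  have "cov_hess (metric_coeff M d) (\<lambda>t. snd d ((f \<circ> \<gamma>) t)) 0 1 1
     = cov_hess (metric_coeff M d) ?F (x 0) (fderiv x 0 1) (fderiv x 0 1) + fderiv ?F (x 0) (hess x 0 1 1)"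
    by (rule cov_hess_compose(2)[OF sF K(1) K0 xK smooth_on_subset[OF sx] FK K(2)]) (use J(3) in auto)
  moreover have "linear (fderiv ?F (snd c p))"
    by (rule linear_frechet_derivative[OF smooth_on_differentiable[OF sF loc_dom_at[OF C M f c d]]])
  ultimately show ?thesis using z by (simp add: x' x0 hx linear_neg)
qed

section \<open>Normality and the mean curvature vector\<close>

lemma metric_on_subset: "metric_on T g \<Longrightarrow> open S \<Longrightarrow> S \<subseteq> T \<Longrightarrow> metric_on S g"
  using smooth_on_subset unfolding metric_on_def by blast

text \<open>By \<open>cov_hess_tangential\<close> the tangential part of the covariant Hessian is
  the image of the Christoffel term of \<open>N\<close>, which is exactly what the chart formula
  subtracts.\<close>

lemma second_fundamental_form_normal:
  fixes N :: "('a, 'e::euclidean_space) riemannian" and M :: "('b, 'f::euclidean_space) riemannian"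
  assumes N: "riemannian_manifold N" and M: "riemannian_manifold M" and f: "isometric_immersion N M f"
    and p: "p \<in> topspace (mtop N)" and v: "v \<in> tangent_space N p" and d: "d \<in> charts_at M (f p)"
  defines "c \<equiv> chart0 N p"
  shows "metric_coeff M d (snd d (f p)) (second_fundamental_form N M f p u v d) (fderiv (loc_rep f c d) (snd c p) e) = 0"
proof -
  note CN = riemannian_charts[OF N] and CM = riemannian_charts[OF M]
  have sf: "smooth_map N M f" using f by (simp add: isometric_immersion_def immersion_def)
  have c: "c \<in> charts_at N p" unfolding c_def by (rule chart0_in[OF CN p])
  have A: "c \<in> atlas N" "d \<in> atlas M" using c d by (auto simp: charts_at_iff)
  let ?F = "loc_rep f c d" and ?x = "snd c p" and ?S = "loc_dom f c d"
  have Fx: "?F ?x = snd d (f p)" by (rule loc_rep_at[OF CN CM sf c])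
  have x: "?x \<in> ?S" by (rule loc_dom_at[OF CN CM sf c d])
  have mN: "metric_on ?S (metric_coeff N c)"
    by (rule metric_on_subset[OF metric_on_chart[OF N A(1)] loc_dom_open[OF CN CM sf A]]) (auto simp: loc_dom_def)
  have F: "\<And>x. x \<in> ?S \<Longrightarrow> ?F x \<in> snd d ` fst d" by (rule loc_rep_in(1)[OF CN CM sf A(1)])
  note iso = isometric_metric_coeff[OF N M f A]
  note mM = metric_on_chart[OF M A(2)]
  note t = cov_hess_tangential[OF mN mM loc_rep_smooth[OF CN CM sf A] F iso x]
  show ?thesis
    using second_fundamental_form_chart[OF CN CM sf p v, of u d] d t iso[OF x] metric_onD(2)[OF mM F[OF x]]
    by (simp add: c_def[symmetric] Fx pos_form_diff)
qed

lemma mean_curvature_normal: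
  fixes N :: "('a, 'e::euclidean_space) riemannian" and M :: "('b, 'f::euclidean_space) riemannian"
  assumes N: "riemannian_manifold N" and M: "riemannian_manifold M" and f: "isometric_immersion N M f"
    and p: "p \<in> topspace (mtop N)" and d: "d \<in> charts_at M (f p)"
  defines "c \<equiv> chart0 N p"
  shows "metric_coeff M d (snd d (f p)) (mean_curvature N M f p d) (fderiv (loc_rep f c d) (snd c p) e) = 0"
proof -
  have d': "d \<in> atlas M" "f p \<in> fst d" using d by (auto simp: charts_at_iff)
  have g: "pos_form (metric_coeff M d (snd d (f p)))"
    by (rule metric_onD(2)[OF metric_on_chart[OF M d'(1)]]) (use d' in auto)
  define E where "E = (SOME E. orthonormal_basis N p E)"
  have E: "E \<subseteq> tangent_space N p"
    using orthonormal_basis_exists[OF N p] by (simp add: orthonormal_basis_def E_def)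
  show ?thesis
    unfolding mean_curvature_def E_def[symmetric] Let_def
    by (simp add: pos_form_scale[OF g] linear_sum[OF pos_form_linear_left[OF g]])
      (intro disjI2 sum.neutral ballI; use E second_fundamental_form_normal[OF N M f p _ d] c_def in blast)
qed

text \<open>Every unit vector contributes \<open>H d\<close>, and a basis has \<open>DIM('e)\<close>
  of them, so the average does not see which orthonormal basis was chosen.\<close>

lemma mean_curvature_eqI:
  fixes N :: "('a, 'e::euclidean_space) riemannian" and M :: "('b, 'f::euclidean_space) riemannian"
  assumes N: "riemannian_manifold N" and p: "p \<in> topspace (mtop N)"
    and II: "\<And>u d. u \<in> tangent_space N p \<Longrightarrow> second_fundamental_form N M f p u u d = metric N p u u *\<^sub>R H d"
  shows "mean_curvature N M f p = H"
proof (rule ext)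
  fix d
  define E where "E = (SOME E. orthonormal_basis N p E)"
  have "orthonormal_basis N p E" unfolding E_def by (rule orthonormal_basis_exists[OF N p])
  then have E: "card E = DIM('e)" "E \<subseteq> tangent_space N p" "\<And>e. e \<in> E \<Longrightarrow> metric N p e e = 1"
    by (simp_all add: orthonormal_basis_def)
  have "(\<Sum>e\<in>E. second_fundamental_form N M f p e e d) = (\<Sum>e\<in>E. H d)"
  proof (rule sum.cong[OF refl])
    show "second_fundamental_form N M f p e e d = H d" if "e \<in> E" for e
      using II[of e d] E(2) E(3)[OF that] that by auto
  qed
  then show "mean_curvature N M f p d = H d"
    unfolding mean_curvature_def E_def[symmetric] Let_def by (simp add: E(1) scaleR_conv_of_real[symmetric] sum_constant_scaleR)
qed

text \<open>The inclusion of \<open>L\<close> lifts through \<open>f\<close> by means of the left inverse \<open>P\<close>. The chart \<open>d0\<close> in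
  which \<open>P\<close> is given is independent of the chart \<open>d\<close> in which the Hessians are compared.\<close>

lemma submanifold_cov_hess:
  fixes N :: "('b, 'f::euclidean_space) riemannian" and M :: "('a, 'e::euclidean_space) riemannian"
    and L :: "('a, 'h::euclidean_space) riemannian"
  assumes N: "smooth_charts N" and M: "smooth_charts M" and f: "smooth_map N M f"
    and c: "c \<in> charts_at N p" and d0: "d0 \<in> charts_at M (f p)"
    and P: "open D" "smooth_on D P" "loc_rep f c d0 ` B \<subseteq> D" "\<And>x. x \<in> B \<Longrightarrow> P (loc_rep f c d0 x) = x"
    and B: "B \<subseteq> loc_dom f c d0" "snd c p \<in> B"
    and L: "smooth_charts L" "smooth_map L M id" "topspace (mtop L) \<subseteq> f ` {y \<in> fst c. snd c y \<in> B}"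
    and l: "l \<in> charts_at L (f p)" and d: "d \<in> charts_at M (f p)"
  obtains a' w where "fderiv (loc_rep id l d) (snd l (f p)) a = fderiv (loc_rep f c d) (snd c p) a'"
    "cov_hess g (loc_rep id l d) (snd l (f p)) a a =
      cov_hess g (loc_rep f c d) (snd c p) a' a' + fderiv (loc_rep f c d) (snd c p) w"
proof -
  have A: "c \<in> atlas N" "p \<in> fst c" "d0 \<in> atlas M" "l \<in> atlas L" "f p \<in> fst l" "d \<in> atlas M"
    using c d0 l d by (auto simp: charts_at_iff)
  have d0': "d0 \<in> charts_at M (id (f p))" and d': "d \<in> charts_at M (id (f p))" using d0 d by simp_all
  \<comment> \<open>The candidate lift reads a point of \<open>L\<close> in ambient coordinates and
    applies \<open>P\<close>. Its smoothness comes from \<open>P\<close> being smooth on the open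
    set \<open>D\<close>; the inclusion of sets only ensures that its values lie in \<open>B\<close>
    and lie over the right points.\<close>
  define \<phi> where "\<phi> z = P (snd d0 (chart_inv l z))" for z
  have lift: "\<exists>y\<in>fst c. snd c y \<in> B \<and> f y = chart_inv l z \<and> \<phi> z = snd c y \<and> snd d0 (chart_inv l z) \<in> D"
    if z: "z \<in> snd l ` fst l" for z
  proof -
    have "chart_inv l z \<in> topspace (mtop L)" using chart_inv_in[OF L(1) A(4) z] chart_subset[OF L(1) A(4)] by blast
    then obtain y where y: "y \<in> fst c" "snd c y \<in> B" "f y = chart_inv l z" using L(3) by auto
    have "loc_rep f c d0 (snd c y) = snd d0 (f y)"
      using y(1) chart_inv_left[OF N A(1)] by (simp add: loc_rep_def)
    then show ?thesis using P(3,4) y by (force simp: \<phi>_def)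
  qed
  let ?T = "loc_dom id l d0 \<inter> loc_dom id l d"
  let ?G = "loc_rep id l d" and ?F = "loc_rep f c d"
  have T1: "z \<in> snd l ` fst l" if "z \<in> ?T" for z using that by (auto simp: loc_dom_def)
  have oT: "open ?T" by (intro open_Int loc_dom_open[OF L(1) M L(2)] A)
  have zT: "snd l (f p) \<in> ?T"
    using loc_dom_at[OF L(1) M L(2) l d0'] loc_dom_at[OF L(1) M L(2) l d'] by blast
  have s0: "smooth_on ?T (\<lambda>z. snd d0 (chart_inv l z))"
    using smooth_on_subset[OF loc_rep_smooth[OF L(1) M L(2) A(4,3)], of ?T] by (simp add: loc_rep_def)
  have s\<phi>: "smooth_on ?T \<phi>"
    unfolding \<phi>_def[abs_def] by (rule smooth_on_comp[OF oT P(1,2) s0]) (use lift T1 in blast)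
  have sG: "smooth_on ?T ?G" by (rule smooth_on_subset[OF loc_rep_smooth[OF L(1) M L(2) A(4,6)]]) simp
  have sF: "smooth_on (loc_dom f c d) ?F" by (rule loc_rep_smooth[OF N M f A(1,6)])
  have \<phi>: "\<phi> z \<in> loc_dom f c d" "?G z = ?F (\<phi> z)" if z: "z \<in> ?T" for z
  proof -
    obtain y where y: "y \<in> fst c" "f y = chart_inv l z" "\<phi> z = snd c y" using lift[OF T1[OF z]] by blast
    have "chart_inv l z \<in> fst d" using loc_rep_in(3)[OF L(1) M L(2) A(4), of z d] z by simp
    then show "\<phi> z \<in> loc_dom f c d" using y by (auto simp: loc_dom_def)
    show "?G z = ?F (\<phi> z)" using y chart_inv_left[OF N A(1)] by (simp add: loc_rep_def)
  qed
  have \<phi>0: "\<phi> (snd l (f p)) = snd c p"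
    using P(4)[OF B(2)] chart_inv_left[OF L(1) A(4,5)] chart_inv_left[OF N A(1,2)]
    by (simp add: \<phi>_def loc_rep_def)
  show ?thesis
    using cov_hess_compose[OF sF oT zT \<phi>(1) s\<phi> \<phi>(2) sG, unfolded \<phi>0] that by blast
qed

subsection \<open>The intersection as a submanifold\<close>

lemma smooth_on_metric:
  assumes g: "metric_on S g" and T: "open T" "\<And>x. x \<in> T \<Longrightarrow> P x \<in> S"
    and P: "smooth_on T P" and U: "smooth_on T U" and V: "smooth_on T V"
  shows "smooth_on T (\<lambda>x. g (P x) (U x) (V x))"
proof -
  note pf = metric_onD(2)[OF g T(2)]
  have 1: "smooth_on T (\<lambda>x. g (P x) a b)" for a b
    by (rule smooth_on_comp[OF T(1) metric_onD(1)[OF g] metric_onD(3)[OF g, of a b] P T(2)])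
  have 2: "smooth_on T (\<lambda>x. g (P x) (U x) b)" for b
    by (rule smooth_on_linear_field[where A="\<lambda>x a. g (P x) a b", OF T(1) pos_form_linear_left[OF pf] 1 U])
  show ?thesis
    by (rule smooth_on_linear_field[where A="\<lambda>x b. g (P x) (U x) b", OF T(1) pos_form_linear[OF pf] 2 V])
qed

text \<open>A single chart, \<open>P\<close> after \<open>snd d\<close>, covers \<open>S\<close>;
  its inverse comes from \<open>G\<close>. Continuity of \<open>P\<close> on an open ambient set
  makes the chart a homeomorphism for the subspace topology, and the metric is pulled back through
  the derivative of \<open>G\<close>.\<close>

lemma embedded_submanifold_exists:
  fixes M :: "('a, 'e::euclidean_space) riemannian" and G :: "'h::euclidean_space \<Rightarrow> 'e"
  assumes M: "riemannian_manifold M" and d: "d \<in> atlas M" and S: "S \<subseteq> fst d"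
    and Q: "open Q" "smooth_on Q G" and D: "open D" "smooth_on D P"
    and GQ: "G ` Q = snd d ` S" "G ` Q \<subseteq> D" and PG: "\<And>a. a \<in> Q \<Longrightarrow> P (G a) = a"
  shows "\<exists>L :: ('a, 'h) riemannian. embedded_submanifold M S L"
proof -
  note C = riemannian_charts[OF M]
  have ST: "S \<subseteq> topspace (mtop M)" using S chart_subset[OF C d] by blast
  define c :: "('a, 'h) chart" where "c = (S, \<lambda>y. P (snd d y))"
  define L :: "('a, 'h) riemannian" where "L = \<lparr>mtop = subtopology (mtop M) S, atlas = {c},
    metric = (\<lambda>p u v. metric_coeff M d (snd d p) (fderiv G (P (snd d p)) (u c)) (fderiv G (P (snd d p)) (v c)))\<rparr>"
  have fc: "fst c = S" and sc: "snd c y = P (snd d y)" for y by (simp_all add: c_def)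
  have mL: "mtop L = subtopology (mtop M) S" and aL: "atlas L = {c}"
    and gL: "metric L p u v = metric_coeff M d (snd d p) (fderiv G (P (snd d p)) (u c)) (fderiv G (P (snd d p)) (v c))" for p u v
    by (simp_all add: L_def)
  have GP: "P (snd d y) \<in> Q" "G (P (snd d y)) = snd d y" if "y \<in> S" for y
  proof -
    obtain a where "a \<in> Q" "G a = snd d y" using GQ(1) \<open>y \<in> S\<close> by (metis imageE imageI)
    then show "P (snd d y) \<in> Q" "G (P (snd d y)) = snd d y" using PG by metis+
  qed
  have dinv: "chart_inv d (snd d y) = y" if "y \<in> S" for y
    using chart_inv_left[OF C d] S that by blast
  have GS: "chart_inv d (G a) \<in> S" "snd d (chart_inv d (G a)) = G a" if a: "a \<in> Q" for a
  proof -
    obtain y where y: "y \<in> S" "G a = snd d y" using GQ(1) a by (metis imageE imageI)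
    then show "chart_inv d (G a) \<in> S" "snd d (chart_inv d (G a)) = G a" using dinv by auto
  qed
  have im: "snd c ` fst c = Q"
  proof
    show "snd c ` fst c \<subseteq> Q" using GP(1) by (auto simp: fc sc)
    show "Q \<subseteq> snd c ` fst c"
    proof
      fix a assume a: "a \<in> Q"
      have "snd c (chart_inv d (G a)) = a" using GS(2)[OF a] PG[OF a] by (simp add: sc)
      then show "a \<in> snd c ` fst c" using GS(1)[OF a] by (metis fc imageI)
    qed
  qed
  have homeo: "homeomorphic_maps (subtopology (mtop M) S) (top_of_set Q) (snd c) (\<lambda>a. chart_inv d (G a))"
    unfolding homeomorphic_maps_def
  proof (intro conjI ballI)
    have "continuous_map (subtopology (mtop M) S) euclidean (snd d)"
      using chart_continuous[OF C d] S continuous_map_from_subtopology_mono by blast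
    then have "continuous_map (subtopology (mtop M) S) (top_of_set D) (snd d)"
      using GQ by (auto simp: continuous_map_in_subtopology)
    moreover have "continuous_map (top_of_set D) euclidean P"
      using smooth_on_continuous_on[OF D(2)] by simp
    ultimately have "continuous_map (subtopology (mtop M) S) euclidean (P \<circ> snd d)"
      by (rule continuous_map_compose)
    then show "continuous_map (subtopology (mtop M) S) (top_of_set Q) (snd c)"
      using GP(1) by (auto simp: continuous_map_in_subtopology comp_def sc[abs_def])
    have "continuous_map (top_of_set Q) (top_of_set (snd d ` fst d)) G"
      using smooth_on_continuous_on[OF Q(2)] GQ(1) S by (auto simp: continuous_map_in_subtopology)
    from continuous_map_compose[OF this chart_inv_continuous[OF C d]]
    show "continuous_map (top_of_set Q) (subtopology (mtop M) S) (\<lambda>a. chart_inv d (G a))"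
      using GS(1) by (auto simp: continuous_map_in_subtopology comp_def)
    show "chart_inv d (G (snd c y)) = y" if "y \<in> topspace (subtopology (mtop M) S)" for y
      using that GP(2) dinv by (simp add: sc)
    show "snd c (chart_inv d (G a)) = a" if "a \<in> topspace (top_of_set Q)" for a
      using that GS(2) PG by (simp add: sc)
  qed
  have hm: "homeomorphic_map (subtopology (mtop L) (fst c)) (top_of_set (snd c ` fst c)) (snd c)"
    using homeo im by (auto simp: mL fc subtopology_subtopology homeomorphic_map_maps)
  have cinv0: "chart_inv c a = chart_inv d (G a)" if a: "a \<in> Q" for a
  proof -
    have "inj_on (snd c) (fst c)"
      by (rule inj_on_inverseI[where g="\<lambda>a. chart_inv d (G a)"]) (simp add: sc fc GP(2) dinv)
    from inv_into_f_f[OF this, of "chart_inv d (G a)"] show ?thesis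
      using GS[OF a] PG[OF a] by (simp add: chart_inv_def fc sc)
  qed
  have tr: "smooth_on (snd c ` (fst c \<inter> fst c)) (snd c \<circ> chart_inv c)"
    unfolding Int_absorb im
    by (rule smooth_on_cong[OF smooth_on_ident[OF Q(1)] Q(1)]) (simp add: cinv0 sc GS(2) PG)
  have topL: "topspace (mtop L) = S" using ST by (auto simp: mL)
  have smL: "smooth_manifold L"
    unfolding smooth_manifold_def
  proof (intro conjI)
    show "Hausdorff_space (mtop L)" "second_countable (mtop L)"
      using M by (simp_all add: mL riemannian_manifold_def smooth_manifold_def Hausdorff_space_subtopology second_countable_subtopology)
    have "openin (mtop L) S" using topL by (metis openin_topspace)
    then show "\<forall>c\<in>atlas L. openin (mtop L) (fst c) \<and> open (snd c ` fst c) \<and>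
        homeomorphic_map (subtopology (mtop L) (fst c)) (top_of_set (snd c ` fst c)) (snd c)"
      unfolding aL using hm im Q(1) fc by simp
  qed (use topL tr in \<open>simp_all add: aL fc\<close>)
  note CL = smooth_manifold_charts[OF smL]
  have cL: "c \<in> charts_at L p" if "p \<in> S" for p using that by (simp add: charts_at_iff aL fc)
  have caL: "c \<in> atlas L" by (simp add: aL)
  have Sd: "d \<in> charts_at M p" if "p \<in> S" for p using that S d by (auto simp: charts_at_iff)
  have lin: "linear (fderiv G a)" if "a \<in> Q" for a
    by (rule linear_frechet_derivative[OF smooth_on_differentiable[OF Q(2) that]])
  \<comment> \<open>Differentiating \<open>P (G a) = a\<close> makes the derivative of
    \<open>G\<close> injective, which gives both positivity of the pulled-back metric and the
    immersion property.\<close>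
  have PDG: "fderiv P (G a) (fderiv G a v) = v" if a: "a \<in> Q" for a v
  proof -
    have "fderiv (\<lambda>a. P (G a)) a v = fderiv P (G a) (fderiv G a v)"
      by (rule fderiv_compose[OF D(2) Q(2) a]) (use GQ(2) a in blast)
    moreover have "fderiv (\<lambda>a. a) a = fderiv (\<lambda>a. P (G a)) a"
      by (rule fderiv_cong[OF Q(1) a]) (simp_all add: PG)
    ultimately show ?thesis by (metis frechet_derivative_ident)
  qed
  have injG: "fderiv G a v = 0 \<longleftrightarrow> v = 0" if a: "a \<in> Q" for a v
  proof
    have z: "fderiv P (G a) 0 = 0" using PDG[OF a, of 0] linear_0[OF lin[OF a]] by simp
    show "v = 0" if "fderiv G a v = 0" using PDG[OF a, of v] z that by simp
  qed (simp add: linear_0[OF lin[OF a]])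
  note mM = metric_on_chart[OF M d]
  have GO: "G a \<in> snd d ` fst d" if "a \<in> Q" for a using GQ(1) S that by blast
  have pf: "pos_form (metric_coeff M d (snd d p))" if "p \<in> S" for p
    using metric_onD(2)[OF mM] S that by blast
  have coeff: "metric_coeff L c x a b = metric_coeff M d (G x) (fderiv G x a) (fderiv G x b)" if x: "x \<in> Q" for x a b
  proof -
    show ?thesis
      unfolding metric_coeff_def[of L] cinv0[OF x] Let_def gL
      by (simp add: coord_vector_chart[OF CL cL[OF GS(1)[OF x]]] GS(2)[OF x] PG[OF x])
  qed
  have rmL: "riemannian_manifold L"
    unfolding riemannian_manifold_def
  proof (intro conjI ballI allI impI)
    fix p u v assume p: "p \<in> topspace (mtop L)" and u: "u \<in> tangent_space L p" and v: "v \<in> tangent_space L p"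
    have pS: "p \<in> S" using p topL by simp
    note g = pf[OF pS] and l = lin[OF GP(1)[OF pS]]
    show "metric L p u v = metric L p v u" unfolding gL by (rule pos_form_sym[OF g])
    show "metric L p (\<lambda>d. u d + v d) w = metric L p u w + metric L p v w" for w
      unfolding gL by (simp add: linear_add[OF l] pos_form_add[OF g])
    show "metric L p (\<lambda>d. r *\<^sub>R u d) v = r * metric L p u v" for r
      unfolding gL by (simp add: linear_cmul[OF l] pos_form_scale[OF g])
    assume u0: "u \<noteq> (\<lambda>_. 0)"
    have "u c \<noteq> 0"
    proof
      assume "u c = 0"
      then have "u = coord_vector L c p 0" using coord_vector_eq[OF CL u cL[OF pS]] by simp
      also have "\<dots> = coord_vector L c p (0 *\<^sub>R 0)" by simp
      also have "\<dots> = (\<lambda>_. 0)" unfolding coord_vector_add(2)[OF CL cL[OF pS]] by simp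
      finally show False using u0 by simp
    qed
    then have "fderiv G (P (snd d p)) (u c) \<noteq> 0" using injG[OF GP(1)[OF pS]] by simp
    then show "0 < metric L p u u" unfolding gL by (rule pos_form_pos[OF g])
  next
    fix c' a b assume "c' \<in> atlas L"
    then have c': "c' = c" by (simp add: aL)
    have "smooth_on Q (\<lambda>x. metric_coeff M d (G x) (fderiv G x a) (fderiv G x b))"
      by (rule smooth_on_metric[OF mM Q(1) GO Q(2) smooth_on_fderiv_const[OF Q(2)] smooth_on_fderiv_const[OF Q(2)]])
    then show "smooth_on (snd c' ` fst c') (\<lambda>x. metric_coeff L c' x a b)"
      unfolding c' im by (rule smooth_on_cong[OF _ Q(1)]) (simp add: coeff)
  qed (rule smL)
  have smi: "smooth_map L M id"
    unfolding smooth_map_def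
  proof (intro conjI ballI)
    show "continuous_map (mtop L) (mtop M) id" unfolding mL by (rule continuous_map_id_subt)
    fix c' d' assume c': "c' \<in> atlas L" and d': "d' \<in> atlas M"
    have c': "c' = c" using c' by (simp add: aL)
    let ?Q = "snd c ` (fst c \<inter> id -` fst d')"
    have "openin (mtop L) (S \<inter> fst d')"
      unfolding mL using openin_subtopology_Int2[OF chart_openin[OF C d']] .
    from chart_image_open_Int[OF CL caL this] have oQ: "open ?Q" by (simp add: fc Int_assoc[symmetric])
    have QQ: "x \<in> Q \<and> G x \<in> snd d ` (fst d \<inter> fst d') \<and> chart_inv c x = chart_inv d (G x)" if x: "x \<in> ?Q" for x
    proof -
      obtain y where y: "y \<in> S" "y \<in> fst d'" "x = P (snd d y)" using x by (auto simp: fc sc)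
      then show ?thesis using GP[OF y(1)] S cinv0 by auto
    qed
    have "smooth_on ?Q (\<lambda>x. snd d' (chart_inv d (G x)))"
      by (rule smooth_on_comp[OF oQ transition_open[OF C d d'] transition_smooth[OF C d d'] smooth_on_subset[OF Q(2)]])
        (use QQ in blast)+
    then show "smooth_on (snd c' ` (fst c' \<inter> id -` fst d')) (snd d' \<circ> id \<circ> chart_inv c')"
      unfolding c' by (rule smooth_on_cong[OF _ oQ]) (use QQ in simp)
  qed
  have rep: "fderiv (loc_rep id c d) (snd c p) = fderiv G (P (snd d p))" if pS: "p \<in> S" for p
  proof -
    have "fderiv G (P (snd d p)) = fderiv (loc_rep id c d) (P (snd d p))"
    proof (rule fderiv_cong[OF Q(1) GP(1)[OF pS]])
      show "G y = loc_rep id c d y" if "y \<in> Q" for y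
        using cinv0[OF that] GS(2)[OF that] by (simp add: loc_rep_def)
    qed (rule smooth_on_differentiable[OF Q(2) GP(1)[OF pS]])
    then show ?thesis by (simp add: sc)
  qed
  have push: "pushforward L M id p u d = fderiv G (P (snd d p)) (u c)" if p: "p \<in> S" and u: "u \<in> tangent_space L p" for p u
    using pushforward_chart[OF CL C smi cL[OF p] _ u, of d] Sd[OF p] by (simp add: rep[OF p])
  have "isometric_immersion L M id"
    unfolding isometric_immersion_def immersion_def
  proof (intro conjI ballI smi)
    fix p assume p: "p \<in> topspace (mtop L)"
    then have pS: "p \<in> S" by (simp add: topL)
    show "inj_on (pushforward L M id p) (tangent_space L p)"
    proof (rule inj_onI)
      fix u v assume uv: "u \<in> tangent_space L p" "v \<in> tangent_space L p" "pushforward L M id p u = pushforward L M id p v"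
      have "fderiv G (P (snd d p)) (u c) = fderiv G (P (snd d p)) (v c)"
        using push[OF pS uv(1)] push[OF pS uv(2)] uv(3) by simp
      then have "u c = v c" using PDG[OF GP(1)[OF pS]] by metis
      then show "u = v" by (rule tangent_space_eqI[OF uv(1,2) cL[OF pS]])
    qed
    fix u v assume u: "u \<in> tangent_space L p" and v: "v \<in> tangent_space L p"
    have "metric M (id p) (pushforward L M id p u) (pushforward L M id p v) =
      metric_coeff M d (snd d (id p)) (pushforward L M id p u d) (pushforward L M id p v d)"
      by (rule metric_in_chart[OF C _ pushforward_tangent[OF CL C smi p u] pushforward_tangent[OF CL C smi p v]])
        (use Sd[OF pS] in simp)
    then show "metric L p u v = metric M (id p) (pushforward L M id p u) (pushforward L M id p v)"
      by (simp add: gL push[OF pS u] push[OF pS v])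
  qed
  then have "embedded_submanifold M S L" by (simp add: embedded_submanifold_def ST mL rmL)
  then show ?thesis by blast
qed

text \<open>The inclusion of the normal space in the tangent space of the other submanifold, read in
  the ambient chart \<open>d\<close>: the tangent vector with components \<open>w\<close> is normal,
  hence a pushforward.\<close>

lemma normal_in_range:
  fixes N :: "('b, 'f::euclidean_space) riemannian" and M :: "('a, 'e::euclidean_space) riemannian"
    and K :: "('c, 'g::euclidean_space) riemannian"
  assumes N: "smooth_charts N" and M: "smooth_charts M" and K: "smooth_charts K"
    and f: "smooth_map N M f" and h: "smooth_map K M h" and hr: "h r = f p"
    and sub: "normal_vectors N M f p \<subseteq> pushforward K M h r ` tangent_space K r"
    and c: "c \<in> charts_at N p" and k: "k \<in> charts_at K r" and d: "d \<in> charts_at M (f p)"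
    and w: "\<And>e. metric_coeff M d (snd d (f p)) w (fderiv (loc_rep f c d) (snd c p) e) = 0"
  shows "\<exists>v. w = fderiv (loc_rep h k d) (snd k r) v"
proof -
  have p: "p \<in> topspace (mtop N)" using c chart_subset[OF N, of c] unfolding charts_at_iff by blast
  have "coord_vector M d (f p) w \<in> normal_vectors N M f p"
    unfolding normal_vectors_def
  proof (intro CollectI conjI ballI)
    show t: "coord_vector M d (f p) w \<in> tangent_space M (f p)" by (rule coord_vector_tangent[OF M d])
    fix u assume u: "u \<in> tangent_space N p"
    show "metric M (f p) (coord_vector M d (f p) w) (pushforward N M f p u) = 0"
      using metric_in_chart[OF M d t pushforward_tangent[OF N M f p u]] w
      by (simp add: coord_vector_chart[OF M d] pushforward_chart[OF N M f c d u])
  qed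
  then obtain v where v: "v \<in> tangent_space K r" "coord_vector M d (f p) w = pushforward K M h r v"
    using sub by blast
  have "w = pushforward K M h r v d" using v(2) coord_vector_chart[OF M d] by metis
  also have "\<dots> = fderiv (loc_rep h k d) (snd k r) (v k)"
    by (rule pushforward_chart[OF K M h k _ v(1)]) (simp add: hr d)
  finally show ?thesis by blast
qed

text \<open>Orthogonal projection onto the range of \<open>A\<close>: its coefficient
  \<open>u\<close> is the Riesz representative, for the pulled-back form, of the functional sending
  \<open>b\<close> to \<open>g w (A b)\<close>. The remainder is normal and so lies in the range of
  \<open>B\<close>.\<close>

lemma transversal_of_normal:
  fixes A :: "'f::euclidean_space \<Rightarrow> 'e::euclidean_space" and g :: "'e \<Rightarrow> 'e \<Rightarrow> real"
  assumes g: "pos_form g" and A: "linear A" "inj A"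
    and B: "\<And>w. (\<And>e. g w (A e) = 0) \<Longrightarrow> \<exists>v. w = B v"
  shows "\<exists>u v. w = A u + B v"
proof -
  have "pos_form (\<lambda>a b. g (A a) (A b))"
    unfolding pos_form_def
  proof (intro conjI allI impI)
    show "g (A a) (A b) = g (A b) (A a)" for a b by (rule pos_form_sym[OF g])
    show "linear (\<lambda>b. g (A a) (A b))" for a
      using linear_compose[OF A(1) pos_form_linear[OF g]] by (simp add: comp_def)
    show "g (A a) (A a) > 0" if "a \<noteq> 0" for a
      by (rule pos_form_pos[OF g]) (use A that linear_injective_0 in blast)
  qed
  moreover have "linear (\<lambda>b. g w (A b))"
    using linear_compose[OF A(1) pos_form_linear[OF g]] by (simp add: comp_def)
  ultimately obtain u where u: "\<And>e. g (A u) (A e) = g w (A e)"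
    using pos_form_riesz[of "\<lambda>a b. g (A a) (A b)" "\<lambda>b. g w (A b)"] by blast
  have "\<exists>v. w - A u = B v" by (rule B) (simp add: pos_form_diff[OF g] u)
  then show ?thesis by (metis add.commute diff_add_cancel)
qed

text \<open>Transversality forces the intersection to have dimension
  \<open>DIM('f) + DIM('g) - DIM('e)\<close>, which is already the dimension of the range of
  \<open>C\<close> inside it.\<close>

lemma range_Int_transversal:
  fixes A :: "'f::euclidean_space \<Rightarrow> 'e::euclidean_space" and B :: "'g::euclidean_space \<Rightarrow> 'e"
    and C :: "'h::euclidean_space \<Rightarrow> 'e"
  assumes A: "linear A" "inj A" and B: "linear B" "inj B" and C: "linear C" "inj C"
    and sub: "range C \<subseteq> range A" "range C \<subseteq> range B" and trans: "\<And>w. \<exists>u v. w = A u + B v"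
    and dims: "DIM('h) + DIM('e) = DIM('f) + DIM('g)"
  shows "range A \<inter> range B = range C"
proof -
  have sA: "subspace (range A)" and sB: "subspace (range B)" and sC: "subspace (range C)"
    using linear_subspace_image[OF _ subspace_UNIV] A(1) B(1) C(1) by blast+
  have "{x + y |x y. x \<in> range A \<and> y \<in> range B} = UNIV" using trans by blast
  then have "dim (range A \<inter> range B) = DIM('h)"
    using dim_sums_Int[OF sA sB] dims dim_image_eq[OF A(1), of UNIV] dim_image_eq[OF B(1), of UNIV] A(2) B(2) by simp
  moreover have "dim (range C) = DIM('h)" using dim_image_eq[OF C(1), of UNIV] C(2) by simp
  ultimately show ?thesis
    using subspace_dim_equal[OF sC subspace_inter[OF sA sB]] sub by auto
qed

text \<open>Immersed submanifolds may return to \<open>q\<close>, so the intersection is formed from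
  the sheets through \<open>p\<close> and \<open>r\<close> alone, over sufficiently small
  neighbourhoods. Quantifying over all smaller \<open>U\<close>, \<open>V\<close> and all structures
  \<open>L\<close> makes the result independent of these choices, and the existence of
  \<open>L\<close> keeps it from being vacuous.\<close>

theorem theorem6:
  fixes Mb :: "('a, 'e::euclidean_space) riemannian"
    and \<Sigma> :: "('b, 'f::euclidean_space) riemannian" and f :: "'b \<Rightarrow> 'a" and p :: 'b
    and M :: "('c, 'g::euclidean_space) riemannian" and h :: "'c \<Rightarrow> 'a" and r :: 'c
    and q :: 'a and m n s :: nat
  assumes "riemannian_manifold Mb" and "DIM('e) = m + n"
    and "riemannian_manifold \<Sigma>" and "DIM('f) = m" and "m \<ge> 2"
    and "isometric_immersion \<Sigma> Mb f" and "p \<in> topspace (mtop \<Sigma>)" and "f p = q"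
    and "umbilic \<Sigma> Mb f p"
    and "0 < s" and "s \<le> m - 1" and "DIM('h::euclidean_space) = s"
    and "riemannian_manifold M" and "DIM('g) = s + n"
    and "isometric_immersion M Mb h" and "r \<in> topspace (mtop M)" and "h r = q"
    and "totally_geodesic_at M Mb h r"
    and "normal_vectors \<Sigma> Mb f p \<subseteq> pushforward M Mb h r ` tangent_space M r"
  shows "\<exists>U\<^sub>0 V\<^sub>0. openin (mtop \<Sigma>) U\<^sub>0 \<and> p \<in> U\<^sub>0 \<and> openin (mtop M) V\<^sub>0 \<and> r \<in> V\<^sub>0 \<and>
    (\<forall>U V. openin (mtop \<Sigma>) U \<and> p \<in> U \<and> U \<subseteq> U\<^sub>0 \<and> openin (mtop M) V \<and> r \<in> V \<and> V \<subseteq> V\<^sub>0 \<longrightarrow>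
       (\<exists>L :: ('a, 'h) riemannian. embedded_submanifold Mb (f ` U \<inter> h ` V) L) \<and>
       (\<forall>L :: ('a, 'h) riemannian. embedded_submanifold Mb (f ` U \<inter> h ` V) L \<longrightarrow>
          mean_curvature L Mb id q = mean_curvature \<Sigma> Mb f p))"
proof -
  note rB = assms(1) and rS = assms(3) and rM = assms(13)
  note CB = riemannian_charts[OF rB] and CS = riemannian_charts[OF rS] and CM = riemannian_charts[OF rM]
  note isf = assms(6) and ish = assms(15)
  have imf: "immersion \<Sigma> Mb f" and imh: "immersion M Mb h"
    using isf ish by (simp_all add: isometric_immersion_def)
  then have sf: "smooth_map \<Sigma> Mb f" and sh: "smooth_map M Mb h" by (simp_all add: immersion_def)
  have q: "q = f p" and hr: "h r = f p" using assms(8,17) by simp_all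
  have dims: "DIM('h) + DIM('e) = DIM('f) + DIM('g)" using assms by simp
  have qT: "f p \<in> topspace (mtop Mb)"
    using sf assms(7) unfolding smooth_map_def continuous_map_def by blast
  define c where "c = chart0 \<Sigma> p"
  define k where "k = chart0 M r"
  define d0 where "d0 = chart0 Mb (f p)"
  have c: "c \<in> charts_at \<Sigma> p" unfolding c_def by (rule chart0_in[OF CS assms(7)])
  have k: "k \<in> charts_at M r" unfolding k_def by (rule chart0_in[OF CM assms(16)])
  have d0: "d0 \<in> charts_at Mb (f p)" unfolding d0_def by (rule chart0_in[OF CB qT])
  have cA: "c \<in> atlas \<Sigma>" "p \<in> fst c" and kA: "k \<in> atlas M" "r \<in> fst k" using c k by (auto simp: charts_at_iff)
  let ?F = "loc_rep f c" and ?H = "loc_rep h k" and ?x = "snd c p" and ?y = "snd k r"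
  have dr: "d \<in> charts_at Mb (h r)" if "d \<in> charts_at Mb (f p)" for d using that by (simp add: hr)
  have injF: "inj (fderiv (?F d) ?x)" if "d \<in> charts_at Mb (f p)" for d
    by (rule immersion_fderiv_inj[OF CS CB imf c that])
  have injH: "inj (fderiv (?H d) ?y)" if "d \<in> charts_at Mb (f p)" for d
    by (rule immersion_fderiv_inj[OF CM CB imh k dr[OF that]])
  have linF: "linear (fderiv (?F d) ?x)" if "d \<in> charts_at Mb (f p)" for d
    by (rule linear_frechet_derivative[OF smooth_on_differentiable[OF loc_rep_smooth[OF CS CB sf cA(1)] loc_dom_at[OF CS CB sf c that]]])
      (use that in \<open>simp add: charts_at_iff\<close>)
  have linH: "linear (fderiv (?H d) ?y)" if "d \<in> charts_at Mb (f p)" for d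
    by (rule linear_frechet_derivative[OF smooth_on_differentiable[OF loc_rep_smooth[OF CM CB sh kA(1)] loc_dom_at[OF CM CB sh k dr[OF that]]]])
      (use that in \<open>simp add: charts_at_iff\<close>)
  have pg: "pos_form (metric_coeff Mb d (snd d (f p)))" if "d \<in> charts_at Mb (f p)" for d
    by (rule metric_onD(2)[OF metric_on_chart[OF rB]]) (use that in \<open>auto simp: charts_at_iff\<close>)
  have nr: "\<exists>v. w = fderiv (?H d) ?y v"
    if "d \<in> charts_at Mb (f p)" "\<And>e. metric_coeff Mb d (snd d (f p)) w (fderiv (?F d) ?x e) = 0" for d w
    by (rule normal_in_range[OF CS CB CM sf sh hr assms(19) c k that])
  have trans: "\<exists>u v. w = fderiv (?F d) ?x u + fderiv (?H d) ?y v" if "d \<in> charts_at Mb (f p)" for d w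
    by (rule transversal_of_normal[OF pg[OF that] linF[OF that] injF[OF that] nr[OF that]])
  have d0A: "d0 \<in> atlas Mb" using d0 by (simp add: charts_at_iff)
  note F = loc_dom_open[OF CS CB sf cA(1) d0A] loc_rep_smooth[OF CS CB sf cA(1) d0A] loc_dom_at[OF CS CB sf c d0] injF[OF d0]
  note H = loc_dom_open[OF CM CB sh kA(1) d0A] loc_rep_smooth[OF CM CB sh kA(1) d0A] loc_dom_at[OF CM CB sh k dr[OF d0]] injH[OF d0]
  obtain B1 D1 P1 where 1: "open B1" "?x \<in> B1" "B1 \<subseteq> loc_dom f c d0" "open D1" "?F d0 ` B1 \<subseteq> D1" "smooth_on D1 P1"
    "\<And>x. x \<in> B1 \<Longrightarrow> P1 (?F d0 x) = x"
    using immersion_left_inverse[OF F] by blast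
  obtain B2 D2 P2 where 2: "open B2" "?y \<in> B2" "B2 \<subseteq> loc_dom h k d0" "open D2" "?H d0 ` B2 \<subseteq> D2" "smooth_on D2 P2"
    "\<And>x. x \<in> B2 \<Longrightarrow> P2 (?H d0 x) = x"
    using immersion_left_inverse[OF H] by blast
  have "?F d0 ?x = ?H d0 ?y"
    by (simp add: loc_rep_at[OF CS CB sf c] loc_rep_at[OF CM CB sh k] hr)
  from transversal_intersection[where 'h='h, OF F H this trans[OF d0] dims]
  obtain C1 C2 where C: "open C1" "?x \<in> C1" "C1 \<subseteq> loc_dom f c d0" "open C2" "?y \<in> C2" "C2 \<subseteq> loc_dom h k d0"
    and Cex: "\<forall>A B. open A \<and> A \<subseteq> C1 \<and> open B \<and> B \<subseteq> C2 \<longrightarrow>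
      (\<exists>Q (G::'h \<Rightarrow> 'e) D P. open Q \<and> smooth_on Q G \<and> open D \<and> smooth_on D P \<and>
         G ` Q = ?F d0 ` A \<inter> ?H d0 ` B \<and> G ` Q \<subseteq> D \<and> (\<forall>a\<in>Q. P (G a) = a))"
    by (elim exE conjE) (rule that; assumption)
  \<comment> \<open>\<open>B1\<close> and \<open>B2\<close> carry the left inverses used for the
    lifts, \<open>C1\<close> and \<open>C2\<close> the local description of the intersection; both
    are required on the same neighbourhoods.\<close>
  define U0 where "U0 = {y \<in> fst c. snd c y \<in> B1 \<inter> C1}"
  define V0 where "V0 = {y \<in> fst k. snd k y \<in> B2 \<inter> C2}"
  have U0: "openin (mtop \<Sigma>) U0" "p \<in> U0"
    unfolding U0_def using chart_preimage_open[OF CS cA(1), of "B1 \<inter> C1"] 1 C cA by auto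
  have V0: "openin (mtop M) V0" "r \<in> V0"
    unfolding V0_def using chart_preimage_open[OF CM kA(1), of "B2 \<inter> C2"] 2 C kA by auto
  have main: "(\<exists>L :: ('a, 'h) riemannian. embedded_submanifold Mb (f ` U \<inter> h ` V) L) \<and>
       (\<forall>L :: ('a, 'h) riemannian. embedded_submanifold Mb (f ` U \<inter> h ` V) L \<longrightarrow>
          mean_curvature L Mb id q = mean_curvature \<Sigma> Mb f p)"
    if U: "openin (mtop \<Sigma>) U" "p \<in> U" "U \<subseteq> U0" and V: "openin (mtop M) V" "r \<in> V" "V \<subseteq> V0" for U V
  proof (intro conjI allI impI)
    let ?S = "f ` U \<inter> h ` V"
    have Uc: "U \<subseteq> fst c" and Vk: "V \<subseteq> fst k" using U(3) V(3) by (auto simp: U0_def V0_def)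
    have oA: "open (snd c ` U)" using chart_image_open_Int[OF CS cA(1) U(1)] Uc by (simp add: Int_absorb1)
    have oB: "open (snd k ` V)" using chart_image_open_Int[OF CM kA(1) V(1)] Vk by (simp add: Int_absorb1)
    have AC: "snd c ` U \<subseteq> C1" and BC: "snd k ` V \<subseteq> C2" using U(3) V(3) by (auto simp: U0_def V0_def)
    have Ff: "?F d0 (snd c y) = snd d0 (f y)" if "y \<in> U" for y
      using chart_inv_left[OF CS cA(1)] Uc that by (auto simp: loc_rep_def)
    have Hh: "?H d0 (snd k y) = snd d0 (h y)" if "y \<in> V" for y
      using chart_inv_left[OF CM kA(1)] Vk that by (auto simp: loc_rep_def)
    have fU: "f y \<in> fst d0" if "y \<in> U" for y
    proof -
      have "y \<in> fst c" "snd c y \<in> loc_dom f c d0" using AC C(3) Uc that by blast+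
      then show ?thesis
        using loc_rep_in(3)[OF CS CB sf cA(1), of "snd c y" d0] chart_inv_left[OF CS cA(1), of y] by simp
    qed
    have hV: "h y \<in> fst d0" if "y \<in> V" for y
    proof -
      have "y \<in> fst k" "snd k y \<in> loc_dom h k d0" using BC C(6) Vk that by blast+
      then show ?thesis
        using loc_rep_in(3)[OF CM CB sh kA(1), of "snd k y" d0] chart_inv_left[OF CM kA(1), of y] by simp
    qed
    \<comment> \<open>Injectivity of the chart \<open>d0\<close> lets the intersection be taken
      before or after passing to coordinates.\<close>
    have dS: "?F d0 ` snd c ` U \<inter> ?H d0 ` snd k ` V = snd d0 ` ?S"
    proof -
      have "?F d0 ` snd c ` U = snd d0 ` f ` U" "?H d0 ` snd k ` V = snd d0 ` h ` V"
        using Ff Hh by (simp_all add: image_image)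
      moreover have "snd d0 ` f ` U \<inter> snd d0 ` h ` V = snd d0 ` ?S"
        by (rule inj_on_image_Int[OF chart_inj[OF CB d0A], symmetric]) (use fU hV in auto)
      ultimately show ?thesis by simp
    qed
    obtain Q and G :: "'h \<Rightarrow> 'e" and D P where Q: "open Q" "smooth_on Q G" "open D" "smooth_on D P"
      "G ` Q = ?F d0 ` snd c ` U \<inter> ?H d0 ` snd k ` V" "G ` Q \<subseteq> D" "\<forall>a\<in>Q. P (G a) = a"
      using Cex[rule_format, OF conjI[OF oA conjI[OF AC conjI[OF oB BC]]]] by (elim exE conjE) (rule that; assumption)
    show "\<exists>L :: ('a, 'h) riemannian. embedded_submanifold Mb ?S L"
      by (rule embedded_submanifold_exists[OF rB d0A _ Q(1-4) _ Q(6) bspec[OF Q(7)]]) (use fU Q(5) dS in auto)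
    fix L :: "('a, 'h) riemannian" assume L: "embedded_submanifold Mb ?S L"
    have rL: "riemannian_manifold L" and isL: "isometric_immersion L Mb id" and mtL: "mtop L = subtopology (mtop Mb) ?S"
      and SM: "?S \<subseteq> topspace (mtop Mb)"
      using L by (auto simp: embedded_submanifold_def)
    note CL = riemannian_charts[OF rL]
    have imL: "immersion L Mb id" using isL by (simp add: isometric_immersion_def)
    then have sL: "smooth_map L Mb id" by (simp add: immersion_def)
    have topL: "topspace (mtop L) = ?S" using mtL SM by auto
    have qL: "f p \<in> topspace (mtop L)" using U(2) V(2) hr topL by (metis IntI imageI)
    define l where "l = chart0 L (f p)"
    have l: "l \<in> charts_at L (f p)" unfolding l_def by (rule chart0_in[OF CL qL])
    have lr: "l \<in> charts_at L (h r)" by (simp add: l hr)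
    have topL1: "topspace (mtop L) \<subseteq> f ` {y \<in> fst c. snd c y \<in> B1}"
      and topL2: "topspace (mtop L) \<subseteq> h ` {y \<in> fst k. snd k y \<in> B2}"
      using topL U(3) V(3) by (auto simp: U0_def V0_def)
    let ?G = "loc_rep id l" and ?z = "snd l (f p)"
    let ?Hm = "mean_curvature \<Sigma> Mb f p"
    have "second_fundamental_form L Mb id (f p) u u d = metric L (f p) u u *\<^sub>R ?Hm d"
      if u: "u \<in> tangent_space L (f p)" for u d
    proof (cases "d \<in> charts_at Mb (f p)")
      \<comment> \<open>Outside the charts around \<open>f p\<close> both sides take the default
        value 0.\<close>
      case False
      have "?Hm d = 0"
        unfolding mean_curvature_def Let_def
      proof (simp, intro disjI2 sum.neutral ballI)
        fix e assume e: "e \<in> (SOME E. orthonormal_basis \<Sigma> p E)"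
        then have "e \<in> tangent_space \<Sigma> p"
          using orthonormal_basis_exists[OF rS assms(7)] by (auto simp: orthonormal_basis_def)
        from second_fundamental_form_chart[OF CS CB sf assms(7) this]
        show "second_fundamental_form \<Sigma> Mb f p e e d = 0" using False by simp
      qed
      then show ?thesis using second_fundamental_form_chart[OF CL CB sL qL u, of u d] False by simp
    next
      case d: True
      have did: "d \<in> charts_at Mb (id (f p))" using d by simp
      have dA: "d \<in> atlas Mb" using d by (simp add: charts_at_iff)
      let ?g = "metric_coeff Mb d (snd d (f p))"
      let ?cg = "metric_coeff Mb d"
      note g = pg[OF d]
      define a where "a = u l"
      have G0: "linear (fderiv (?G d) ?z)"
        by (rule linear_frechet_derivative[OF smooth_on_differentiable[OF loc_rep_smooth[OF CL CB sL _ dA] loc_dom_at[OF CL CB sL l did]]])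
          (use l in \<open>simp add: charts_at_iff\<close>)
      have Gi: "inj (fderiv (?G d) ?z)" by (rule immersion_fderiv_inj[OF CL CB imL l did])
      note cov1 = submanifold_cov_hess[OF CS CB sf c d0 1(4,6,5,7,3,2) CL sL topL1 l d]
      note cov2 = submanifold_cov_hess[OF CM CB sh k dr[OF d0] 2(4,6,5,7,3,2) CL sL topL2 lr dr[OF d], unfolded hr]
      have sub1: "range (fderiv (?G d) ?z) \<subseteq> range (fderiv (?F d) ?x)"
      proof (rule image_subsetI)
        fix v
        obtain a' where "fderiv (?G d) ?z v = fderiv (?F d) ?x a'" by (rule cov1[where g="?cg" and a=v]) blast
        then show "fderiv (?G d) ?z v \<in> range (fderiv (?F d) ?x)" by simp
      qed
      have sub2: "range (fderiv (?G d) ?z) \<subseteq> range (fderiv (?H d) ?y)"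
      proof (rule image_subsetI)
        fix v
        obtain a' where "fderiv (?G d) ?z v = fderiv (?H d) ?y a'" by (rule cov2[where g="?cg" and a=v]) blast
        then show "fderiv (?G d) ?z v \<in> range (fderiv (?H d) ?y)" by simp
      qed
      \<comment> \<open>The tangent space of the intersection is the intersection of the tangent
        spaces: \<open>sub1\<close> and \<open>sub2\<close> come from the lifts, equality from the
        dimensions.\<close>
      have rng: "range (fderiv (?F d) ?x) \<inter> range (fderiv (?H d) ?y) = range (fderiv (?G d) ?z)"
        by (rule range_Int_transversal[OF linF[OF d] injF[OF d] linH[OF d] injH[OF d] G0 Gi sub1 sub2 trans[OF d] dims])
      have sF: "subspace (range (fderiv (?F d) ?x))" and sH: "subspace (range (fderiv (?H d) ?y))"
        using linear_subspace_image[OF _ subspace_UNIV] linF[OF d] linH[OF d] by blast+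
      obtain a1 w1 where a1: "fderiv (?G d) ?z a = fderiv (?F d) ?x a1"
        "cov_hess ?cg (?G d) ?z a a = cov_hess ?cg (?F d) ?x a1 a1 + fderiv (?F d) ?x w1"
        by (rule cov1[where g="?cg" and a=a]) blast
      obtain a2 w2 where a2: "fderiv (?G d) ?z a = fderiv (?H d) ?y a2"
        "cov_hess ?cg (?G d) ?z a a = cov_hess ?cg (?H d) ?y a2 a2 + fderiv (?H d) ?y w2"
        by (rule cov2[where g="?cg" and a=a]) blast
      define II where "II = second_fundamental_form L Mb id (f p) u u d"
      obtain b where b: "II = cov_hess ?cg (?G d) ?z a a - fderiv (?G d) ?z b"
        using second_fundamental_form_chart[OF CL CB sL qL u, of u d] did by (simp add: II_def l_def[symmetric] a_def)
      define \<mu> where "\<mu> = ?g (fderiv (?G d) ?z a) (fderiv (?G d) ?z a)"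
      have met: "metric L (f p) u u = \<mu>"
      proof -
        have "metric L (f p) u u = metric Mb (id (f p)) (pushforward L Mb id (f p) u) (pushforward L Mb id (f p) u)"
          using isL qL u by (simp add: isometric_immersion_def)
        also have "\<dots> = metric_coeff Mb d (snd d (id (f p))) (pushforward L Mb id (f p) u d) (pushforward L Mb id (f p) u d)"
          by (intro metric_in_chart[OF CB did] pushforward_tangent[OF CL CB sL qL u])
        finally show ?thesis
          unfolding \<mu>_def a_def pushforward_chart[OF CL CB sL l did u] id_apply[of "f p"] .
      qed
      \<comment> \<open>Umbilicity is applied to the vector tangent to \<Sigma> with component
        \<open>a1\<close>. By the lift its pushforward has the same components in \<open>d\<close>
        as that of \<open>u\<close>, hence the same squared length \<mu>.\<close>
      have umb: "\<exists>b1. cov_hess ?cg (?F d) ?x a1 a1 - fderiv (?F d) ?x b1 = \<mu> *\<^sub>R ?Hm d"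
      proof -
        let ?u1 = "coord_vector \<Sigma> c p a1"
        note t = coord_vector_tangent[OF CS c, of a1]
        have "second_fundamental_form \<Sigma> Mb f p ?u1 ?u1 d =
          metric Mb (f p) (pushforward \<Sigma> Mb f p ?u1) (pushforward \<Sigma> Mb f p ?u1) *\<^sub>R ?Hm d"
          using assms(9) t unfolding umbilic_def by metis
        also have "metric Mb (f p) (pushforward \<Sigma> Mb f p ?u1) (pushforward \<Sigma> Mb f p ?u1) = \<mu>"
          using metric_in_chart[OF CB d pushforward_tangent[OF CS CB sf assms(7) t] pushforward_tangent[OF CS CB sf assms(7) t]]
          by (simp add: \<mu>_def a1(1) pushforward_chart[OF CS CB sf c d t] coord_vector_chart[OF CS c])
        finally show ?thesis
          using second_fundamental_form_chart[OF CS CB sf assms(7) t, of ?u1 d] d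
          by (auto simp: c_def[symmetric] coord_vector_chart[OF CS c])
      qed
      then obtain b1 where b1: "cov_hess ?cg (?F d) ?x a1 a1 = fderiv (?F d) ?x b1 + \<mu> *\<^sub>R ?Hm d"
        by (metis add.commute diff_add_cancel)
      note tgm = totally_geodesic_cov_hess[OF rM CB sh assms(18) k dr[OF d], of a2]
      have Hn: "?g (?Hm d) (fderiv (?F d) ?x e) = 0" for e
        using mean_curvature_normal[OF rS rB isf assms(7) d, of e] by (simp add: c_def)
      define X where "X = II - \<mu> *\<^sub>R ?Hm d"
      have "fderiv (?G d) ?z b \<in> range (fderiv (?F d) ?x)" "fderiv (?G d) ?z b \<in> range (fderiv (?H d) ?y)"
        using sub1 sub2 by blast+
      note Gb = this
      have "X = fderiv (?F d) ?x b1 + fderiv (?F d) ?x w1 - fderiv (?G d) ?z b"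
        by (simp add: X_def b a1(2) b1)
      then have X1: "X \<in> range (fderiv (?F d) ?x)"
        using sF Gb(1) by (simp add: subspace_add subspace_diff)
      \<comment> \<open>On the side of \<open>M\<close>, total geodesicity makes the covariant
        Hessian itself tangent, so that only the mean curvature term remains to be placed in the
        range.\<close>
      have "X = fderiv (?H d) ?y (christoffel_of (metric_coeff M k) ?y a2 a2) + fderiv (?H d) ?y w2
          - fderiv (?G d) ?z b - \<mu> *\<^sub>R ?Hm d"
        by (simp add: X_def b a2(2) tgm)
      moreover have "?Hm d \<in> range (fderiv (?H d) ?y)" using nr[OF d Hn] by blast
      ultimately have X2: "X \<in> range (fderiv (?H d) ?y)"
        using sH Gb(2) by (simp add: subspace_add subspace_diff subspace_scale)
      obtain e where e: "X = fderiv (?G d) ?z e" using X1 X2 rng by blast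
      obtain e1 where e1: "X = fderiv (?F d) ?x e1" using X1 by blast
      \<comment> \<open>Writing \<open>X\<close> through \<open>e\<close>, as a vector tangent to
        the intersection, makes it orthogonal to \<open>II\<close>; writing it through
        \<open>e1\<close>, as a vector tangent to \<Sigma>, makes it orthogonal to the mean
        curvature vector.\<close>
      have "?g II X = 0"
        unfolding e II_def l_def
        by (rule second_fundamental_form_normal[OF rL rB isL qL u did, unfolded id_apply[of "f p"]])
      moreover have "?g (?Hm d) X = 0" unfolding e1 by (rule Hn)
      ultimately have "?g X X = 0" by (simp add: X_def pos_form_diff(1)[OF g] pos_form_scale(1)[OF g])
      then have "X = 0" using pos_form_pos[OF g, of X] by force
      then show ?thesis by (simp add: X_def II_def met)
    qed
    then show "mean_curvature L Mb id q = ?Hm"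
      unfolding q by (rule mean_curvature_eqI[OF rL qL])
  qed
  show ?thesis
    using U0 V0 main by (intro exI[of _ U0] exI[of _ V0]) blast
qed

end
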